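(* Let $\mu\in\mathbb R$, $T>0$, $r>3/2$, and assume that the cubic Schrödinger equation $$i\partial_t u=-\partial_x^2u+\mu|u|^2u\quad\text{on }(0,T)\times\mathbb T,\qquad u(0)=u_0,$$ admits an exact solution $u\in C([0,T];H^r(\mathbb T))$. For $\tau=T/N_c$, $N_c\in\mathbb N$, let $U_n=u(n\tau)$ and let $U_n^k$ be the parareal approximation at the $k$-th iteration and $n$-th coarse grid point obtained with the exact fine propagator $\mathcal F_\tau$ and the coarse propagator $\mathcal G_\tau(v)=e^{i\tau\partial_x^2}v+\Phi_{c,2}(\tau;v)$, where $$\begin{aligned}\Phi_{c,2}(\tau;v)&=e^{i\tau\partial_x^2}\big(e^{-2i\mu\tau(M(v)+P(v)\partial_x^{-1})}-1\big)v-i\mu\tau\,\Pi_0(|v|^2v)+2i\mu\tau M(v)\Pi_0(v)\\&\quad-\frac{\mu}{2}\partial_x^{-2}\Big[\big(e^{-i\tau\partial_x^2}\bar v\big)\,e^{i\tau\partial_x^2}(v^2)\Big]+\frac{\mu}{2}e^{i\tau\partial_x^2}\partial_x^{-2}\big[|v|^2v\big]\\&\quad+\mu\,\partial_x^{-1}\Big[\big(e^{i\tau\partial_x^2}v\big)\,\partial_x^{-1}\big(|e^{i\tau\partial_x^2}v|^2\big)\Big]-\mu\,e^{i\tau\partial_x^2}\partial_x^{-1}\Big[v\,\partial_x^{-1}\big(|v|^2\big)\Big].\end{aligned}$$ Then there exist constants $\tau_0,C_1,C_2>0$, independent of $n$ and $k$, such that for every such $\tau$ with $0<\tau\le\tau_0$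 and all $k\ge0$, $$\max_{1\le n\le N_c}\|U_n^k-U_n\|_{H^r}\le C_1(C_2\tau)^k .$$
   Context: $\mathbb T=(0,2\pi)$ with periodic boundary conditions. Fourier series: $f(x)=\sum_{k\in\mathbb Z}\hat f_k e^{ikx}$. $\Pi_0(f)=\frac1{2\pi}\int_{\mathbb T}f\,dx$, $M(v)=\Pi_0(|v|^2)$, $P(v)=\Pi_0(v\,\partial_x\bar v)$. The regularized inverse derivative is $\partial_x^{-1}f(x)=\sum_{k\ne0}(ik)^{-1}\hat f_k e^{ikx}$ (zero mode set to $0$), and $\partial_x^{-2}=(\partial_x^{-1})^2$. The operator $e^{-2i\mu\tau(M(v)+P(v)\partial_x^{-1})}$ is the Fourier multiplier with symbol $e^{-2i\mu\tau(M(v)+P(v)(ik)^{-1})}$ for $k\ne0$ and $e^{-2i\mu\tau M(v)}$ for $k=0$. Solutions are understood in the Duhamel (mild) sense. Exact fine propagator: $\mathcal F_\tau(v)$ is the value at time $\tau$ of the exact ($C([0,\tau];H^r)$, mild) solution of the equation with initial value $v\in H^r(\mathbb T)$ at time $0$. Parareal algorithm with coarse step $\tau=T/N_c$: $U_0^k=u_0$ for all $k\ge0$; $$U_{n+1}^0=\mathcal G_\tau(U_n^0),\qquad U_{n+1}^{k+1}=\mathcal G_\tau(U_n^{k+1})+\mathcal F_\tau(U_n^k)-\mathcal G_\tau(U_n^k),$$ for $n=0,\dots,N_c-1$ and $k\ge0$. *)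

theory Defs
  imports "HOL-Analysis.Analysis"
begin

text \<open>
  Functions on the torus are \<open>2 * pi\<close>-periodic functions of type \<open>real \<Rightarrow> complex\<close>.
\<close>

definition Pi0 :: "(real \<Rightarrow> complex) \<Rightarrow> complex" where
  "Pi0 f = integral {0..2 * pi} f / of_real (2 * pi)"

definition fourier_coeff :: "(real \<Rightarrow> complex) \<Rightarrow> int \<Rightarrow> complex" where
  "fourier_coeff f k = Pi0 (\<lambda>x. f x * exp (- \<i> * of_int k * of_real x))"

text \<open>
  The Sobolev space of order \<open>r\<close> on the torus, for \<open>r > 1/2\<close>.  By Sobolev embedding, every class of
  functions in this space then has exactly one continuous representative, and the set below consists
  of these representatives; so equality in the space is equality of functions.
  (For \<open>r \<le> 1/2\<close> the set would be too small; it is only used for \<open>r > 3/2\<close>.)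
\<close>

definition sobolev :: "real \<Rightarrow> (real \<Rightarrow> complex) set" where
  "sobolev r = {f. continuous_on UNIV f \<and> (\<forall>x. f (x + 2 * pi) = f x) \<and>
     (\<lambda>k::int. (1 + (of_int k)\<^sup>2) powr r * (cmod (fourier_coeff f k))\<^sup>2) summable_on UNIV}"

definition sobolev_norm :: "real \<Rightarrow> (real \<Rightarrow> complex) \<Rightarrow> real" where
  "sobolev_norm r f =
     sqrt (\<Sum>\<^sub>\<infinity>k::int. (1 + (of_int k)\<^sup>2) powr r * (cmod (fourier_coeff f k))\<^sup>2)"

text \<open>
  The series converges absolutely whenever the multiplier \<open>m\<close> is bounded and \<open>f\<close> lies in
  \<open>sobolev r\<close> with \<open>r > 1/2\<close>.
\<close>

definition fourier_multiplier ::
  "(int \<Rightarrow> complex) \<Rightarrow> (real \<Rightarrow> complex) \<Rightarrow> (real \<Rightarrow> complex)" where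
  "fourier_multiplier m f =
     (\<lambda>x. \<Sum>\<^sub>\<infinity>k::int. m k * fourier_coeff f k * exp (\<i> * of_int k * of_real x))"

text \<open>The free Schroedinger group, with generator \<open>\<i> \<partial>\<^sub>x\<^sup>2\<close>.\<close>

definition schroedinger_group :: "real \<Rightarrow> (real \<Rightarrow> complex) \<Rightarrow> (real \<Rightarrow> complex)" where
  "schroedinger_group t = fourier_multiplier (\<lambda>k. exp (- \<i> * of_real t * (of_int k)\<^sup>2))"

definition inv_deriv_symbol :: "int \<Rightarrow> complex" where
  "inv_deriv_symbol k = (if k = 0 then 0 else 1 / (\<i> * of_int k))"

definition inv_deriv :: "(real \<Rightarrow> complex) \<Rightarrow> (real \<Rightarrow> complex)" where
  "inv_deriv = fourier_multiplier inv_deriv_symbol"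

definition mass :: "(real \<Rightarrow> complex) \<Rightarrow> complex" where
  "mass v = Pi0 (\<lambda>x. of_real ((cmod (v x))\<^sup>2))"

text \<open>
  The derivative is the classical one: elements of \<open>sobolev r\<close> with \<open>r > 3/2\<close> are continuously
  differentiable.
\<close>

definition momentum :: "(real \<Rightarrow> complex) \<Rightarrow> complex" where
  "momentum v = Pi0 (\<lambda>x. v x * vector_derivative (\<lambda>y. cnj (v y)) (at x))"

definition sobolev_continuous :: "real \<Rightarrow> real \<Rightarrow> (real \<Rightarrow> real \<Rightarrow> complex) \<Rightarrow> bool" where
  "sobolev_continuous r T u \<longleftrightarrow>
     (\<forall>t\<in>{0..T}. u t \<in> sobolev r \<and>
        ((\<lambda>s. sobolev_norm r (\<lambda>x. u s x - u t x)) \<longlongrightarrow> 0) (at t within {0..T}))"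

text \<open>
  Mild solutions of \<open>\<i> \<partial>\<^sub>t u = - \<partial>\<^sub>x\<^sup>2 u + \<mu> \<bar>u\<bar>\<^sup>2 u\<close>, \<open>u(0) = v\<close> in \<open>C([0,T]; H\<^sup>r)\<close>.  The integral in
  Duhamel's formula is evaluated pointwise in \<open>x\<close>; for \<open>r > 1/2\<close> this is the value at \<open>x\<close> of the
  integral of the (continuous) integrand with values in the Sobolev space, as point evaluation is
  continuous there.
\<close>

definition nls_mild_solution ::
  "real \<Rightarrow> real \<Rightarrow> real \<Rightarrow> (real \<Rightarrow> complex) \<Rightarrow> (real \<Rightarrow> real \<Rightarrow> complex) \<Rightarrow> bool" where
  "nls_mild_solution \<mu> r T v u \<longleftrightarrow>
     sobolev_continuous r T u \<and> u 0 = v \<and>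
     (\<forall>t\<in>{0..T}. \<forall>x.
        ((\<lambda>s. - \<i> * of_real \<mu> *
            schroedinger_group (t - s) (\<lambda>y. of_real ((cmod (u s y))\<^sup>2) * u s y) x)
          has_integral (u t x - schroedinger_group t v x)) {0..t})"

definition fine_propagator ::
  "real \<Rightarrow> real \<Rightarrow> real \<Rightarrow> (real \<Rightarrow> complex) \<Rightarrow> (real \<Rightarrow> complex)" where
  "fine_propagator \<mu> r \<tau> v = (THE w. \<exists>u. nls_mild_solution \<mu> r \<tau> v u \<and> w = u \<tau>)"

text \<open>The operator \<open>exp (- 2 \<i> \<mu> \<tau> (M(v) + P(v) \<partial>\<^sub>x\<^sup>-\<^sup>1))\<close>; its coefficients depend on \<open>v\<close>.\<close>

definition mass_momentum_exp ::
  "real \<Rightarrow> real \<Rightarrow> (real \<Rightarrow> complex) \<Rightarrow> (real \<Rightarrow> complex) \<Rightarrow> (real \<Rightarrow> complex)" where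
  "mass_momentum_exp \<mu> \<tau> v = fourier_multiplier
     (\<lambda>k. exp (- 2 * \<i> * of_real \<mu> * of_real \<tau> * (mass v + momentum v * inv_deriv_symbol k)))"

definition Phi_c2 :: "real \<Rightarrow> real \<Rightarrow> (real \<Rightarrow> complex) \<Rightarrow> (real \<Rightarrow> complex)" where
  "Phi_c2 \<mu> \<tau> v = (let S = schroedinger_group in (\<lambda>x.
       S \<tau> (\<lambda>y. mass_momentum_exp \<mu> \<tau> v v y - v y) x
     - \<i> * of_real \<mu> * of_real \<tau> * Pi0 (\<lambda>y. of_real ((cmod (v y))\<^sup>2) * v y)
     + 2 * \<i> * of_real \<mu> * of_real \<tau> * mass v * Pi0 v
     - of_real \<mu> / 2 *
         inv_deriv (inv_deriv (\<lambda>y. S (- \<tau>) (\<lambda>z. cnj (v z)) y * S \<tau> (\<lambda>z. (v z)\<^sup>2) y)) x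
     + of_real \<mu> / 2 *
         S \<tau> (inv_deriv (inv_deriv (\<lambda>y. of_real ((cmod (v y))\<^sup>2) * v y))) x
     + of_real \<mu> *
         inv_deriv (\<lambda>y. S \<tau> v y * inv_deriv (\<lambda>z. of_real ((cmod (S \<tau> v z))\<^sup>2)) y) x
     - of_real \<mu> *
         S \<tau> (inv_deriv (\<lambda>y. v y * inv_deriv (\<lambda>z. of_real ((cmod (v z))\<^sup>2)) y)) x))"

definition coarse_propagator :: "real \<Rightarrow> real \<Rightarrow> (real \<Rightarrow> complex) \<Rightarrow> (real \<Rightarrow> complex)" where
  "coarse_propagator \<mu> \<tau> v = (\<lambda>x. schroedinger_group \<tau> v x + Phi_c2 \<mu> \<tau> v x)"

text \<open>\<open>parareal F G u0 k n\<close> is the \<open>k\<close>-th iterate at the \<open>n\<close>-th coarse grid point.\<close>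

fun parareal ::
  "((real \<Rightarrow> complex) \<Rightarrow> (real \<Rightarrow> complex)) \<Rightarrow> ((real \<Rightarrow> complex) \<Rightarrow> (real \<Rightarrow> complex)) \<Rightarrow>
   (real \<Rightarrow> complex) \<Rightarrow> nat \<Rightarrow> nat \<Rightarrow> (real \<Rightarrow> complex)" where
  "parareal F G u0 k 0 = u0"
| "parareal F G u0 0 (Suc n) = G (parareal F G u0 0 n)"
| "parareal F G u0 (Suc k) (Suc n) =
     (\<lambda>x. G (parareal F G u0 (Suc k) n) x + F (parareal F G u0 k n) x - G (parareal F G u0 k n) x)"

end

theory Submission
  imports Defs
begin

text \<open>
  Functions in the Sobolev space of order \<open>r\<close> are represented by their Fourier coefficients, rescaled
  to square-summable sequences, on which the cubic nonlinearity acts through a kernel that is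
  square-summable for \<open>r > 1/2\<close>.  In the interaction picture, the flow is
  \<open>v - \<i> \<mu> \<integral> S(-s) (|S(s) v|\<^sup>2 S(s) v) ds\<close> up to \<open>O(\<tau>\<^sup>2)\<close>.  Expanding the integrand in Fourier modes
  \<open>k = - k1 + k2 + k3\<close> gives the phase \<open>2 (k2 - k1) (k3 - k1) = 2 k2 k3 - 2 k k1\<close>.  By the splitting
  \<open>k = (k2 - k1) + (k3 - k1) + k1\<close>, the coarse propagator integrates the phase exactly, except for the
  part with weight \<open>k1 / k\<close>, in which the factor with phase \<open>2 k2 k3\<close> is dropped.  The error made
  there has the symbol \<open>\<tau>\<^sup>2 k1 k2 k3 / k\<close>, which is bounded on the Sobolev space because \<open>r - 1 > 1/2\<close>.
  Hence the fine and coarse propagators differ by a map with local Lipschitz constant \<open>O(\<tau>\<^sup>2)\<close>, and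
  each parareal sweep gains a factor \<open>O(\<tau>)\<close> by a discrete Gronwall argument.
\<close>

section \<open>Square-summable sequences\<close>

text \<open>Sequences form a single normed type, so Picard iteration and vector-valued integrals are
  available there; \<open>ev\<close> carries the results back to functions. In the interaction
  picture the right-hand side is bounded on this space, so Taylor expansion in time loses no
  derivative; derivatives are lost only where a phase is frozen. Two things stand outside the
  splitting of the weight. On the resonant modes k2 = k the inverse derivative vanishes; their sum
  with weight 1 - k1/k is (M + P/(ik)) v_k, which is why mass and momentum appear in an exponential,
  whose deviation from its linear part is again of second order in \<tau>. At k = 0 division by k is
  impossible; there the terms with \<open>Pi0\<close> take over, and the whole phase 2 k2 k3 is
  frozen. The splitting is recovered only after symmetrization in k2 and k3, since the scheme
  contains twice one of the first two summands instead of both. Finally, all Lipschitz bounds hold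
  on balls only, and the fine propagator is identified only there, so the convergence estimate must
  at the same time keep all iterates within distance 1 of the solution.\<close>

typedef l2 = "{a :: int \<Rightarrow> complex. (\<lambda>k. (cmod (a k))\<^sup>2) summable_on UNIV}"
  morphisms coord Abs_l2
  by (intro exI[of _ "\<lambda>_. 0"]) simp

lemma coord_summable: "(\<lambda>k. (cmod (coord x k))\<^sup>2) summable_on UNIV"
  using coord[of x] by simp

lemma l2_eqI: "(\<And>k. coord x k = coord y k) \<Longrightarrow> x = y"
  using coord_inject by blast

text \<open>Phrased through finite sections, so that it makes sense before \<open>a\<close> is known
  to lie in the space; one such estimate yields both membership (\<open>coord_Abs_l2\<close>) and
  the norm bound (\<open>norm_Abs_l2_le\<close>).\<close>

definition sq_bounded :: "real \<Rightarrow> (int \<Rightarrow> complex) \<Rightarrow> bool" where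
  "sq_bounded B a \<longleftrightarrow> (\<forall>F. finite F \<longrightarrow> L2_set (\<lambda>k. cmod (a k)) F \<le> B)"

lemma sq_bounded_summable:
  assumes "sq_bounded B a"
  shows "(\<lambda>k. (cmod (a k))\<^sup>2) summable_on UNIV"
proof (rule nonneg_bdd_above_summable_on)
  show "bdd_above (sum (\<lambda>k. (cmod (a k))\<^sup>2) ` {F. F \<subseteq> UNIV \<and> finite F})"
  proof (rule bdd_aboveI2)
    fix F :: "int set" assume "F \<in> {F. F \<subseteq> UNIV \<and> finite F}"
    then have "sqrt (\<Sum>k\<in>F. (cmod (a k))\<^sup>2) \<le> B"
      using assms by (auto simp: sq_bounded_def L2_set_def)
    then show "(\<Sum>k\<in>F. (cmod (a k))\<^sup>2) \<le> B\<^sup>2"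
      by (rule sqrt_le_D)
  qed
qed auto

lemma coord_Abs_l2: "sq_bounded B a \<Longrightarrow> coord (Abs_l2 a) = a"
  by (rule Abs_l2_inverse) (auto intro: sq_bounded_summable)

definition l2_norm :: "l2 \<Rightarrow> real" where
  "l2_norm x = sqrt (\<Sum>\<^sub>\<infinity>k. (cmod (coord x k))\<^sup>2)"

lemma L2_set_le_l2_norm: "finite F \<Longrightarrow> L2_set (\<lambda>k. cmod (coord x k)) F \<le> l2_norm x"
  unfolding l2_norm_def L2_set_def
  by (intro real_sqrt_le_mono finite_sum_le_infsum coord_summable) auto

lemma l2_norm_leI:
  assumes "sq_bounded B (coord x)"
  shows "l2_norm x \<le> B"
proof -
  have B: "B \<ge> 0"
    using assms unfolding sq_bounded_def by (metis L2_set_empty finite.emptyI)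
  have "(\<Sum>\<^sub>\<infinity>k. (cmod (coord x k))\<^sup>2) \<le> B\<^sup>2"
    using assms by (intro infsum_le_finite_sums coord_summable)
      (auto simp: sq_bounded_def L2_set_def intro: sqrt_le_D)
  then show ?thesis
    unfolding l2_norm_def using B by (metis abs_of_nonneg real_sqrt_abs real_sqrt_le_iff)
qed

lemma sq_bounded_coord: "sq_bounded (l2_norm x) (coord x)"
  by (simp add: sq_bounded_def L2_set_le_l2_norm)

lemma sq_bounded_add:
  assumes "sq_bounded A a" "sq_bounded B b"
  shows "sq_bounded (A + B) (\<lambda>k. a k + b k)"
  unfolding sq_bounded_def
proof safe
  fix F :: "int set" assume F: "finite F"
  have "L2_set (\<lambda>k. cmod (a k + b k)) F \<le> L2_set (\<lambda>k. cmod (a k) + cmod (b k)) F"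
    by (intro L2_set_mono norm_triangle_ineq) auto
  also have "\<dots> \<le> L2_set (\<lambda>k. cmod (a k)) F + L2_set (\<lambda>k. cmod (b k)) F"
    by (rule L2_set_triangle_ineq)
  finally show "L2_set (\<lambda>k. cmod (a k + b k)) F \<le> A + B"
    using assms F unfolding sq_bounded_def by (meson add_mono order_trans)
qed

lemma sq_bounded_mult:
  assumes "sq_bounded A a" "\<And>k. cmod (m k) \<le> C"
  shows "sq_bounded (C * A) (\<lambda>k. m k * a k)"
  unfolding sq_bounded_def
proof safe
  fix F :: "int set" assume F: "finite F"
  have C: "C \<ge> 0" using assms(2)[of 0] norm_ge_zero order_trans by blast
  have "L2_set (\<lambda>k. cmod (m k * a k)) F \<le> L2_set (\<lambda>k. C * cmod (a k)) F"
    by (intro L2_set_mono) (auto simp: norm_mult intro: mult_right_mono assms)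
  also have "\<dots> = C * L2_set (\<lambda>k. cmod (a k)) F"
    using C by (simp add: L2_set_right_distrib)
  finally show "L2_set (\<lambda>k. cmod (m k * a k)) F \<le> C * A"
    using assms F C unfolding sq_bounded_def by (meson mult_left_mono order_trans)
qed

section \<open>Banach space structure on the square-summable sequences\<close>

instantiation l2 :: real_normed_vector
begin

definition "0 = Abs_l2 (\<lambda>_. 0)"
definition "x + y = Abs_l2 (\<lambda>k. coord x k + coord y k)"
definition "- x = Abs_l2 (\<lambda>k. - coord x k)"
definition "x - y = Abs_l2 (\<lambda>k. coord x k - coord y k)"
definition "c *\<^sub>R x = Abs_l2 (\<lambda>k. of_real c * coord x k)"
definition "norm x = l2_norm x"
definition "dist (x::l2) y = norm (x - y)"
definition "sgn (x::l2) = inverse (norm x) *\<^sub>R x"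
definition "(uniformity :: (l2 \<times> l2) filter) = (INF e\<in>{0<..}. principal {(x, y). dist x y < e})"
definition "open (U :: l2 set) \<longleftrightarrow> (\<forall>x\<in>U. eventually (\<lambda>(x', y). x' = x \<longrightarrow> y \<in> U) uniformity)"

lemma coord_zero: "coord 0 k = 0"
  unfolding zero_l2_def by (subst coord_Abs_l2[where B = 0]) (auto simp: sq_bounded_def L2_set_def)

lemma coord_plus: "coord (x + y) k = coord x k + coord y k"
  unfolding plus_l2_def by (subst coord_Abs_l2[OF sq_bounded_add[OF sq_bounded_coord
      sq_bounded_coord]]) auto

lemma coord_scaleR: "coord (c *\<^sub>R x) k = of_real c * coord x k"
  unfolding scaleR_l2_def
  by (subst coord_Abs_l2[OF sq_bounded_mult[OF sq_bounded_coord, where C = "\<bar>c\<bar>"]]) auto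

lemma coord_uminus: "coord (- x) k = - coord x k"
  unfolding uminus_l2_def
  using coord_Abs_l2[OF sq_bounded_mult[OF sq_bounded_coord, of "\<lambda>_. -1" 1 x]] by simp

lemma coord_minus: "coord (x - y) k = coord x k - coord y k"
proof -
  have "x - y = x + - y"
    unfolding minus_l2_def plus_l2_def by (simp add: coord_uminus)
  then show ?thesis by (simp add: coord_plus coord_uminus)
qed

lemmas coord_simps [simp] = coord_zero coord_plus coord_scaleR coord_uminus coord_minus

instance
proof
  fix x y :: l2 and c :: real
  show "norm x = 0 \<longleftrightarrow> x = 0"
  proof
    assume "norm x = 0"
    then have "(\<Sum>\<^sub>\<infinity>k. (cmod (coord x k))\<^sup>2) = 0"
      by (simp add: norm_l2_def l2_norm_def)
    then have "(cmod (coord x k))\<^sup>2 = 0" for k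
      by (rule nonneg_infsum_le_0D[OF eq_refl coord_summable]) auto
    then show "x = 0" by (intro l2_eqI) simp
  qed (simp add: norm_l2_def l2_norm_def)
  show "norm (x + y) \<le> norm x + norm y"
    unfolding norm_l2_def by (rule l2_norm_leI)
      (use sq_bounded_add[OF sq_bounded_coord sq_bounded_coord] in \<open>simp add: coord_plus[abs_def]\<close>)
  show "norm (c *\<^sub>R x) = \<bar>c\<bar> * norm x"
    by (simp add: norm_l2_def l2_norm_def norm_mult power_mult_distrib infsum_cmult_right'
        real_sqrt_mult)
qed (auto intro!: l2_eqI simp: algebra_simps dist_l2_def sgn_l2_def uniformity_l2_def open_l2_def)

end

lemma l2_norm_eq: "(norm x)\<^sup>2 = (\<Sum>\<^sub>\<infinity>k. (cmod (coord x k))\<^sup>2)"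
  by (simp add: norm_l2_def l2_norm_def infsum_nonneg)

lemma sum_coord_le: "finite F \<Longrightarrow> (\<Sum>k\<in>F. (cmod (coord x k))\<^sup>2) \<le> (norm x)\<^sup>2"
  unfolding l2_norm_eq by (intro finite_sum_le_infsum coord_summable) auto

lemma cmod_coord_le: "cmod (coord x k) \<le> norm x"
  using sum_coord_le[of "{k}" x] by (simp add: power2_le_iff_abs_le)

lemma sq_boundedI:
  assumes "B \<ge> 0" "\<And>F. finite F \<Longrightarrow> (\<Sum>k\<in>F. (cmod (a k))\<^sup>2) \<le> B\<^sup>2"
  shows "sq_bounded B a"
  unfolding sq_bounded_def L2_set_def using assms by (auto intro: real_le_lsqrt sum_nonneg)

lemma norm_Abs_l2_le: "sq_bounded B a \<Longrightarrow> norm (Abs_l2 a) \<le> B"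
  unfolding norm_l2_def by (rule l2_norm_leI) (simp add: coord_Abs_l2)

lemma norm_l2_leI: "sq_bounded B (coord x) \<Longrightarrow> norm x \<le> B"
  unfolding norm_l2_def by (rule l2_norm_leI)

lemma sq_bounded_norm: "sq_bounded (norm x) (coord x)"
  unfolding norm_l2_def by (rule sq_bounded_coord)

text \<open>Coordinates are 1-Lipschitz, so a Cauchy sequence converges coordinatewise; letting m
  tend to infinity in finite sections of \<open>X n - X m\<close> upgrades this to convergence in
  norm.\<close>

instance l2 :: banach
proof
  fix X :: "nat \<Rightarrow> l2" assume X: "Cauchy X"
  have "Cauchy (\<lambda>n. coord (X n) k)" for k
  proof (rule CauchyI)
    fix e :: real assume "e > 0"
    then obtain M where "\<forall>m\<ge>M. \<forall>n\<ge>M. norm (X m - X n) < e"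
      using CauchyD[OF X] by blast
    then show "\<exists>M. \<forall>m\<ge>M. \<forall>n\<ge>M. norm (coord (X m) k - coord (X n) k) < e"
      by (metis coord_minus cmod_coord_le order_le_less_trans)
  qed
  then obtain a where a: "\<And>k. (\<lambda>n. coord (X n) k) \<longlonglongrightarrow> a k"
    unfolding Cauchy_convergent_iff convergent_def by metis
  have close: "sq_bounded e (\<lambda>k. coord (X n) k - a k)"
    if "\<forall>m\<ge>M. \<forall>n\<ge>M. norm (X m - X n) < e" "n \<ge> M" for n M e
    unfolding sq_bounded_def
  proof safe
    fix F :: "int set" assume "finite F"
    have "(\<lambda>m. L2_set (\<lambda>k. cmod (coord (X n) k - coord (X m) k)) F)
        \<longlonglongrightarrow> L2_set (\<lambda>k. cmod (coord (X n) k - a k)) F"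
      unfolding L2_set_def by (intro tendsto_intros a)
    moreover have "L2_set (\<lambda>k. cmod (coord (X n) k - coord (X m) k)) F \<le> e" if "m \<ge> M" for m
    proof -
      have "L2_set (\<lambda>k. cmod (coord (X n - X m) k)) F \<le> norm (X n - X m)"
        unfolding norm_l2_def by (rule L2_set_le_l2_norm[OF \<open>finite F\<close>])
      also have "\<dots> \<le> e"
        using \<open>m \<ge> M\<close> \<open>n \<ge> M\<close> \<open>\<forall>m\<ge>M. \<forall>n\<ge>M. norm (X m - X n) < e\<close>
        by (simp add: less_imp_le)
      finally show ?thesis by simp
    qed
    ultimately show "L2_set (\<lambda>k. cmod (coord (X n) k - a k)) F \<le> e"
      using Lim_bounded by blast
  qed
  obtain M where M: "\<forall>m\<ge>M. \<forall>n\<ge>M. norm (X m - X n) < 1"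
    using CauchyD[OF X, of 1] by auto
  \<comment> \<open>The limit is \<open>X M\<close> minus a sequence bounded by 1, hence it lies in
    the space.\<close>
  have "sq_bounded (1 * 1 + norm (X M)) (\<lambda>k. - 1 * (coord (X M) k - a k) + coord (X M) k)"
    by (intro sq_bounded_add sq_bounded_mult close[OF M] sq_bounded_norm) auto
  then have ca: "coord (Abs_l2 a) = a"
    by (intro coord_Abs_l2) simp
  have "X \<longlonglongrightarrow> Abs_l2 a"
  proof (rule LIMSEQ_I)
    fix e :: real assume "e > 0"
    then obtain M where M: "\<forall>m\<ge>M. \<forall>n\<ge>M. norm (X m - X n) < e / 2"
      using CauchyD[OF X, of "e / 2"] by auto
    have "norm (X n - Abs_l2 a) < e" if "n \<ge> M" for n
    proof -
      have "norm (X n - Abs_l2 a) \<le> e / 2"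
        using close[OF M that] by (intro norm_l2_leI) (simp add: ca coord_minus[abs_def])
      then show ?thesis using \<open>e > 0\<close> by simp
    qed
    then show "\<exists>M. \<forall>n\<ge>M. norm (X n - Abs_l2 a) < e" by blast
  qed
  then show "convergent X" by (auto simp: convergent_def)
qed

lemma bounded_linear_coord: "bounded_linear (\<lambda>x. coord x k)"
proof (rule bounded_linear_intro[where K = 1])
  show "coord (r *\<^sub>R x) k = r *\<^sub>R coord x k" for r x by (simp add: scaleR_conv_of_real)
qed (auto simp: cmod_coord_le)

section \<open>Diagonal operators\<close>

definition diag :: "(int \<Rightarrow> complex) \<Rightarrow> l2 \<Rightarrow> l2" where
  "diag m x = Abs_l2 (\<lambda>k. m k * coord x k)"

lemma coord_diag:
  assumes "\<And>k. cmod (m k) \<le> C"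
  shows "coord (diag m x) k = m k * coord x k"
  unfolding diag_def by (subst coord_Abs_l2[OF sq_bounded_mult[OF sq_bounded_norm assms]]) auto

lemma norm_diag_le:
  assumes "\<And>k. cmod (m k) \<le> C"
  shows "norm (diag m x) \<le> C * norm x"
  unfolding diag_def by (intro norm_Abs_l2_le sq_bounded_mult sq_bounded_norm assms)

lemma bounded_linear_diag:
  assumes "\<And>k. cmod (m k) \<le> C"
  shows "bounded_linear (diag m)"
proof (rule bounded_linear_intro[where K = C])
  show "diag m (x + y) = diag m x + diag m y" for x y
    by (intro l2_eqI) (simp add: coord_diag[of m C, OF assms] algebra_simps)
  show "diag m (r *\<^sub>R x) = r *\<^sub>R diag m x" for r x
    by (intro l2_eqI) (simp add: coord_diag[of m C, OF assms] algebra_simps)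
qed (use norm_diag_le[OF assms] in \<open>auto simp: mult.commute\<close>)

section \<open>Cubic forms on sequences\<close>

text \<open>With \<open>p\<close> = (k1, k2) the third frequency is forced by k = - k1 + k2 + k3;
  the first factor is the conjugated one.\<close>

definition tprod :: "(int \<Rightarrow> complex) \<Rightarrow> (int \<Rightarrow> complex) \<Rightarrow> (int \<Rightarrow> complex) \<Rightarrow> int \<Rightarrow> int \<times> int \<Rightarrow> complex" where
  "tprod a b c k p = cnj (a (fst p)) * b (snd p) * c (k + fst p - snd p)"

abbreviation "ctprod x y z \<equiv> tprod (coord x) (coord y) (coord z)"

definition tri :: "(int \<Rightarrow> int \<times> int \<Rightarrow> complex) \<Rightarrow> l2 \<Rightarrow> l2 \<Rightarrow> l2 \<Rightarrow> l2" where
  "tri \<kappa> x y z = Abs_l2 (\<lambda>k. \<Sum>\<^sub>\<infinity>p. \<kappa> k p * ctprod x y z k p)"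

text \<open>Square summability in \<open>p\<close>, uniformly in the output frequency: the condition
  under which Cauchy-Schwarz makes \<open>tri\<close> bounded on square-summable sequences.\<close>

definition kernel_bdd :: "real \<Rightarrow> (int \<Rightarrow> int \<times> int \<Rightarrow> complex) \<Rightarrow> bool" where
  "kernel_bdd K \<kappa> \<longleftrightarrow> K \<ge> 0 \<and> (\<forall>k F. finite F \<longrightarrow> (\<Sum>p\<in>F. (cmod (\<kappa> k p))\<^sup>2) \<le> K\<^sup>2)"

text \<open>For fixed \<open>p\<close> the sum over the output frequency only sees a shift of
  \<open>z\<close>; what remains is part of a product of two single sums.\<close>

lemma sum_tprod_sq_le:
  assumes "finite F" "finite P"
  shows "(\<Sum>k\<in>F. \<Sum>p\<in>P. (cmod (ctprod x y z k p))\<^sup>2)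
    \<le> (norm x * norm y * norm z)\<^sup>2"
proof -
  have 1: "(\<Sum>k\<in>F. (cmod (coord z (k + fst p - snd p)))\<^sup>2) \<le> (norm z)\<^sup>2" for p
  proof -
    have "(\<Sum>k\<in>F. (cmod (coord z (k + fst p - snd p)))\<^sup>2)
        = (\<Sum>k\<in>(\<lambda>k. k + fst p - snd p) ` F. (cmod (coord z k))\<^sup>2)"
      by (subst sum.reindex) (auto simp: inj_on_def)
    also have "\<dots> \<le> (norm z)\<^sup>2" by (intro sum_coord_le finite_imageI assms)
    finally show ?thesis .
  qed
  have "(\<Sum>k\<in>F. \<Sum>p\<in>P. (cmod (ctprod x y z k p))\<^sup>2)
      = (\<Sum>p\<in>P. (cmod (coord x (fst p)))\<^sup>2 * (cmod (coord y (snd p)))\<^sup>2 *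
          (\<Sum>k\<in>F. (cmod (coord z (k + fst p - snd p)))\<^sup>2))"
    by (subst sum.swap)
      (simp add: tprod_def norm_mult power_mult_distrib sum_distrib_left)
  also have "\<dots> \<le> (\<Sum>p\<in>P. (cmod (coord x (fst p)))\<^sup>2 * (cmod (coord y (snd p)))\<^sup>2 * (norm z)\<^sup>2)"
    by (intro sum_mono mult_left_mono 1) auto
  also have "\<dots> \<le> (\<Sum>p\<in>fst ` P \<times> snd ` P.
      (cmod (coord x (fst p)))\<^sup>2 * (cmod (coord y (snd p)))\<^sup>2 * (norm z)\<^sup>2)"
  proof (intro sum_mono2)
    show "P \<subseteq> fst ` P \<times> snd ` P" by (auto simp: image_iff) force+
  qed (use assms in auto)
  also have "\<dots> = (\<Sum>j\<in>fst ` P. (cmod (coord x j))\<^sup>2) * (\<Sum>j\<in>snd ` P. (cmod (coord y j))\<^sup>2) * (norm z)\<^sup>2"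
    by (simp add: sum_product sum.cartesian_product case_prod_beta flip: sum_distrib_right)
  also have "\<dots> \<le> (norm x)\<^sup>2 * (norm y)\<^sup>2 * (norm z)\<^sup>2"
    using assms by (intro mult_mono sum_coord_le) (auto intro: sum_nonneg)
  finally show ?thesis by (simp add: power_mult_distrib)
qed

lemma kernel_sum_le:
  assumes K: "kernel_bdd K \<kappa>" and P: "finite P"
  shows "(\<Sum>p\<in>P. cmod (\<kappa> k p * ctprod x y z k p))\<^sup>2
    \<le> K\<^sup>2 * (\<Sum>p\<in>P. (cmod (ctprod x y z k p))\<^sup>2)"
proof -
  have "(\<Sum>p\<in>P. cmod (\<kappa> k p * ctprod x y z k p))\<^sup>2
      \<le> (\<Sum>p\<in>P. (cmod (\<kappa> k p))\<^sup>2) * (\<Sum>p\<in>P. (cmod (ctprod x y z k p))\<^sup>2)"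
    unfolding norm_mult by (rule Cauchy_Schwarz_ineq_sum)
  also have "\<dots> \<le> K\<^sup>2 * (\<Sum>p\<in>P. (cmod (ctprod x y z k p))\<^sup>2)"
    using K P unfolding kernel_bdd_def by (intro mult_right_mono) (auto intro: sum_nonneg)
  finally show ?thesis .
qed

lemma kernel_abs_summable:
  assumes K: "kernel_bdd K \<kappa>"
  shows "(\<lambda>p. cmod (\<kappa> k p * ctprod x y z k p)) summable_on UNIV"
proof (rule abs_summable_iff_bdd_above[THEN iffD2], rule bdd_aboveI2)
  fix P :: "(int \<times> int) set" assume "P \<in> {F. F \<subseteq> UNIV \<and> finite F}"
  then have P: "finite P" by auto
  have "(\<Sum>p\<in>P. cmod (\<kappa> k p * ctprod x y z k p))\<^sup>2
    \<le> K\<^sup>2 * (\<Sum>p\<in>P. (cmod (ctprod x y z k p))\<^sup>2)"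
    by (rule kernel_sum_le[OF K P])
  also have "\<dots> \<le> K\<^sup>2 * (norm x * norm y * norm z)\<^sup>2"
    using sum_tprod_sq_le[of "{k}" P x y z] P by (intro mult_left_mono) auto
  finally have "(\<Sum>p\<in>P. cmod (\<kappa> k p * ctprod x y z k p))\<^sup>2
    \<le> (K * (norm x * norm y * norm z))\<^sup>2"
    by (simp only: power_mult_distrib)
  then show "(\<Sum>p\<in>P. cmod (\<kappa> k p * ctprod x y z k p)) \<le> K * (norm x * norm y * norm z)"
    by (rule power2_le_imp_le) (use K in \<open>simp add: kernel_bdd_def\<close>)
qed

lemma tri_sq_bounded:
  assumes K: "kernel_bdd K \<kappa>"
  shows "sq_bounded (K * (norm x * norm y * norm z))
    (\<lambda>k. \<Sum>\<^sub>\<infinity>p. \<kappa> k p * ctprod x y z k p)"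
proof (rule sq_boundedI)
  show "0 \<le> K * (norm x * norm y * norm z)" using K by (auto simp: kernel_bdd_def)
  fix F :: "int set" assume F: "finite F"
  let ?f = "\<lambda>k p. \<kappa> k p * ctprod x y z k p"
  \<comment> \<open>The bound is uniform in the finite set \<open>P\<close>, so it survives the
    limit that produces the infinite sums over \<open>p\<close>.\<close>
  have "((\<lambda>P. \<Sum>k\<in>F. (cmod (sum (?f k) P))\<^sup>2) \<longlongrightarrow> (\<Sum>k\<in>F. (cmod (\<Sum>\<^sub>\<infinity>p. ?f k p))\<^sup>2))
      (finite_subsets_at_top UNIV)"
    by (intro tendsto_sum tendsto_power tendsto_norm infsum_tendsto
        abs_summable_summable[OF kernel_abs_summable[OF K]])
  moreover have "\<forall>\<^sub>F P in finite_subsets_at_top UNIV.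
      (\<Sum>k\<in>F. (cmod (sum (?f k) P))\<^sup>2) \<le> (K * (norm x * norm y * norm z))\<^sup>2"
  proof (rule eventually_finite_subsets_at_top_weakI)
    fix P :: "(int \<times> int) set" assume P: "finite P"
    have "(\<Sum>k\<in>F. (cmod (sum (?f k) P))\<^sup>2) \<le> (\<Sum>k\<in>F. (\<Sum>p\<in>P. cmod (?f k p))\<^sup>2)"
      by (intro sum_mono power_mono norm_sum) auto
    also have "\<dots> \<le> (\<Sum>k\<in>F. K\<^sup>2 * (\<Sum>p\<in>P. (cmod (ctprod x y z k p))\<^sup>2))"
      by (intro sum_mono kernel_sum_le[OF K P])
    also have "\<dots> \<le> K\<^sup>2 * (norm x * norm y * norm z)\<^sup>2"
      unfolding sum_distrib_left[symmetric]
      by (intro mult_left_mono sum_tprod_sq_le F P) auto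
    finally show "(\<Sum>k\<in>F. (cmod (sum (?f k) P))\<^sup>2) \<le> (K * (norm x * norm y * norm z))\<^sup>2"
      by (simp add: power_mult_distrib)
  qed
  ultimately show "(\<Sum>k\<in>F. (cmod (\<Sum>\<^sub>\<infinity>p. ?f k p))\<^sup>2) \<le> (K * (norm x * norm y * norm z))\<^sup>2"
    by (rule tendsto_upperbound) simp
qed

lemma coord_tri:
  "kernel_bdd K \<kappa> \<Longrightarrow> coord (tri \<kappa> x y z) k
    = (\<Sum>\<^sub>\<infinity>p. \<kappa> k p * ctprod x y z k p)"
  unfolding tri_def by (subst coord_Abs_l2[OF tri_sq_bounded]) auto

lemma norm_tri_le: "kernel_bdd K \<kappa> \<Longrightarrow> norm (tri \<kappa> x y z) \<le> K * (norm x * norm y * norm z)"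
  unfolding tri_def by (intro norm_Abs_l2_le tri_sq_bounded)

lemma infsum_diff:
  fixes f g :: "'a \<Rightarrow> 'b :: real_normed_vector"
  assumes "f summable_on A" "g summable_on A"
  shows "(\<Sum>\<^sub>\<infinity>x\<in>A. f x - g x) = infsum f A - infsum g A"
  using infsum_add[of f A "\<lambda>x. - g x"] assms by (simp add: summable_on_uminus infsum_uminus)

lemma tri_diff:
  assumes K: "kernel_bdd K \<kappa>"
  shows "tri \<kappa> (x - x') y z = tri \<kappa> x y z - tri \<kappa> x' y z"
    and "tri \<kappa> x (y - y') z = tri \<kappa> x y z - tri \<kappa> x y' z"
    and "tri \<kappa> x y (z - z') = tri \<kappa> x y z - tri \<kappa> x y z'"
proof -
  note [simp] = coord_tri[OF K]
  note sm = abs_summable_summable[OF kernel_abs_summable[OF K]]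
  show "tri \<kappa> (x - x') y z = tri \<kappa> x y z - tri \<kappa> x' y z"
    by (rule l2_eqI, simp, subst infsum_diff[OF sm sm, symmetric])
      (simp add: tprod_def algebra_simps)
  show "tri \<kappa> x (y - y') z = tri \<kappa> x y z - tri \<kappa> x y' z"
    by (rule l2_eqI, simp, subst infsum_diff[OF sm sm, symmetric])
      (simp add: tprod_def algebra_simps)
  show "tri \<kappa> x y (z - z') = tri \<kappa> x y z - tri \<kappa> x y z'"
    by (rule l2_eqI, simp, subst infsum_diff[OF sm sm, symmetric])
      (simp add: tprod_def algebra_simps)
qed

lemma tri_triple_diff:
  assumes "kernel_bdd K \<kappa>"
  shows "tri \<kappa> x y z - tri \<kappa> x' y' z'
    = tri \<kappa> (x - x') y z + tri \<kappa> x' (y - y') z + tri \<kappa> x' y' (z - z')"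
  by (simp add: tri_diff[OF assms])

section \<open>Sobolev weights\<close>

definition jb :: "int \<Rightarrow> real" where
  "jb k = 1 + (of_int k)\<^sup>2"

lemma jb_ge_1: "jb k \<ge> 1" and jb_pos: "jb k > 0"
  by (auto simp: jb_def add_pos_nonneg)

lemma jb_powr_summable:
  assumes "s > 1/2"
  shows "(\<lambda>k. jb k powr (-s)) summable_on UNIV"
proof -
  have nat: "summable (\<lambda>n. (1 + (real n)\<^sup>2) powr (-s))"
  proof (rule summable_comparison_test')
    show "summable (\<lambda>n. real n powr (- 2 * s))"
      using assms by (simp add: summable_real_powr_iff)
    \<comment> \<open>The comparison fails at n = 0, where \<open>real n powr _\<close> is
      0.\<close>
    show "norm ((1 + (real n)\<^sup>2) powr (-s)) \<le> real n powr (- 2 * s)" if "n \<ge> 1" for n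
    proof -
      have "(1 + (real n)\<^sup>2) powr (-s) \<le> ((real n)\<^sup>2) powr (-s)"
        using that assms by (intro powr_mono2') auto
      also have "\<dots> = real n powr (- 2 * s)"
        using that by (simp add: powr_powr flip: powr_numeral)
      finally show ?thesis by simp
    qed
  qed
  have "(\<lambda>k. jb k powr (-s)) summable_on range int"
    by (subst summable_on_reindex)
      (auto simp: jb_def o_def intro!: norm_summable_imp_summable_on nat)
  moreover have "(\<lambda>k. jb k powr (-s)) summable_on range (\<lambda>n. - int n)"
    by (subst summable_on_reindex)
      (auto simp: jb_def o_def inj_on_def intro!: norm_summable_imp_summable_on nat)
  ultimately have "(\<lambda>k. jb k powr (-s)) summable_on (range int \<union> range (\<lambda>n. - int n))"
    by (rule summable_on_union)
  moreover have "range int \<union> range (\<lambda>n. - int n) = UNIV"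
    by (auto simp: image_iff) (metis int_cases2)
  ultimately show ?thesis by simp
qed

definition jb_zeta :: "real \<Rightarrow> real" where
  "jb_zeta s = (\<Sum>\<^sub>\<infinity>k. jb k powr (-s))"

lemma sum_jb_le: "s > 1/2 \<Longrightarrow> finite F \<Longrightarrow> (\<Sum>k\<in>F. jb k powr (-s)) \<le> jb_zeta s"
  unfolding jb_zeta_def by (intro finite_sum_le_infsum jb_powr_summable) auto

lemma jb_zeta_nonneg: "jb_zeta s \<ge> 0"
  unfolding jb_zeta_def by (intro infsum_nonneg) auto

text \<open>For the case where one of three weights has absorbed the weight of the output frequency:
  the two remaining frequencies still determine \<open>p\<close>, so the sum embeds into a product
  of two convergent series.\<close>

lemma sum_jb_pair_le:
  assumes s: "s > 1/2" and "finite F" and inj: "inj_on (\<lambda>p. (f p, g p)) F"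
  shows "(\<Sum>p\<in>F. jb (f p) powr (-s) * jb (g p) powr (-s)) \<le> (jb_zeta s)\<^sup>2"
proof -
  have "(\<Sum>p\<in>F. jb (f p) powr (-s) * jb (g p) powr (-s))
      = (\<Sum>q\<in>(\<lambda>p. (f p, g p)) ` F. jb (fst q) powr (-s) * jb (snd q) powr (-s))"
    by (subst sum.reindex[OF inj]) simp
  also have "\<dots> \<le> (\<Sum>q\<in>f ` F \<times> g ` F. jb (fst q) powr (-s) * jb (snd q) powr (-s))"
    using assms by (intro sum_mono2) auto
  also have "\<dots> = (\<Sum>k\<in>f ` F. jb k powr (-s)) * (\<Sum>k\<in>g ` F. jb k powr (-s))"
    by (simp add: sum_product sum.cartesian_product case_prod_beta)
  also have "\<dots> \<le> jb_zeta s * jb_zeta s"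
    using assms by (intro mult_mono sum_jb_le jb_zeta_nonneg) (auto intro: sum_nonneg)
  finally show ?thesis by (simp add: power2_eq_square)
qed

text \<open>The factor 9 is 3 times 3: one factor comes from 3 (a^2 + b^2 + c^2) - (- a + b + c)^2 =
  (a + b)^2 + (a + c)^2 + (b - c)^2, the other from replacing each weight by the largest, whose
  power is one of the three summands.\<close>

lemma jb_powr_sum_le:
  assumes "s \<ge> 0"
  shows "jb (- a + b + c) powr s \<le> 9 powr s * (jb a powr s + jb b powr s + jb c powr s)"
proof -
  define m where "m = max (jb a) (max (jb b) (jb c))"
  have m: "m \<ge> jb a" "m \<ge> jb b" "m \<ge> jb c" "m = jb a \<or> m = jb b \<or> m = jb c"
    by (auto simp: m_def)
  have "0 \<le> (of_int a + of_int b :: real)\<^sup>2 + (of_int a + of_int c)\<^sup>2 + (of_int b - of_int c)\<^sup>2"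
    by simp
  then have "(- of_int a + of_int b + of_int c :: real)\<^sup>2
      \<le> 3 * ((of_int a)\<^sup>2 + (of_int b)\<^sup>2 + (of_int c)\<^sup>2)"
    by (simp add: power2_eq_square algebra_simps)
  then have "jb (- a + b + c) \<le> 3 * (jb a + jb b + jb c)"
    unfolding jb_def of_int_add of_int_minus distrib_left by linarith
  then have "jb (- a + b + c) \<le> 3 * (m + m + m)" using mult_left_mono[OF add_mono[OF add_mono[OF
      m(1,2)] m(3)], of 3] by simp
  then have "jb (- a + b + c) \<le> 9 * m" by simp
  then have "jb (- a + b + c) powr s \<le> (9 * m) powr s"
    using assms jb_pos by (intro powr_mono2) (auto simp: less_imp_le)
  also have "\<dots> = 9 powr s * m powr s"
    using m(1) jb_pos[of a] by (simp add: powr_mult)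
  also have "m powr s \<le> jb a powr s + jb b powr s + jb c powr s"
    using m(4) by (auto simp: add_nonneg_nonneg)
  finally show ?thesis by simp
qed

text \<open>The factor that a cubic form acquires when Fourier coefficients are rescaled to
  square-summable coordinates: the output is multiplied by its weight, each input divided by its
  own.\<close>

definition wt :: "real \<Rightarrow> int \<Rightarrow> int \<times> int \<Rightarrow> real" where
  "wt s k p = jb k powr (s/2) *
     (jb (fst p) powr (-s/2) * jb (snd p) powr (-s/2) * jb (k + fst p - snd p) powr (-s/2))"

lemma wt_nonneg: "wt s k p \<ge> 0"
  by (simp add: wt_def)

lemma wt_sq:
  "(wt s k p)\<^sup>2 = jb k powr s *
     (jb (fst p) powr (-s) * jb (snd p) powr (-s) * jb (k + fst p - snd p) powr (-s))"
proof -
  have sq: "(jb j powr (t/2))\<^sup>2 = jb j powr t" for j t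
    by (simp add: power2_eq_square flip: powr_add)
  show ?thesis
    using sq[of _ "-s"] by (simp add: wt_def power_mult_distrib sq)
qed

text \<open>The estimate behind the algebra property of the Sobolev space of order \<open>s > 1/2\<close>.\<close>

lemma sum_wt_sq_le:
  assumes s: "s > 1/2" and F: "finite F"
  shows "(\<Sum>p\<in>F. (wt s k p)\<^sup>2) \<le> (sqrt (3 * 9 powr s) * jb_zeta s)\<^sup>2"
proof -
  have "(wt s k p)\<^sup>2 \<le> 9 powr s *
     (jb (snd p) powr (-s) * jb (k + fst p - snd p) powr (-s)
      + jb (fst p) powr (-s) * jb (k + fst p - snd p) powr (-s)
      + jb (fst p) powr (-s) * jb (snd p) powr (-s))" for p
  proof -
    define A B C where "A = jb (fst p)" and "B = jb (snd p)" and "C = jb (k + fst p - snd p)"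
    have pos: "A > 0" "B > 0" "C > 0" by (auto simp: A_def B_def C_def jb_pos)
    have "jb k powr s \<le> 9 powr s * (A powr s + B powr s + C powr s)"
      using jb_powr_sum_le[of s "fst p" "snd p" "k + fst p - snd p"] s by (simp add: A_def B_def C_def)
    then have "(wt s k p)\<^sup>2 \<le> 9 powr s * (A powr s + B powr s + C powr s) *
        (A powr (-s) * B powr (-s) * C powr (-s))"
      unfolding wt_sq A_def[symmetric] B_def[symmetric] C_def[symmetric]
      by (intro mult_right_mono) auto
    also have "\<dots> = 9 powr s * (B powr (-s) * C powr (-s) + A powr (-s) * C powr (-s)
        + A powr (-s) * B powr (-s))"
      using pos by (simp add: powr_minus field_simps)
    finally show ?thesis unfolding A_def B_def C_def .
  qed
  then have "(\<Sum>p\<in>F. (wt s k p)\<^sup>2) \<le> (\<Sum>p\<in>F. 9 powr s *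
     (jb (snd p) powr (-s) * jb (k + fst p - snd p) powr (-s)
      + jb (fst p) powr (-s) * jb (k + fst p - snd p) powr (-s)
      + jb (fst p) powr (-s) * jb (snd p) powr (-s)))"
    by (rule sum_mono)
  also have "\<dots> = 9 powr s * ((\<Sum>p\<in>F. jb (snd p) powr (-s) * jb (k + fst p - snd p) powr (-s))
      + (\<Sum>p\<in>F. jb (fst p) powr (-s) * jb (k + fst p - snd p) powr (-s))
      + (\<Sum>p\<in>F. jb (fst p) powr (-s) * jb (snd p) powr (-s)))"
    by (simp only: sum.distrib sum_distrib_left distrib_left)
  also have "\<dots> \<le> 9 powr s * ((jb_zeta s)\<^sup>2 + (jb_zeta s)\<^sup>2 + (jb_zeta s)\<^sup>2)"
    using F by (intro mult_left_mono add_mono sum_jb_pair_le[OF s]) (auto simp: inj_on_def prod_eq_iff)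
  finally show ?thesis by (simp add: power_mult_distrib)
qed

lemma kernel_bdd_wt:
  assumes s: "s > 1/2" and C: "C \<ge> 0" and le: "\<And>k p. cmod (\<kappa> k p) \<le> C * wt s k p"
  shows "kernel_bdd (C * (sqrt (3 * 9 powr s) * jb_zeta s)) \<kappa>"
  unfolding kernel_bdd_def
proof (intro conjI allI impI)
  show "0 \<le> C * (sqrt (3 * 9 powr s) * jb_zeta s)"
    using C jb_zeta_nonneg by simp
  fix k :: int and F :: "(int \<times> int) set" assume F: "finite F"
  have "(\<Sum>p\<in>F. (cmod (\<kappa> k p))\<^sup>2) \<le> (\<Sum>p\<in>F. C\<^sup>2 * (wt s k p)\<^sup>2)"
    unfolding power_mult_distrib[symmetric] by (intro sum_mono power_mono le) auto
  also have "\<dots> \<le> C\<^sup>2 * (sqrt (3 * 9 powr s) * jb_zeta s)\<^sup>2"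
    unfolding sum_distrib_left[symmetric] by (intro mult_left_mono sum_wt_sq_le s F) auto
  finally show "(\<Sum>p\<in>F. (cmod (\<kappa> k p))\<^sup>2) \<le> (C * (sqrt (3 * 9 powr s) * jb_zeta s))\<^sup>2"
    by (simp add: power_mult_distrib)
qed

section \<open>Absolutely convergent Fourier series\<close>

definition ek :: "int \<Rightarrow> real \<Rightarrow> complex" where
  "ek k x = exp (\<i> * of_int k * of_real x)"

lemma ek_0 [simp]: "ek 0 x = 1"
  by (simp add: ek_def)

lemma ek_add: "ek (j + l) x = ek j x * ek l x"
  by (simp add: ek_def algebra_simps flip: exp_add)

lemma cmod_ek [simp]: "cmod (ek k x) = 1"
proof -
  have "\<i> * of_int k * of_real x = \<i> * complex_of_real (of_int k * x)" by simp
  then show ?thesis unfolding ek_def by (simp only: norm_exp_i_times)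
qed

lemma cnj_ek: "cnj (ek k x) = ek (- k) x"
  by (simp add: ek_def exp_cnj)

lemma ek_periodic: "ek k (x + 2 * pi) = ek k x"
proof -
  have "exp (\<i> * of_int k * of_real (2 * pi)) = 1"
    using exp_integer_2pi[of "of_int k"] by (simp add: mult_ac)
  then show ?thesis by (simp add: ek_def exp_add distrib_left)
qed

lemma continuous_on_ek: "continuous_on A (ek k)"
  unfolding ek_def by (intro continuous_intros)

lemma fourier_coeff_ek: "fourier_coeff f k = Pi0 (\<lambda>x. f x * ek (- k) x)"
  by (simp add: fourier_coeff_def ek_def)

lemma has_vector_derivative_ek:
  "(ek k has_vector_derivative \<i> * of_int k * ek k x) (at x within S)"
proof -
  have "((\<lambda>z. exp (\<i> * of_int k * z)) has_field_derivative \<i> * of_int k * ek k x) (at (of_real x))"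
    by (auto intro!: derivative_eq_intros simp: ek_def)
  from has_vector_derivative_real_field[OF this] show ?thesis
    by (simp add: ek_def[abs_def])
qed

lemma integral_ek: "integral {0..2 * pi} (ek k) = (if k = 0 then of_real (2 * pi) else 0)"
proof (cases "k = 0")
  case False
  have "((\<lambda>x. \<i> * of_int k * ek k x) has_integral ek k (2 * pi) - ek k 0) {0..2 * pi}"
    by (intro fundamental_theorem_of_calculus has_vector_derivative_ek) simp
  then have "((\<lambda>x. \<i> * of_int k * ek k x) has_integral 0) {0..2 * pi}"
    using ek_periodic[of k 0] by simp
  then have "((\<lambda>x. inverse (\<i> * of_int k) * (\<i> * of_int k * ek k x)) has_integral inverse (\<i> *
      of_int k) * 0) {0..2 * pi}"
    by (rule has_integral_mult_right)
  moreover have "inverse (\<i> * of_int k) * (\<i> * of_int k * ek k x) = ek k x" for x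
    by (subst mult.assoc[symmetric], subst left_inverse) (use False in auto)
  ultimately have "((\<lambda>x. ek k x) has_integral 0) {0..2 * pi}" by (simp only: mult_zero_right)
  then show ?thesis using False by (simp add: integral_unique)
qed (simp add: ek_def[abs_def] scaleR_conv_of_real)

text \<open>Termwise integration by the Weierstrass M-test. It serves the Fourier coefficients of a
  series, the derivative of a series and the time integral of the nonlinearity.\<close>

lemma has_integral_infsum:
  fixes f :: "'a \<Rightarrow> real \<Rightarrow> 'b :: banach"
  assumes M: "M summable_on UNIV"
    and le: "\<And>p s. s \<in> {a..b} \<Longrightarrow> norm (f p s) \<le> M p"
    and cont: "\<And>p. continuous_on {a..b} (f p)"
  shows "((\<lambda>p. integral {a..b} (f p)) has_sum integral {a..b} (\<lambda>s. \<Sum>\<^sub>\<infinity>p. f p s)) UNIV"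
    and "continuous_on {a..b} (\<lambda>s. \<Sum>\<^sub>\<infinity>p. f p s)"
proof -
  have u: "uniform_limit {a..b} (\<lambda>F s. \<Sum>p\<in>F. f p s) (\<lambda>s. \<Sum>\<^sub>\<infinity>p. f p s) (finite_subsets_at_top UNIV)"
    using le M by (rule Weierstrass_m_test_general)
  show "continuous_on {a..b} (\<lambda>s. \<Sum>\<^sub>\<infinity>p. f p s)"
    by (rule uniform_limit_theorem[OF _ u]) (auto intro!: always_eventually continuous_intros cont)
  obtain I J where I: "\<And>F. ((\<lambda>s. \<Sum>p\<in>F. f p s) has_integral I F) (cbox a b)"
    and J: "((\<lambda>s. \<Sum>\<^sub>\<infinity>p. f p s) has_integral J) (cbox a b)"
    and lim: "(I \<longlongrightarrow> J) (finite_subsets_at_top UNIV)"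
    by (rule uniform_limit_integral_cbox[OF u[folded cbox_interval]])
      (auto intro!: continuous_intros cont)
  have "I = (\<lambda>F. \<Sum>p\<in>F. integral {a..b} (f p))"
  proof
    fix F show "I F = (\<Sum>p\<in>F. integral {a..b} (f p))"
      using I[of F] cont
      by (cases "finite F") (auto simp: integral_sum integrable_continuous_interval dest!: integral_unique)
  qed
  then show "((\<lambda>p. integral {a..b} (f p)) has_sum integral {a..b} (\<lambda>s. \<Sum>\<^sub>\<infinity>p. f p s)) UNIV"
    using lim J by (simp add: has_sum_def integral_unique)
qed

text \<open>Coefficients in the Wiener algebra. Sobolev functions of order above 1/2 belong to it,
  and in it products become convolutions without further convergence questions.\<close>

definition wsum :: "(int \<Rightarrow> complex) \<Rightarrow> bool" where
  "wsum a \<longleftrightarrow> (\<lambda>k. cmod (a k)) summable_on UNIV"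

definition wien :: "(int \<Rightarrow> complex) \<Rightarrow> real \<Rightarrow> complex" where
  "wien a x = (\<Sum>\<^sub>\<infinity>k. a k * ek k x)"

lemma wsum_summable: "wsum a \<Longrightarrow> (\<lambda>k. a k * ek k x) summable_on UNIV"
  by (rule abs_summable_summable) (simp add: wsum_def norm_mult)

lemma wsum_le: "wsum b \<Longrightarrow> (\<And>k. cmod (a k) \<le> cmod (b k)) \<Longrightarrow> wsum a"
  unfolding wsum_def by (rule Infinite_Sum.abs_summable_on_comparison_test')

lemma wsum_add:
  assumes "wsum a" "wsum b"
  shows "wsum (\<lambda>k. a k + b k)"
  unfolding wsum_def
  by (rule Infinite_Sum.abs_summable_on_comparison_test'
      [OF summable_on_add[OF assms[unfolded wsum_def]]]) (rule norm_triangle_ineq)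

lemma wsum_mult:
  assumes "wsum a" "\<And>k. cmod (m k) \<le> C"
  shows "wsum (\<lambda>k. m k * a k)"
  unfolding wsum_def
  by (rule Infinite_Sum.abs_summable_on_comparison_test'
      [OF summable_on_cmult_right[OF assms(1)[unfolded wsum_def], of C]])
    (simp add: norm_mult mult_right_mono assms(2))

lemma wsum_cmult: "wsum a \<Longrightarrow> wsum (\<lambda>k. c * a k)"
  by (rule wsum_mult[of a "\<lambda>_. c" "cmod c"]) auto

lemma wsum_diff: "wsum a \<Longrightarrow> wsum b \<Longrightarrow> wsum (\<lambda>k. a k - b k)"
  using wsum_add[of a "\<lambda>k. - 1 * b k"] wsum_cmult[of b "-1"] by simp

lemma wsum_cnj:
  assumes "wsum a"
  shows "wsum (\<lambda>k. cnj (a (- k)))"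
  using assms summable_on_reindex_bij_witness[of UNIV uminus uminus UNIV "\<lambda>k. cmod (a k)" "\<lambda>k.
      cmod (a (- k))"]
  by (simp add: wsum_def)

lemma wsum_single: "wsum (\<lambda>k. if k = 0 then c else 0)"
  unfolding wsum_def
  by (rule finite_nonzero_values_imp_summable_on) (rule finite_subset[of _ "{0}"], auto)

lemma wien_single: "wien (\<lambda>k. if k = 0 then c else 0) x = c"
proof -
  have "((\<lambda>k. (if k = 0 then c else 0) * ek k x) has_sum c) UNIV"
    by (rule has_sum_finite_neutralI[of "{0}"]) auto
  then show ?thesis unfolding wien_def by (rule infsumI)
qed

lemma wien_add: "wsum a \<Longrightarrow> wsum b \<Longrightarrow> wien a x + wien b x = wien (\<lambda>k. a k + b k) x"
  unfolding wien_def by (subst infsum_add[symmetric]) (auto simp: wsum_summable algebra_simps)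

lemma wien_diff: "wsum a \<Longrightarrow> wsum b \<Longrightarrow> wien a x - wien b x = wien (\<lambda>k. a k - b k) x"
  unfolding wien_def by (subst infsum_diff[symmetric]) (auto simp: wsum_summable algebra_simps)

lemma wien_cmult: "c * wien a x = wien (\<lambda>k. c * a k) x"
  unfolding wien_def by (simp add: mult.assoc infsum_cmult_right')

lemma wien_cnj: "cnj (wien a x) = wien (\<lambda>k. cnj (a (- k))) x"
  unfolding wien_def infsum_cnj[symmetric]
  by (rule infsum_reindex_bij_witness[of _ uminus uminus]) (auto simp: cnj_ek)

lemma continuous_on_wien:
  assumes "wsum a"
  shows "continuous_on UNIV (wien a)"
proof -
  have "uniform_limit UNIV (\<lambda>F x. \<Sum>k\<in>F. a k * ek k x) (\<lambda>x. \<Sum>\<^sub>\<infinity>k. a k * ek k x) (finite_subsets_at_top UNIV)"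
    by (rule Weierstrass_m_test_general[OF _ assms[unfolded wsum_def]]) (simp add: norm_mult)
  then have "continuous_on UNIV (\<lambda>x. \<Sum>\<^sub>\<infinity>k. a k * ek k x)"
    by (rule uniform_limit_theorem[rotated]) (auto intro!: always_eventually continuous_intros
        continuous_on_ek)
  then show ?thesis by (simp add: wien_def[abs_def])
qed

lemma wien_periodic: "wien a (x + 2 * pi) = wien a x"
  by (simp add: wien_def ek_periodic)

lemma fourier_coeff_wien:
  assumes "wsum a"
  shows "fourier_coeff (wien a) k = a k"
proof -
  have "((\<lambda>j. integral {0..2*pi} (\<lambda>x. a j * ek (j - k) x)) has_sum
      integral {0..2*pi} (\<lambda>x. \<Sum>\<^sub>\<infinity>j. a j * ek (j - k) x)) UNIV"
    by (rule has_integral_infsum(1)[OF assms[unfolded wsum_def]])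
      (auto simp: norm_mult intro!: continuous_intros continuous_on_ek)
  moreover have "(\<Sum>\<^sub>\<infinity>j. a j * ek (j - k) x) = wien a x * ek (- k) x" for x
    unfolding wien_def by (subst infsum_cmult_left'[symmetric]) (simp add: mult.assoc flip: ek_add)
  moreover have "integral {0..2*pi} (\<lambda>x. a j * ek (j - k) x) = (if j = k then a k * of_real (2 *
      pi) else 0)" for j
    by (simp add: integral_ek)
  ultimately have "((\<lambda>j. if j = k then a k * of_real (2 * pi) else 0) has_sum
      integral {0..2*pi} (\<lambda>x. wien a x * ek (- k) x)) UNIV"
    by simp
  moreover have "((\<lambda>j. if j = k then a k * of_real (2 * pi) else 0) has_sum a k * of_real (2 * pi)) UNIV"
    by (rule has_sum_finite_neutralI[of "{k}"]) auto
  ultimately have "integral {0..2*pi} (\<lambda>x. wien a x * ek (- k) x) = a k * of_real (2 * pi)"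
    by (rule has_sum_unique)
  then show ?thesis by (simp add: fourier_coeff_ek Pi0_def)
qed

lemma Pi0_wien: "wsum a \<Longrightarrow> Pi0 (wien a) = a 0"
  using fourier_coeff_wien[of a 0] by (simp add: fourier_coeff_ek)

lemma fourier_multiplier_eq: "fourier_multiplier m f = wien (\<lambda>k. m k * fourier_coeff f k)"
  by (simp add: fourier_multiplier_def wien_def ek_def fun_eq_iff)

lemma fourier_multiplier_wien:
  "wsum a \<Longrightarrow> fourier_multiplier m (wien a) = wien (\<lambda>k. m k * a k)"
  by (simp add: fourier_multiplier_eq fourier_coeff_wien)

subsection \<open>Convolution\<close>

definition conv :: "(int \<Rightarrow> complex) \<Rightarrow> (int \<Rightarrow> complex) \<Rightarrow> int \<Rightarrow> complex" where
  "conv a b k = (\<Sum>\<^sub>\<infinity>j. a j * b (k - j))"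

lemma summable_on_prod:
  fixes f :: "'a \<Rightarrow> real" and g :: "'b \<Rightarrow> real"
  assumes "f summable_on UNIV" "g summable_on UNIV" "\<And>x. f x \<ge> 0" "\<And>x. g x \<ge> 0"
  shows "(\<lambda>p. f (fst p) * g (snd p)) summable_on UNIV"
proof -
  have "(\<lambda>p. f (fst p) * g (snd p)) summable_on Sigma UNIV (\<lambda>_. UNIV)"
  proof (rule summable_on_SigmaI)
    show "((\<lambda>y. f (fst (x, y)) * g (snd (x, y))) has_sum f x * infsum g UNIV) UNIV" for x
      using assms by (auto intro: has_sum_cmult_right)
    show "(\<lambda>x. f x * infsum g UNIV) summable_on UNIV"
      by (intro summable_on_cmult_left assms)
  qed (use assms in auto)
  then show ?thesis by simp
qed

lemma conv_summable:
  assumes "wsum a" "wsum b"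
  shows "(\<lambda>q. cmod (a (snd q) * b (fst q - snd q))) summable_on UNIV"
proof -
  have "(\<lambda>p. cmod (a (fst p)) * cmod (b (snd p))) summable_on UNIV"
    using assms unfolding wsum_def by (intro summable_on_prod) auto
  also have "?this \<longleftrightarrow> ?thesis"
    by (rule summable_on_reindex_bij_witness[of _ "\<lambda>q. (snd q, fst q - snd q)" "\<lambda>p. (fst p + snd
        p, fst p)"])
      (auto simp: norm_mult)
  finally show ?thesis .
qed

lemma conv_summable1:
  assumes "wsum a" "wsum b"
  shows "(\<lambda>j. cmod (a j * b (k - j))) summable_on UNIV"
  by (rule summable_on_SigmaD1[of "\<lambda>k j. cmod (a j * b (k - j))" UNIV "\<lambda>_. UNIV"])
    (use conv_summable[OF assms] in \<open>auto simp: case_prod_unfold\<close>)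

lemma wsum_conv:
  assumes "wsum a" "wsum b"
  shows "wsum (conv a b)"
proof -
  have "(\<lambda>k. \<Sum>\<^sub>\<infinity>j. cmod (a j * b (k - j))) summable_on UNIV"
    using summable_on_Sigma_banach[of "\<lambda>k j. cmod (a j * b (k - j))" UNIV "\<lambda>_. UNIV"]
      conv_summable[OF assms] by (simp add: case_prod_unfold)
  then show ?thesis
    unfolding wsum_def
    by (rule Infinite_Sum.abs_summable_on_comparison_test')
      (auto simp: conv_def intro: norm_infsum_bound conv_summable1[OF assms])
qed

lemma wien_mult:
  assumes "wsum a" "wsum b"
  shows "wien a x * wien b x = wien (conv a b) x"
proof -
  have "wien a x * wien b x = (\<Sum>\<^sub>\<infinity>j. \<Sum>\<^sub>\<infinity>l. a j * ek j x * (b l * ek l x))"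
    by (simp add: wien_def infsum_cmult_left' infsum_cmult_right')
  also have "\<dots> = (\<Sum>\<^sub>\<infinity>j. \<Sum>\<^sub>\<infinity>k. a j * b (k - j) * ek k x)"
  proof (rule infsum_cong)
    fix j :: int
    show "(\<Sum>\<^sub>\<infinity>l. a j * ek j x * (b l * ek l x)) = (\<Sum>\<^sub>\<infinity>k. a j * b (k - j) * ek k x)"
      by (intro infsum_reindex_bij_witness[of _ "\<lambda>k. k - j" "\<lambda>l. j + l"])
        (auto simp: ek_add)
  qed
  also have "\<dots> = (\<Sum>\<^sub>\<infinity>k. \<Sum>\<^sub>\<infinity>j. a j * b (k - j) * ek k x)"
  proof (rule infsum_swap_banach[symmetric])
    have "(\<lambda>q. a (snd q) * b (fst q - snd q) * ek (fst q) x) summable_on UNIV"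
      by (rule abs_summable_summable)
        (use conv_summable[OF assms] in \<open>simp add: norm_mult\<close>)
    then show "(\<lambda>(k, j). a j * b (k - j) * ek k x) summable_on UNIV \<times> UNIV"
      by (simp add: case_prod_unfold)
  qed
  also have "\<dots> = wien (conv a b) x"
    unfolding wien_def conv_def by (simp add: infsum_cmult_left')
  finally show ?thesis .
qed

subsection \<open>Uniqueness of Fourier coefficients\<close>

definition annihilated :: "(real \<Rightarrow> complex) \<Rightarrow> bool" where
  "annihilated h \<longleftrightarrow> continuous_on UNIV h \<and> (\<forall>k. fourier_coeff h k = 0)"

lemma annihilated_mult_ek:
  assumes "annihilated h" shows "annihilated (\<lambda>x. h x * ek j x)"
proof -
  have "fourier_coeff (\<lambda>x. h x * ek j x) k = fourier_coeff h (k - j)" for k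
    by (simp add: fourier_coeff_ek mult.assoc flip: ek_add)
  then show ?thesis
    using assms by (auto simp: annihilated_def intro!: continuous_intros continuous_on_ek)
qed

lemma annihilated_add:
  assumes "annihilated f" "annihilated g"
  shows "annihilated (\<lambda>x. f x + g x)"
proof -
  have int: "(\<lambda>x. h x * ek (- k) x) integrable_on {0..2*pi}" if "annihilated h" for h k
    using that unfolding annihilated_def
    by (intro integrable_continuous_interval continuous_intros continuous_on_ek)
      (auto intro: continuous_on_subset)
  have "fourier_coeff (\<lambda>x. f x + g x) k = fourier_coeff f k + fourier_coeff g k" for k
    using int[OF assms(1)] int[OF assms(2)]
    by (simp add: fourier_coeff_ek Pi0_def distrib_right integral_add add_divide_distrib)
  then show ?thesis
    using assms by (auto simp: annihilated_def intro!: continuous_intros)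
qed

lemma annihilated_cmult: "annihilated f \<Longrightarrow> annihilated (\<lambda>x. c * f x)"
  by (auto simp: annihilated_def fourier_coeff_ek Pi0_def mult.assoc intro!: continuous_intros)

text \<open>A real linear function of \<open>ek 1 x\<close> is a combination of
  \<open>ek 1 x\<close> and \<open>ek (- 1) x\<close>, and multiplication by these only shifts
  Fourier coefficients. Products are handled by applying the induction hypothesis to a new
  \<open>h\<close>.\<close>

lemma annihilated_mult_polynomial:
  assumes "real_polynomial_function g" "annihilated h"
  shows "annihilated (\<lambda>x. h x * of_real (g (ek 1 x)))"
  using assms
proof (induction arbitrary: h rule: real_polynomial_function.induct)
  case (linear g)
  interpret bounded_linear g by fact
  have "g (ek 1 x) = g (Re (ek 1 x) *\<^sub>R 1 + Im (ek 1 x) *\<^sub>R \<i>)" for x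
    by (simp add: scaleR_conv_of_real mult.commute flip: complex_eq)
  then have g: "g (ek 1 x) = Re (ek 1 x) * g 1 + Im (ek 1 x) * g \<i>" for x
    by (simp only: add scaleR real_scaleR_def)
  have R: "complex_of_real (Re (ek 1 x)) = (ek 1 x + ek (- 1) x) / 2" for x
    by (simp add: cnj_ek[symmetric] complex_add_cnj)
  have I: "complex_of_real (Im (ek 1 x)) = (ek 1 x - ek (- 1) x) / (2 * \<i>)" for x
    by (simp add: cnj_ek[symmetric] complex_diff_cnj mult.commute[of "complex_of_real (Im (ek 1 x))" \<i>])
  have "annihilated (\<lambda>x. (of_real (g 1) / 2 + of_real (g \<i>) / (2 * \<i>)) * (h x * ek 1 x)
      + (of_real (g 1) / 2 - of_real (g \<i>) / (2 * \<i>)) * (h x * ek (- 1) x))"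
    by (intro annihilated_add annihilated_cmult annihilated_mult_ek \<open>annihilated h\<close>)
  then show ?case
    by (rule back_subst[of annihilated]) (simp add: g R I fun_eq_iff field_simps)
next
  case (const c)
  then show ?case using annihilated_cmult[of h "of_real c"] by (simp add: mult.commute)
next
  case (add f g)
  then show ?case using annihilated_add by (simp add: distrib_left)
next
  case (mult f g)
  then show ?case by (simp flip: mult.assoc)
qed

text \<open>Viewed on the unit circle, \<open>f\<close> is a uniform limit of real polynomials, all
  of which it is orthogonal to; hence it is orthogonal to itself.\<close>

lemma annihilated_real_eq_0:
  fixes f :: "real \<Rightarrow> real"
  assumes Z: "annihilated (\<lambda>x. of_real (f x))" and per: "\<And>x. f (x + 2 * pi) = f x"
  shows "f x = 0"
proof -
  interpret periodic_fun_simple f "2 * pi" by standard (rule per)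
  have cont: "continuous_on UNIV f"
    using Z continuous_on_Re[of UNIV "\<lambda>x. complex_of_real (f x)"] by (simp add: annihilated_def)
  then have contA: "continuous_on A f" for A by (rule continuous_on_subset) simp
  define F where "F = (\<lambda>z. f (Arg z))"
  have exp_arg: "f a = f b" if e: "exp (\<i> * of_real a) = exp (\<i> * of_real b)" for a b
  proof -
    obtain n :: int where "\<i> * of_real a = \<i> * of_real b + (of_int (2 * n) * pi) * \<i>"
      using e unfolding exp_eq by blast
    then have "\<i> * complex_of_real a = \<i> * complex_of_real (b + of_int n * (2 * pi))"
      by (simp add: algebra_simps)
    then have "a = b + of_int n * (2 * pi)" by (simp only: mult_cancel_left of_real_eq_iff) simp
    then show ?thesis using plus_of_int[of b n] by simp
  qed
  have F2: "F z = f (Arg2pi z)" if "z \<noteq> 0" for z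
    unfolding F_def using that Arg_eq[of z] Arg2pi_eq[of z]
    by (intro exp_arg) (metis mult_cancel_left norm_eq_zero of_real_eq_0_iff)
  have F_ek: "F (ek 1 x) = f x" for x
    unfolding F_def using Arg_eq[of "ek 1 x"] cmod_ek[of 1 x]
    by (intro exp_arg) (auto simp: ek_def simp del: cmod_ek)
  \<comment> \<open>\<open>Arg\<close> jumps on the negative axis; near such points the branch
    \<open>Arg2pi\<close>, which jumps on the positive axis, gives the same function by
    \<open>F2\<close>.\<close>
  have "isCont F z" if "z \<noteq> 0" for z
  proof (cases "z \<in> \<real>\<^sub>\<le>\<^sub>0")
    case False
    then show ?thesis
      unfolding F_def using cont
      by (intro continuous_at_compose[unfolded o_def, of z Arg f] continuous_at_Arg)
        (auto simp: continuous_on_eq_continuous_at)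
  next
    case True
    then have "z \<notin> \<real>\<^sub>\<ge>\<^sub>0"
      using that by (auto simp: complex_nonpos_Reals_iff complex_nonneg_Reals_iff complex_eq_iff)
    then have "isCont (\<lambda>z. f (Arg2pi z)) z"
      using cont
      by (intro continuous_at_compose[unfolded o_def, of z Arg2pi f] continuous_at_Arg2pi)
        (auto simp: continuous_on_eq_continuous_at)
    moreover have "\<forall>\<^sub>F w in nhds z. F w = f (Arg2pi w)"
      using t1_space_nhds[OF that] by eventually_elim (rule F2)
    ultimately show ?thesis using isCont_cong by fast
  qed
  then have contF: "continuous_on (sphere 0 1) F"
    by (intro continuous_at_imp_continuous_on) (metis mem_sphere_0 norm_zero zero_neq_one)
  define B where "B = integral {0..2*pi} (\<lambda>x. \<bar>f x\<bar>)"
  have B: "B \<ge> 0" unfolding B_def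
    by (intro integral_nonneg integrable_continuous_interval continuous_intros contA) auto
  have le: "integral {0..2*pi} (\<lambda>x. f x * f x) \<le> e * B" if "e > 0" for e
  proof -
    obtain g where g: "real_polynomial_function g" "\<And>z. z \<in> sphere 0 1 \<Longrightarrow> \<bar>F z - g z\<bar> < e"
      using Stone_Weierstrass_real_polynomial_function[OF compact_sphere contF \<open>e > 0\<close>] by metis
    let ?g = "\<lambda>x. g (ek 1 x)"
    have "annihilated (\<lambda>x. of_real (f x) * of_real (?g x))"
      by (rule annihilated_mult_polynomial[OF g(1) Z])
    then have ann: "annihilated (\<lambda>x. of_real (f x * ?g x))" by simp
    then have contg: "continuous_on A (\<lambda>x. f x * ?g x)" for A
      using continuous_on_Re[of UNIV "\<lambda>x. complex_of_real (f x * ?g x)"]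
      by (auto simp: annihilated_def intro: continuous_on_subset)
    have "fourier_coeff (\<lambda>x. of_real (f x * ?g x)) 0 = 0"
      using ann unfolding annihilated_def by blast
    then have "integral {0..2*pi} (\<lambda>x. complex_of_real (f x * ?g x)) = 0"
      by (simp add: fourier_coeff_ek Pi0_def)
    moreover have "integral {0..2*pi} (\<lambda>x. complex_of_real (f x * ?g x))
        = of_real (integral {0..2*pi} (\<lambda>x. f x * ?g x))"
      by (intro integral_unique has_integral_of_real integrable_integral
          integrable_continuous_interval contg)
    ultimately have 0: "integral {0..2*pi} (\<lambda>x. f x * ?g x) = 0"
      by (simp only: of_real_eq_0_iff)
    \<comment> \<open>Subtracting the vanishing integral of f g leaves f (f - g), which is at most e
      times the modulus of f.\<close>
    have "integral {0..2*pi} (\<lambda>x. f x * f x) = integral {0..2*pi} (\<lambda>x. f x * f x - f x * ?g x)"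
      by (subst integral_diff) (auto simp: 0 intro!: integrable_continuous_interval
          continuous_intros contA contg)
    also have "\<dots> \<le> integral {0..2*pi} (\<lambda>x. e * \<bar>f x\<bar>)"
    proof (intro integral_le integrable_continuous_interval continuous_on_diff contg
        continuous_on_mult_left continuous_on_rabs contA)
      show "continuous_on {0..2*pi} (\<lambda>x. f x * f x)" by (intro continuous_intros contA)
      fix x
      have "\<bar>f x - ?g x\<bar> \<le> e" using g(2)[of "ek 1 x"] F_ek[of x] by (simp add: less_imp_le)
      then have "\<bar>f x\<bar> * \<bar>f x - ?g x\<bar> \<le> \<bar>f x\<bar> * e" by (intro mult_left_mono) auto
      moreover have "f x * f x - f x * ?g x \<le> \<bar>f x\<bar> * \<bar>f x - ?g x\<bar>"
        by (metis abs_ge_self abs_mult right_diff_distrib)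
      ultimately show "f x * f x - f x * ?g x \<le> e * \<bar>f x\<bar>" by (simp add: mult.commute)
    qed
    finally show ?thesis by (simp add: B_def)
  qed
  have "integral {0..2*pi} (\<lambda>x. f x * f x) \<le> 0"
  proof (rule field_le_epsilon)
    fix e :: real assume "e > 0"
    have "integral {0..2*pi} (\<lambda>x. f x * f x) \<le> e / (B + 1) * B"
      using \<open>e > 0\<close> B by (intro le) auto
    also have "\<dots> \<le> e" using \<open>e > 0\<close> B by (simp add: field_simps)
    finally show "integral {0..2*pi} (\<lambda>x. f x * f x) \<le> 0 + e" by simp
  qed
  moreover have "integral {0..2*pi} (\<lambda>x. f x * f x) \<ge> 0"
    by (intro integral_nonneg integrable_continuous_interval continuous_intros contA) auto
  ultimately have "integral {0..2*pi} (\<lambda>x. f x * f x) = 0" by simp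
  moreover have "continuous_on {0..2*pi} (\<lambda>x. f x * f x)" by (intro continuous_intros contA)
  ultimately have "\<forall>x\<in>{0..2*pi}. f x * f x = 0"
    by (subst (asm) integral_eq_0_iff) auto
  then have zero: "f x = 0" if "x \<in> {0..2*pi}" for x
    using that by (simp only: mult_eq_0_iff) blast
  define n where "n = \<lfloor>x / (2 * pi)\<rfloor>"
  have "of_int n \<le> x / (2 * pi)" "x / (2 * pi) < of_int n + 1" unfolding n_def by linarith+
  then have "x - of_int n * (2 * pi) \<in> {0..2*pi}" by (auto simp: field_simps)
  from zero[OF this] show ?thesis using plus_of_int[of "x - of_int n * (2 * pi)" n] by simp
qed

text \<open>The approximation argument is for real functions. Real and imaginary parts are again
  annihilated, because conjugation sends the coefficient at k to the conjugate of the one at -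
  k.\<close>

lemma fourier_unique:
  assumes "continuous_on UNIV f" "\<And>x. f (x + 2 * pi) = f x" "\<And>k. fourier_coeff f k = 0"
  shows "f x = 0"
proof -
  have Z: "annihilated f" using assms by (simp add: annihilated_def)
  have "fourier_coeff (\<lambda>x. cnj (f x)) k = cnj (fourier_coeff f (- k))" for k
    by (simp add: fourier_coeff_ek Pi0_def integral_cnj cnj_ek)
  then have Zc: "annihilated (\<lambda>x. cnj (f x))"
    using assms by (auto simp: annihilated_def intro!: continuous_intros)
  have "annihilated (\<lambda>x. 1/2 * (f x + cnj (f x)))"
    by (intro annihilated_cmult annihilated_add Z Zc)
  then have "annihilated (\<lambda>x. of_real (Re (f x)))" by (simp add: complex_add_cnj)
  then have "Re (f x) = 0" by (rule annihilated_real_eq_0) (simp add: assms)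
  have "annihilated (\<lambda>x. (1/(2*\<i>)) * (f x + - 1 * cnj (f x)))"
    by (intro annihilated_cmult annihilated_add Z Zc)
  then have "annihilated (\<lambda>x. of_real (Im (f x)))" by (simp add: complex_diff_cnj mult.commute[of
      "complex_of_real _" \<i>])
  then have "Im (f x) = 0" by (rule annihilated_real_eq_0) (simp add: assms)
  with \<open>Re (f x) = 0\<close> show ?thesis by (simp add: complex_eq_iff)
qed

section \<open>Sobolev functions as weighted sequences\<close>

lemma jb_powr_half_sq: "(jb k powr (s/2))\<^sup>2 = jb k powr s"
  by (simp add: power2_eq_square flip: powr_add)

lemma jb_powr_cancel: "jb k powr (-r/2) * jb k powr (r/2) = 1"
  using jb_pos[of k] by (simp flip: powr_add)

lemma of_real_jb_powr_cancel:
  "complex_of_real (jb k powr (-r/2)) * of_real (jb k powr (r/2)) = 1"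
  by (metis jb_powr_cancel of_real_1 of_real_mult)

text \<open>Coordinates carry the weight \<open>jb k powr (r/2)\<close>, which is removed here; so
  \<open>ev r\<close> becomes an isometry of the sequence space onto \<open>sobolev r\<close> when r
  > 1/2.\<close>

definition cf :: "real \<Rightarrow> l2 \<Rightarrow> int \<Rightarrow> complex" where
  "cf r x k = of_real (jb k powr (-r/2)) * coord x k"

definition ev :: "real \<Rightarrow> l2 \<Rightarrow> real \<Rightarrow> complex" where
  "ev r x = wien (cf r x)"

lemma wsum_cf:
  assumes "r > 1/2"
  shows "wsum (cf r x)"
  unfolding wsum_def
proof (rule Infinite_Sum.abs_summable_on_comparison_test')
  show "(\<lambda>k. jb k powr (-r) + (cmod (coord x k))\<^sup>2) summable_on UNIV"
    by (intro summable_on_add jb_powr_summable coord_summable assms)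
  show "cmod (cf r x k) \<le> jb k powr (-r) + (cmod (coord x k))\<^sup>2" for k
  proof -
    define u where "u = jb k powr (-r/2) * cmod (coord x k)"
    have "2 * u \<le> (jb k powr (-r/2))\<^sup>2 + (cmod (coord x k))\<^sup>2"
      unfolding u_def using sum_squares_bound[of "jb k powr (-r/2)" "cmod (coord x k)"]
      by (simp only: mult.assoc)
    moreover have "u \<ge> 0" by (simp add: u_def)
    ultimately have "u \<le> jb k powr (-r) + (cmod (coord x k))\<^sup>2"
      unfolding jb_powr_half_sq by linarith
    then show ?thesis by (simp add: cf_def norm_mult u_def)
  qed
qed

lemma abs_int_le_jb: "\<bar>real_of_int k\<bar> \<le> jb k powr (1/2)"
proof -
  have "\<bar>real_of_int k\<bar> = sqrt ((of_int k)\<^sup>2)" by simp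
  also have "\<dots> \<le> sqrt (jb k)" by (intro real_sqrt_le_mono) (simp add: jb_def)
  finally show ?thesis using jb_pos[of k] by (simp add: powr_half_sqrt)
qed

text \<open>Multiplication by k costs one order of regularity, and r - 1 > 1/2 is still enough for
  absolute summability.\<close>

lemma wsum_int_cf:
  assumes "r > 3/2"
  shows "wsum (\<lambda>k. of_int k * cf r x k)"
proof (rule wsum_le[OF wsum_cf[of "r - 1" x]])
  fix k
  have "cmod (of_int k * cf r x k) \<le> jb k powr (1/2) * (jb k powr (-r/2) * cmod (coord x k))"
    unfolding norm_mult cf_def by (intro mult_mono) (auto simp: abs_int_le_jb)
  also have "\<dots> = cmod (cf (r - 1) x k)"
  proof -
    have "1 / 2 + - r / 2 = - (r - 1) / 2" by (simp add: field_simps)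
    then show ?thesis
      by (simp only: cf_def norm_mult norm_of_real mult.assoc[symmetric] powr_add[symmetric]
          abs_of_nonneg[OF powr_ge_zero])
  qed
  finally show "cmod (of_int k * cf r x k) \<le> cmod (cf (r - 1) x k)" .
qed (use assms in simp)

lemma fourier_coeff_ev: "r > 1/2 \<Longrightarrow> fourier_coeff (ev r x) k = cf r x k"
  by (simp add: ev_def fourier_coeff_wien wsum_cf)

lemma cf_weight: "jb k powr r * (cmod (cf r x k))\<^sup>2 = (cmod (coord x k))\<^sup>2"
proof -
  have "jb k powr r * jb k powr (-r) = 1"
    using jb_pos[of k] by (simp flip: powr_add)
  then show ?thesis
    by (simp only: cf_def norm_mult norm_of_real power_mult_distrib power2_abs jb_powr_half_sq
        mult.assoc[symmetric] mult_1_left)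
qed

lemma ev_in_sobolev: "r > 1/2 \<Longrightarrow> ev r x \<in> sobolev r"
  unfolding sobolev_def jb_def[symmetric]
  by (auto simp: fourier_coeff_ev cf_weight coord_summable)
    (auto simp: ev_def continuous_on_wien wsum_cf wien_periodic)

lemma sobolev_norm_ev: "r > 1/2 \<Longrightarrow> sobolev_norm r (ev r x) = norm x"
  unfolding sobolev_norm_def jb_def[symmetric]
  by (simp add: fourier_coeff_ev cf_weight flip: l2_norm_eq)

lemma ev_add: "r > 1/2 \<Longrightarrow> ev r x t + ev r y t = ev r (x + y) t"
proof -
  assume r: "r > 1/2"
  have "cf r (x + y) = (\<lambda>k. cf r x k + cf r y k)"
    by (simp add: cf_def fun_eq_iff distrib_left)
  then show ?thesis
    unfolding ev_def by (simp only: wien_add[OF wsum_cf[OF r] wsum_cf[OF r]])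
qed

lemma ev_diff:
  assumes "r > 1/2"
  shows "ev r x t - ev r y t = ev r (x - y) t"
  using ev_add[OF assms, of "x - y" t y] by (simp add: diff_eq_eq)

lemma ev_inj:
  assumes "r > 1/2" "ev r x = ev r y"
  shows "x = y"
proof (rule l2_eqI)
  fix k
  have "cf r x k = cf r y k" using assms fourier_coeff_ev by metis
  then show "coord x k = coord y k" using jb_pos[of k] by (simp add: cf_def)
qed

text \<open>Surjectivity rests on uniqueness of Fourier coefficients: \<open>f\<close> and the
  series built from its coefficients are both continuous and periodic.\<close>

lemma sobolev_eq_range:
  assumes r: "r > 1/2"
  shows "sobolev r = range (ev r)"
proof (intro equalityI subsetI)
  fix f assume f: "f \<in> sobolev r"
  define a where "a = (\<lambda>k. of_real (jb k powr (r/2)) * fourier_coeff f k)"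
  have "(\<lambda>k. (cmod (a k))\<^sup>2) = (\<lambda>k. jb k powr r * (cmod (fourier_coeff f k))\<^sup>2)"
    by (simp only: a_def norm_mult norm_of_real power_mult_distrib power2_abs jb_powr_half_sq)
  then have "(\<lambda>k. (cmod (a k))\<^sup>2) summable_on UNIV"
    using f by (simp add: sobolev_def jb_def)
  then have co: "coord (Abs_l2 a) = a" by (simp add: Abs_l2_inverse)
  have cfa: "cf r (Abs_l2 a) = fourier_coeff f"
    unfolding fun_eq_iff cf_def co
    by (simp only: a_def mult.assoc[symmetric] of_real_jb_powr_cancel mult_1_left) simp
  have "f x - ev r (Abs_l2 a) x = 0" for x
  proof (rule fourier_unique)
    show "continuous_on UNIV (\<lambda>x. f x - ev r (Abs_l2 a) x)"
      using f r by (intro continuous_intros) (auto simp: sobolev_def ev_def continuous_on_wien wsum_cf)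
    show "f (x + 2 * pi) - ev r (Abs_l2 a) (x + 2 * pi) = f x - ev r (Abs_l2 a) x" for x
      using f by (simp add: sobolev_def ev_def wien_periodic)
    have int: "(\<lambda>x. g x * ek (- k) x) integrable_on {0..2*pi}" if "g \<in> sobolev r" for g k
      using that unfolding sobolev_def
      by (intro integrable_continuous_interval continuous_intros continuous_on_ek)
        (auto intro: continuous_on_subset)
    show "fourier_coeff (\<lambda>x. f x - ev r (Abs_l2 a) x) k = 0" for k
      using int[OF f, of k] int[OF ev_in_sobolev[OF r], of "Abs_l2 a" k] fourier_coeff_ev[OF r, of
          "Abs_l2 a" k]
      by (simp add: cfa fourier_coeff_ek Pi0_def left_diff_distrib integral_diff diff_divide_distrib)
  qed
  then have "f = ev r (Abs_l2 a)" by (simp add: fun_eq_iff)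
  then show "f \<in> range (ev r)" by blast
qed (auto simp: ev_in_sobolev[OF r])

text \<open>Sobolev embedding by Cauchy-Schwarz. Continuity of point evaluation is what links
  integrals of sequences with the pointwise integral in Duhamel's formula.\<close>

lemma bounded_linear_ev:
  assumes r: "r > 1/2"
  shows "bounded_linear (\<lambda>x. ev r x t)"
proof (rule bounded_linear_intro)
  show "ev r (x + y) t = ev r x t + ev r y t" for x y by (simp only: ev_add[OF r])
  show "ev r (c *\<^sub>R x) t = c *\<^sub>R ev r x t" for c x
    by (simp add: ev_def scaleR_conv_of_real wien_cmult cf_def[abs_def] mult_ac)
  fix x
  have "norm (ev r x t) \<le> (\<Sum>\<^sub>\<infinity>k. cmod (cf r x k))"
    unfolding ev_def wien_def
    using norm_infsum_bound[of "\<lambda>k. cf r x k * ek k t" UNIV] wsum_cf[OF r, of x]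
    by (simp add: norm_mult wsum_def)
  also have "\<dots> \<le> norm x * sqrt (jb_zeta r)"
  proof (rule infsum_le_finite_sums)
    show "(\<lambda>k. cmod (cf r x k)) summable_on UNIV" using wsum_cf[OF r, of x] by (simp add: wsum_def)
    fix F :: "int set" assume F: "finite F"
    have "(\<Sum>k\<in>F. cmod (cf r x k))\<^sup>2 = (\<Sum>k\<in>F. cmod (coord x k) * jb k powr (-r/2))\<^sup>2"
      by (simp add: cf_def norm_mult mult.commute)
    also have "\<dots> \<le> (\<Sum>k\<in>F. (cmod (coord x k))\<^sup>2) * (\<Sum>k\<in>F. (jb k powr (-r/2))\<^sup>2)"
      by (rule Cauchy_Schwarz_ineq_sum)
    also have "\<dots> \<le> (norm x)\<^sup>2 * jb_zeta r"
      unfolding jb_powr_half_sq using F r by (intro mult_mono sum_coord_le sum_jb_le) (auto intro: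
          sum_nonneg)
    also have "\<dots> = (norm x * sqrt (jb_zeta r))\<^sup>2"
      by (simp add: power_mult_distrib jb_zeta_nonneg)
    finally show "(\<Sum>k\<in>F. cmod (cf r x k)) \<le> norm x * sqrt (jb_zeta r)"
      by (rule power2_le_imp_le) (simp add: jb_zeta_nonneg)
  qed
  finally show "norm (ev r x t) \<le> norm x * sqrt (jb_zeta r)" .
qed

lemma fourier_multiplier_ev:
  assumes "r > 1/2" "\<And>k. cmod (m k) \<le> C"
  shows "fourier_multiplier m (ev r x) = ev r (diag m x)"
proof -
  have "(\<lambda>k. m k * cf r x k) = cf r (diag m x)"
    by (simp add: fun_eq_iff cf_def coord_diag[of m C, OF assms(2)] mult_ac)
  then show ?thesis
    unfolding ev_def by (simp only: fourier_multiplier_wien[OF wsum_cf[OF assms(1)]])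
qed

section \<open>The free group\<close>

definition su :: "real \<Rightarrow> int \<Rightarrow> complex" where
  "su t k = exp (- \<i> * of_real t * (of_int k)\<^sup>2)"

lemma su_eq_cis: "su t k = cis (- t * (of_int k)\<^sup>2)"
  by (simp add: su_def cis_conv_exp mult_ac)

lemma cmod_su [simp]: "cmod (su t k) = 1"
  by (simp add: su_eq_cis)

lemma su_add: "su (s + t) k = su s k * su t k"
  by (simp add: su_eq_cis cis_mult algebra_simps)

lemma su_0 [simp]: "su 0 k = 1"
  by (simp add: su_def)

definition sg :: "real \<Rightarrow> l2 \<Rightarrow> l2" where
  "sg t = diag (su t)"

lemma coord_sg [simp]: "coord (sg t x) k = su t k * coord x k"
  unfolding sg_def by (rule coord_diag[where C = 1]) simp

lemma norm_sg [simp]: "norm (sg t x) = norm x"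
proof -
  have "(norm (sg t x))\<^sup>2 = (norm x)\<^sup>2" by (simp add: l2_norm_eq norm_mult)
  then show ?thesis by (simp add: power2_eq_iff_nonneg)
qed

lemma sg_sg: "sg s (sg t x) = sg (s + t) x"
  by (rule l2_eqI) (simp add: su_add mult_ac)

lemma sg_0 [simp]: "sg 0 x = x"
  by (rule l2_eqI) simp

lemma bounded_linear_sg: "bounded_linear (sg t)"
  unfolding sg_def by (rule bounded_linear_diag[where C = 1]) simp

lemmas sg_diff = linear_diff[OF bounded_linear.linear[OF bounded_linear_sg]]
lemmas sg_add = linear_add[OF bounded_linear.linear[OF bounded_linear_sg]]

lemma schroedinger_group_ev: "r > 1/2 \<Longrightarrow> schroedinger_group t (ev r x) = ev r (sg t x)"
  using fourier_multiplier_ev[of r "su t" 1 x]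
  by (simp add: schroedinger_group_def sg_def su_def[abs_def])

text \<open>The group is only strongly continuous: the high frequencies are controlled by the fixed
  summable majorant 4 |x_k|^2, not uniformly over a ball.\<close>

lemma tendsto_sg: "((\<lambda>t. sg t x) \<longlongrightarrow> sg s x) (at s within A)"
proof -
  let ?D = "\<lambda>t. \<Sum>\<^sub>\<infinity>k. (cmod (su t k - su s k))\<^sup>2 * (cmod (coord x k))\<^sup>2"
  have "uniform_limit UNIV (\<lambda>F t. \<Sum>k\<in>F. (cmod (su t k - su s k))\<^sup>2 * (cmod (coord x k))\<^sup>2) ?D
      (finite_subsets_at_top UNIV)"
  proof (rule Weierstrass_m_test_general)
    show "(\<lambda>k. 4 * (cmod (coord x k))\<^sup>2) summable_on UNIV"
      by (rule summable_on_cmult_right[OF coord_summable])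
    fix k t
    have "cmod (su t k - su s k) \<le> 2" using norm_triangle_ineq4[of "su t k" "su s k"] by simp
    then have "(cmod (su t k - su s k))\<^sup>2 \<le> 2\<^sup>2" by (intro power_mono) auto
    then show "norm ((cmod (su t k - su s k))\<^sup>2 * (cmod (coord x k))\<^sup>2) \<le> 4 * (cmod (coord x k))\<^sup>2"
      by (simp add: mult_right_mono)
  qed
  then have "continuous_on UNIV ?D"
    by (rule uniform_limit_theorem[rotated])
      (auto intro!: always_eventually continuous_intros simp: su_def)
  then have "(?D \<longlongrightarrow> ?D s) (at s within A)"
    unfolding continuous_on_def by (meson UNIV_I subset_UNIV tendsto_within_subset)
  then have "((\<lambda>t. (norm (sg t x - sg s x))\<^sup>2) \<longlongrightarrow> 0) (at s within A)"
    by (simp add: l2_norm_eq norm_mult power_mult_distrib flip: left_diff_distrib)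
  then have "((\<lambda>t. sqrt ((norm (sg t x - sg s x))\<^sup>2)) \<longlongrightarrow> sqrt 0) (at s within A)"
    by (rule tendsto_real_sqrt)
  then show ?thesis by (subst Lim_null) (simp add: tendsto_norm_zero_iff)
qed

text \<open>Since the group is isometric, a change of the vector is harmless at every time; strong
  continuity is used at the fixed vector \<open>w s\<close> only.\<close>

lemma continuous_on_sg:
  assumes g: "continuous_on A g" and w: "continuous_on A w"
  shows "continuous_on A (\<lambda>s. sg (g s) (w s))"
  unfolding continuous_on_def
proof
  fix s assume s: "s \<in> A"
  have 1: "((\<lambda>t. norm (w t - w s)) \<longlongrightarrow> 0) (at s within A)"
    using w s by (auto simp: continuous_on_def intro!: tendsto_norm_zero LIM_zero)
  have "isCont (\<lambda>t. sg t (w s)) (g s)"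
    using tendsto_sg[of "w s" "g s" UNIV] by (simp add: isCont_def)
  then have 2: "((\<lambda>t. norm (sg (g t) (w s) - sg (g s) (w s))) \<longlongrightarrow> 0) (at s within A)"
    using isCont_tendsto_compose[of "g s" "\<lambda>t. sg t (w s)" g "at s within A"] g s
    by (intro tendsto_norm_zero LIM_zero) (simp add: continuous_on_def)
  have "((\<lambda>t. sg (g t) (w t) - sg (g s) (w s)) \<longlongrightarrow> 0) (at s within A)"
  proof (rule Lim_null_comparison[OF always_eventually])
    show "((\<lambda>t. norm (w t - w s) + norm (sg (g t) (w s) - sg (g s) (w s))) \<longlongrightarrow> 0) (at s within A)"
      using tendsto_add[OF 1 2] by simp
    have "sg (g t) (w t) - sg (g s) (w s) = sg (g t) (w t - w s) + (sg (g t) (w s) - sg (g s) (w s))" for t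
      by (simp add: sg_diff)
    then show "\<forall>t. norm (sg (g t) (w t) - sg (g s) (w s))
        \<le> norm (w t - w s) + norm (sg (g t) (w s) - sg (g s) (w s))"
      by (metis norm_sg norm_triangle_ineq)
  qed
  then show "((\<lambda>t. sg (g t) (w t)) \<longlongrightarrow> sg (g s) (w s)) (at s within A)"
    by (rule LIM_zero_cancel)
qed

section \<open>Cubic products\<close>

definition tsum :: "(int \<Rightarrow> int \<times> int \<Rightarrow> complex) \<Rightarrow> (int \<Rightarrow> complex) \<Rightarrow> (int \<Rightarrow> complex) \<Rightarrow> (int \<Rightarrow> complex)
    \<Rightarrow> int \<Rightarrow> complex" where
  "tsum m a b c k = (\<Sum>\<^sub>\<infinity>p. m k p * tprod a b c k p)"

lemma wsum_bounded:
  assumes "wsum a" obtains C where "\<And>k. cmod (a k) \<le> C" "C \<ge> 0"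
proof
  show "cmod (a k) \<le> (\<Sum>\<^sub>\<infinity>k. cmod (a k))" for k
    using finite_sum_le_infsum[of "\<lambda>k. cmod (a k)" UNIV "{k}"] assms by (simp add: wsum_def)
qed (simp add: infsum_nonneg)

lemma tprod_summable:
  assumes "wsum a" "wsum b" "wsum c"
  shows "(\<lambda>p. cmod (tprod a b c k p)) summable_on UNIV"
proof -
  obtain C where C: "\<And>k. cmod (c k) \<le> C" "C \<ge> 0" using wsum_bounded[OF assms(3)] by blast
  have "(\<lambda>p. cmod (a (fst p)) * cmod (b (snd p)) * C) summable_on UNIV"
    using assms unfolding wsum_def by (intro summable_on_cmult_left summable_on_prod) auto
  then show ?thesis
    by (rule Infinite_Sum.abs_summable_on_comparison_test')
      (simp add: tprod_def norm_mult mult_left_mono C)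
qed

lemma tsum_summable:
  assumes "wsum a" "wsum b" "wsum c" "\<And>p. cmod (m p) \<le> C"
  shows "(\<lambda>p. m p * tprod a b c k p) summable_on UNIV"
proof (rule abs_summable_summable, rule Infinite_Sum.abs_summable_on_comparison_test')
  show "(\<lambda>p. C * cmod (tprod a b c k p)) summable_on UNIV"
    by (rule summable_on_cmult_right[OF tprod_summable[OF assms(1-3)]])
qed (simp add: norm_mult mult_right_mono assms)

lemma infsum_pair:
  fixes f :: "int \<times> int \<Rightarrow> complex"
  assumes "f summable_on UNIV"
  shows "(\<Sum>\<^sub>\<infinity>i. \<Sum>\<^sub>\<infinity>j. f (i, j)) = infsum f UNIV"
    and "(\<Sum>\<^sub>\<infinity>j. \<Sum>\<^sub>\<infinity>i. f (i, j)) = infsum f UNIV"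
proof -
  show 1: "(\<Sum>\<^sub>\<infinity>i. \<Sum>\<^sub>\<infinity>j. f (i, j)) = infsum f UNIV"
    using infsum_Sigma_banach[of f UNIV "\<lambda>_. UNIV"] assms by simp
  show "(\<Sum>\<^sub>\<infinity>j. \<Sum>\<^sub>\<infinity>i. f (i, j)) = infsum f UNIV"
    unfolding 1[symmetric] by (rule infsum_swap_banach[symmetric]) (use assms in simp)
qed

text \<open>The pattern of the product of a filtered conjugate with a filtered square: the conjugate
  factor has frequency - k1, the square k2 + k3 = k + k1.\<close>

lemma conv_conv_conj_first:
  assumes "wsum a" "wsum b" "wsum c" "\<And>k. cmod (\<alpha> k) \<le> 1" "\<And>k. cmod (\<beta> k) \<le> 1"
  shows "conv (\<lambda>j. \<alpha> j * cnj (a (- j))) (\<lambda>l. \<beta> l * conv b c l) k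
    = tsum (\<lambda>k p. \<alpha> (- fst p) * \<beta> (k + fst p)) a b c k"
proof -
  have "conv (\<lambda>j. \<alpha> j * cnj (a (- j))) (\<lambda>l. \<beta> l * conv b c l) k
      = (\<Sum>\<^sub>\<infinity>j. \<alpha> (- j) * cnj (a j) * (\<beta> (k + j) * conv b c (k + j)))"
    unfolding conv_def[of "\<lambda>j. \<alpha> j * cnj (a (- j))"]
    by (rule infsum_reindex_bij_witness[of _ uminus uminus]) auto
  also have "\<dots> = (\<Sum>\<^sub>\<infinity>j. \<Sum>\<^sub>\<infinity>l. \<alpha> (- j) * cnj (a j) * (\<beta> (k + j) * (b l * c (k + j - l))))"
    by (simp add: conv_def infsum_cmult_right')
  also have "\<dots> = (\<Sum>\<^sub>\<infinity>j. \<Sum>\<^sub>\<infinity>l. (\<lambda>p. \<alpha> (- fst p) * \<beta> (k + fst p) * tprod a b c k p) (j, l))"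
    by (simp add: tprod_def mult_ac)
  also have "\<dots> = tsum (\<lambda>k p. \<alpha> (- fst p) * \<beta> (k + fst p)) a b c k"
    unfolding tsum_def
    by (rule infsum_pair(1)[of "\<lambda>p. \<alpha> (- fst p) * \<beta> (k + fst p) * tprod a b c k p"])
      (rule tsum_summable[where C = 1], auto simp: norm_mult mult_le_one assms)
  finally show ?thesis .
qed

text \<open>The pattern of a function times a filtered modulus square: that modulus square has
  frequency k3 - k1 = k - k2.\<close>

lemma conv_conv_conj_second:
  assumes "wsum a" "wsum b" "wsum c" "\<And>k. cmod (\<beta> k) \<le> 1"
  shows "conv b (\<lambda>l. \<beta> l * conv (\<lambda>j. cnj (a (- j))) c l) k
    = tsum (\<lambda>k p. \<beta> (k - snd p)) a b c k"
proof -
  have "conv (\<lambda>j. cnj (a (- j))) c l = (\<Sum>\<^sub>\<infinity>i. cnj (a i) * c (l + i))" for l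
    unfolding conv_def by (rule infsum_reindex_bij_witness[of _ uminus uminus]) auto
  then have "conv b (\<lambda>l. \<beta> l * conv (\<lambda>j. cnj (a (- j))) c l) k
      = (\<Sum>\<^sub>\<infinity>j. \<Sum>\<^sub>\<infinity>i. b j * (\<beta> (k - j) * (cnj (a i) * c (k - j + i))))"
    unfolding conv_def[of b] by (simp add: infsum_cmult_right')
  also have "\<dots> = (\<Sum>\<^sub>\<infinity>j. \<Sum>\<^sub>\<infinity>i. (\<lambda>p. \<beta> (k - snd p) * tprod a b c k p) (i, j))"
    by (simp add: tprod_def mult_ac algebra_simps)
  also have "\<dots> = tsum (\<lambda>k p. \<beta> (k - snd p)) a b c k"
    unfolding tsum_def
    by (rule infsum_pair(2)[of "\<lambda>p. \<beta> (k - snd p) * tprod a b c k p"])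
      (rule tsum_summable[where C = 1], auto intro: assms)
  finally show ?thesis .
qed

lemma wien_cubic:
  assumes a: "wsum a"
  shows "of_real ((cmod (wien a x))\<^sup>2) * wien a x = wien (tsum (\<lambda>_ _. 1) a a a) x"
    and "wsum (tsum (\<lambda>_ _. 1) a a a)"
proof -
  have eq: "conv (\<lambda>j. cnj (a (- j))) (conv a a) = tsum (\<lambda>_ _. 1) a a a"
    using conv_conv_conj_first[OF a a a, of "\<lambda>_. 1" "\<lambda>_. 1"] by auto
  show "wsum (tsum (\<lambda>_ _. 1) a a a)"
    unfolding eq[symmetric] by (intro wsum_conv wsum_cnj a)
  have "of_real ((cmod (wien a x))\<^sup>2) * wien a x = cnj (wien a x) * (wien a x * wien a x)"
    by (simp only: complex_norm_square mult_ac)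
  also have "\<dots> = wien (tsum (\<lambda>_ _. 1) a a a) x"
    unfolding eq[symmetric] wien_cnj by (simp add: wien_mult wsum_conv wsum_cnj a)
  finally show "of_real ((cmod (wien a x))\<^sup>2) * wien a x = wien (tsum (\<lambda>_ _. 1) a a a) x" .
qed

text \<open>The cubic form with Fourier symbol \<open>m\<close>, acting on weighted sequences.\<close>

definition ksym :: "real \<Rightarrow> (int \<Rightarrow> int \<times> int \<Rightarrow> complex) \<Rightarrow> int \<Rightarrow> int \<times> int \<Rightarrow> complex" where
  "ksym r m k p = m k p * of_real (wt r k p)"

lemma ksym_tprod:
  "of_real (jb k powr (-r/2)) * (ksym r m k p * ctprod x y z k p)
    = m k p * tprod (cf r x) (cf r y) (cf r z) k p"
  using of_real_jb_powr_cancel[of k r]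
  unfolding ksym_def wt_def tprod_def cf_def of_real_mult complex_cnj_mult complex_cnj_complex_of_real
  by algebra

lemma cf_tri_ksym:
  assumes "kernel_bdd K (ksym r m)"
  shows "cf r (tri (ksym r m) x y z) k = tsum m (cf r x) (cf r y) (cf r z) k"
  unfolding cf_def[of r "tri (ksym r m) x y z"] coord_tri[OF assms] tsum_def
  by (subst infsum_cmult_right'[symmetric]) (rule infsum_cong[OF ksym_tprod])

lemma kernel_bdd_unit:
  assumes "r > 1/2" "C \<ge> 0" "\<And>k p. cmod (m k p) \<le> C"
  shows "kernel_bdd (C * (sqrt (3 * 9 powr r) * jb_zeta r)) (ksym r m)"
  by (intro kernel_bdd_wt assms) (simp add: ksym_def norm_mult wt_nonneg mult_right_mono assms)

section \<open>Ordinary differential equations with a cubic right-hand side\<close>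

text \<open>Growth at rate 2c against Lipschitz constant c: the integral gains a factor 1/2 on
  intervals of any length, so no smallness of \<open>t\<close> is required.\<close>

lemma integral_Lipschitz_exp_bound:
  fixes g :: "real \<Rightarrow> 'a :: banach"
  assumes t: "t \<ge> 0" and cont: "continuous_on {0..t} g" and c: "c > 0"
    and le: "\<And>s. s \<in> {0..t} \<Longrightarrow> norm (g s) \<le> c * m * exp (2 * c * s)"
  shows "norm (integral {0..t} g) \<le> m / 2 * (exp (2 * c * t) - 1)"
proof -
  have "((\<lambda>s. c * m * exp (2 * c * s)) has_integral (m / 2 * exp (2 * c * t) - m / 2 * exp (2 * c
      * 0))) {0..t}"
    using t by (intro fundamental_theorem_of_calculus)
      (auto intro!: derivative_eq_intros simp flip: has_real_derivative_iff_has_vector_derivative)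
  then have I: "((\<lambda>s. c * m * exp (2 * c * s)) has_integral (m / 2 * (exp (2 * c * t) - 1))) {0..t}"
    by (simp add: algebra_simps)
  have "norm (integral {0..t} g) \<le> integral {0..t} (\<lambda>s. c * m * exp (2 * c * s))"
    using I le by (intro integral_norm_bound_integral integrable_continuous_interval cont)
      (auto intro!: continuous_intros)
  then show ?thesis unfolding integral_unique[OF I] .
qed

text \<open>The equation in the interaction picture. Additivity is phrased through differences,
  which suits the conjugate-linear slot as well; continuity in time is required along continuous
  curves, because the free group is merely strongly continuous.\<close>

locale cubic_ode =
  fixes B :: "real \<Rightarrow> 'a \<Rightarrow> 'a \<Rightarrow> 'a \<Rightarrow> 'a :: banach" and C :: real
  assumes diff1: "B s (x - x') y z = B s x y z - B s x' y z"
    and diff2: "B s x (y - y') z = B s x y z - B s x y' z"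
    and diff3: "B s x y (z - z') = B s x y z - B s x y z'"
    and bound: "norm (B s x y z) \<le> C * (norm x * norm y * norm z)"
    and C_nonneg: "C \<ge> 0"
    and cont: "continuous_on A w \<Longrightarrow> continuous_on A (\<lambda>s. B s (w s) (w s) (w s))"
begin

abbreviation K :: "real \<Rightarrow> 'a \<Rightarrow> 'a" where
  "K s x \<equiv> B s x x x"

definition solves :: "real \<Rightarrow> 'a \<Rightarrow> (real \<Rightarrow> 'a) \<Rightarrow> bool" where
  "solves \<tau> v w \<longleftrightarrow> continuous_on {0..\<tau>} w \<and>
     (\<forall>t\<in>{0..\<tau>}. w t = v + integral {0..t} (\<lambda>s. K s (w s)))"

lemma triple_diff:
  "B s x y z - B s x' y' z' = B s (x - x') y z + B s x' (y - y') z + B s x' y' (z - z')"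
  by (simp add: diff1 diff2 diff3)

lemma bound_le:
  assumes "norm x \<le> a" "norm y \<le> b" "norm z \<le> c"
  shows "norm (B s x y z) \<le> C * (a * b * c)"
proof -
  have "0 \<le> a" "0 \<le> b" "0 \<le> c" using assms norm_ge_zero order_trans by metis+
  then have "norm x * norm y * norm z \<le> a * b * c"
    using assms by (intro mult_mono) auto
  then show ?thesis using bound[of s x y z] C_nonneg by (meson mult_left_mono order_trans)
qed

lemma triple_diff_bound:
  assumes "norm (x - x') \<le> \<alpha>" "norm (y - y') \<le> \<beta>" "norm (z - z') \<le> \<gamma>"
    and "norm x' \<le> a" "norm y \<le> b" "norm y' \<le> b" "norm z \<le> c"
  shows "norm (B s x y z - B s x' y' z') \<le> C * (\<alpha> * b * c) + C * (a * \<beta> * c) + C * (a * b * \<gamma>)"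
  unfolding triple_diff by (intro norm_triangle_le add_mono bound_le assms)

lemma K_0: "K s 0 = 0"
  using bound[of s 0 0 0] by simp

lemma K_bound: "norm x \<le> R \<Longrightarrow> norm (K s x) \<le> C * R ^ 3"
  using bound_le[of x R x R x R s] by (simp add: power3_eq_cube)

lemma K_lip:
  assumes "norm x \<le> R" "norm y \<le> R"
  shows "norm (K s x - K s y) \<le> 3 * C * R\<^sup>2 * norm (x - y)"
proof -
  have "norm (K s x - K s y) \<le> C * (norm (x - y) * R * R) + C * (R * norm (x - y) * R) + C * (R *
      R * norm (x - y))"
    by (rule triple_diff_bound) (use assms in auto)
  also have "\<dots> = 3 * C * R\<^sup>2 * norm (x - y)"
    by (simp add: power2_eq_square algebra_simps)
  finally show ?thesis .
qed

text \<open>Both increments are telescoped into three terms, each containing the displacement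
  \<open>X - x\<close> or \<open>Y - y\<close> once; a second telescoping compares corresponding
  terms. It provides Lipschitz bounds, not just size bounds, for the Taylor remainder.\<close>

lemma K_second_diff:
  assumes "norm x \<le> \<rho>" "norm y \<le> \<rho>" "norm X \<le> \<rho>" "norm Y \<le> \<rho>"
    and "norm (X - x) \<le> \<delta>" "norm (Y - y) \<le> \<delta>" "norm ((X - x) - (Y - y)) \<le> \<eta>"
    and "norm (x - y) \<le> \<xi>" "norm (X - Y) \<le> \<xi>'"
  shows "norm ((K s X - K s x) - (K s Y - K s y)) \<le> 3 * C * \<rho>\<^sup>2 * \<eta> + 3 * C * \<rho> * \<delta> * (\<xi> + \<xi>')"
proof -
  have K: "K s X - K s x = B s (X - x) X X + B s x (X - x) X + B s x x (X - x)" for X x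
    by (rule triple_diff)
  have "norm ((K s X - K s x) - (K s Y - K s y)) \<le>
    norm (B s (X - x) X X - B s (Y - y) Y Y) + norm (B s x (X - x) X - B s y (Y - y) Y)
    + norm (B s x x (X - x) - B s y y (Y - y))"
    unfolding K add_diff_add by (intro norm_triangle_le add_mono order_refl)
  also have "\<dots> \<le> (C * (\<eta> * \<rho> * \<rho>) + C * (\<delta> * \<xi>' * \<rho>) + C * (\<delta> * \<rho> * \<xi>'))
    + (C * (\<xi> * \<delta> * \<rho>) + C * (\<rho> * \<eta> * \<rho>) + C * (\<rho> * \<delta> * \<xi>'))
    + (C * (\<xi> * \<rho> * \<delta>) + C * (\<rho> * \<xi> * \<delta>) + C * (\<rho> * \<rho> * \<eta>))"
    by (intro add_mono triple_diff_bound assms)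
  also have "\<dots> = 3 * C * \<rho>\<^sup>2 * \<eta> + 3 * C * \<rho> * \<delta> * (\<xi> + \<xi>')"
    by (simp add: power2_eq_square algebra_simps)
  finally show ?thesis .
qed

section \<open>Uniqueness and existence for the integral equation\<close>

lemma solves_bounded:
  assumes "solves \<tau> v w"
  obtains R where "\<And>t. t \<in> {0..\<tau>} \<Longrightarrow> norm (w t) \<le> R"
proof -
  have "bounded (w ` {0..\<tau>})"
    using assms by (intro compact_imp_bounded compact_continuous_image) (auto simp: solves_def)
  then obtain R where "\<forall>x\<in>w ` {0..\<tau>}. norm x \<le> R" unfolding bounded_iff ..
  then show ?thesis using that[of R] by blast
qed

lemma continuous_on_K:
  assumes "solves \<tau> v w" "t \<le> \<tau>"
  shows "continuous_on {0..t} (\<lambda>s. K s (w s))"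
  using assms by (intro cont) (auto simp: solves_def intro: continuous_on_subset)

text \<open>At a maximum of the exponentially weighted difference, the integral equation bounds that
  maximum by less than half of itself, so it vanishes; the interval may be long.\<close>

lemma solves_unique:
  assumes w: "solves \<tau> v w" and w': "solves \<tau> v w'" and t: "t \<in> {0..\<tau>}"
  shows "w t = w' t"
proof -
  obtain R1 R2 where "\<And>t. t \<in> {0..\<tau>} \<Longrightarrow> norm (w t) \<le> R1" "\<And>t. t \<in> {0..\<tau>} \<Longrightarrow> norm (w' t) \<le> R2"
    using solves_bounded[OF w] solves_bounded[OF w'] by metis
  then have R: "norm (w t) \<le> max R1 R2" "norm (w' t) \<le> max R1 R2" if "t \<in> {0..\<tau>}" for t
    using that by (auto simp: le_max_iff_disj)
  \<comment> \<open>The added 1 keeps \<open>c\<close> positive when the Lipschitz constant is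
    0.\<close>
  define c where "c = 3 * C * (max R1 R2)\<^sup>2 + 1"
  have c: "c > 0" using C_nonneg by (simp add: c_def add_nonneg_pos)
  define E where "E = (\<lambda>t. exp (- 2 * c * t) * norm (w t - w' t))"
  have "continuous_on {0..\<tau>} E"
    unfolding E_def using w w' by (intro continuous_intros) (auto simp: solves_def)
  then obtain u where u: "u \<in> {0..\<tau>}" "\<And>s. s \<in> {0..\<tau>} \<Longrightarrow> E s \<le> E u"
    using continuous_attains_sup[of "{0..\<tau>}" E] t by auto
  have D: "norm (w s - w' s) = E s * exp (2 * c * s)" for s
    by (simp add: E_def flip: exp_add)
  have "w u - w' u = integral {0..u} (\<lambda>s. K s (w s) - K s (w' s))"
    using w w' u by (simp add: solves_def integral_diff integrable_continuous_interval
        continuous_on_K[OF w] continuous_on_K[OF w'])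
  also have "norm \<dots> \<le> E u / 2 * (exp (2 * c * u) - 1)"
  proof (rule integral_Lipschitz_exp_bound)
    show "continuous_on {0..u} (\<lambda>s. K s (w s) - K s (w' s))"
      using u by (intro continuous_on_diff continuous_on_K[OF w] continuous_on_K[OF w']) auto
    fix s assume "s \<in> {0..u}"
    then have s: "s \<in> {0..\<tau>}" using u by auto
    have "norm (K s (w s) - K s (w' s)) \<le> 3 * C * (max R1 R2)\<^sup>2 * norm (w s - w' s)"
      by (intro K_lip R s)
    also have "\<dots> \<le> c * norm (w s - w' s)"
      by (intro mult_right_mono) (auto simp: c_def)
    also have "\<dots> = c * E s * exp (2 * c * s)" by (simp add: D)
    also have "\<dots> \<le> c * E u * exp (2 * c * s)"
      using u(2)[OF s] c by (intro mult_right_mono mult_left_mono) auto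
    finally show "norm (K s (w s) - K s (w' s)) \<le> c * E u * exp (2 * c * s)" .
  qed (use u c in auto)
  finally have "E u * exp (2 * c * u) \<le> E u / 2 * (exp (2 * c * u) - 1)" by (simp only: D)
  then have "E u * (exp (2 * c * u) + 1) \<le> 0" by (simp add: algebra_simps)
  moreover have "exp (2 * c * u) + 1 > 0" by (simp add: add_pos_pos)
  ultimately have "E u \<le> 0" by (metis mult_le_0_iff not_le)
  then have "E t \<le> 0" using u(2)[OF t] by simp
  then show ?thesis by (simp add: E_def mult_le_0_iff)
qed

text \<open>\<open>small R \<tau>\<close> makes the Picard iteration contract on the unit balls around data of norm at most \<open>R\<close>.\<close>

definition small :: "real \<Rightarrow> real \<Rightarrow> bool" where
  "small R \<tau> \<longleftrightarrow> 0 \<le> R \<and> 0 \<le> \<tau> \<and> \<tau> * (3 * C * (R + 1) ^ 3) \<le> 1/2"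

lemma small_le:
  assumes "small R \<tau>"
  shows "\<tau> * (3 * C * (R + 1)\<^sup>2) \<le> 1/2" "\<tau> * (C * (R + 1) ^ 3) \<le> 1"
proof -
  have "(R + 1)\<^sup>2 \<le> (R + 1) ^ 3" using assms by (intro power_increasing) (auto simp: small_def)
  then have "\<tau> * (3 * C * (R + 1)\<^sup>2) \<le> \<tau> * (3 * C * (R + 1) ^ 3)"
    using assms C_nonneg by (intro mult_left_mono) (auto simp: small_def)
  then show "\<tau> * (3 * C * (R + 1)\<^sup>2) \<le> 1/2"
    using assms unfolding small_def by linarith
  have "0 \<le> \<tau> * (C * (R + 1) ^ 3)" using assms C_nonneg by (simp add: small_def)
  then show "\<tau> * (C * (R + 1) ^ 3) \<le> 1" using assms by (simp add: small_def)
qed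

text \<open>Banach's fixed point theorem for curves in the unit ball around \<open>v\<close>. The
  cubic bound on \<open>K\<close> keeps the ball invariant, the quadratic Lipschitz constant gives
  contraction by 1/2.\<close>

lemma solves_exists:
  assumes v: "norm v \<le> R" and sm: "small R \<tau>"
  shows "\<exists>w. solves \<tau> v w \<and> (\<forall>t\<in>{0..\<tau>}. norm (w t - v) \<le> 1)"
proof -
  have \<tau>: "\<tau> \<ge> 0" using sm by (simp add: small_def)
  \<comment> \<open>Clamping time to \<open>{0..\<tau>}\<close> extends curves to the whole line,
    where bounded continuous functions form a complete space.\<close>
  define c where "c = (\<lambda>t. max 0 (min \<tau> t))"
  have c: "c t \<in> {0..\<tau>}" for t using \<tau> by (auto simp: c_def)
  define S where "S = PiC (UNIV :: real set) (\<lambda>_. cball v 1)"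
  define J where "J = (\<lambda>f :: real \<Rightarrow>\<^sub>C 'a. \<lambda>t. v + integral {0..c t} (\<lambda>s. K s (f s)))"
  have inS: "f \<in> S \<longleftrightarrow> (\<forall>t. norm (apply_bcontfun f t - v) \<le> 1)" for f
    by (auto simp: S_def mem_PiC_iff dist_norm norm_minus_commute Pi_def)
  have nS: "norm (apply_bcontfun f t) \<le> R + 1" if "f \<in> S" for f t
    using that v norm_triangle_sub[of "apply_bcontfun f t" v] unfolding inS by (smt (verit))
  have Kc: "continuous_on A (\<lambda>s. K s (apply_bcontfun f s))" for f A
    by (intro cont continuous_on_apply_bcontfun)
  have Jb: "norm (J f t - v) \<le> 1" if "f \<in> S" for f t
  proof -
    have "norm (integral {0..c t} (\<lambda>s. K s (f s))) \<le> C * (R + 1) ^ 3 * (c t - 0)"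
      using c[of t] by (intro integral_bound Kc K_bound nS that) auto
    also have "\<dots> \<le> C * (R + 1) ^ 3 * \<tau>"
      using c[of t] C_nonneg sm by (intro mult_left_mono) (auto simp: small_def)
    also have "\<dots> \<le> 1" using small_le(2)[OF sm] by (simp add: mult_ac)
    finally show ?thesis by (simp add: J_def)
  qed
  have Jc: "J f \<in> bcontfun" if "f \<in> S" for f
  proof (rule bcontfun_normI)
    have "continuous_on {0..\<tau>} (\<lambda>u. integral {0..u} (\<lambda>s. K s (f s)))"
      by (intro indefinite_integral_continuous_1 integrable_continuous_interval Kc)
    then have "continuous_on UNIV (\<lambda>t. integral {0..c t} (\<lambda>s. K s (f s)))"
      by (rule continuous_on_compose2) (use c in \<open>auto simp: c_def intro!: continuous_intros\<close>)
    then show "continuous_on UNIV (J f)" unfolding J_def by (intro continuous_intros)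
    show "norm (J f t) \<le> norm v + 1" for t
      using Jb[OF that, of t] norm_triangle_sub[of "J f t" v] by linarith
  qed
  have "\<exists>!f\<in>S. Bcontfun (J f) = f"
  proof (rule Banach_fix[where c = "1/2"])
    show "complete S" unfolding S_def complete_eq_closed by (intro closed_PiC) auto
    have "apply_bcontfun (const_bcontfun v) t = v" for t by simp
    then have "const_bcontfun v \<in> S" by (simp add: inS)
    then show "S \<noteq> {}" by blast
    show "(\<lambda>f. Bcontfun (J f)) ` S \<subseteq> S"
      by (auto simp: inS Bcontfun_inverse Jc Jb)
    show "dist (Bcontfun (J f)) (Bcontfun (J g)) \<le> 1/2 * dist f g" if fg: "f \<in> S" "g \<in> S" for f g
    proof (rule dist_bound)
      fix t
      have "J f t - J g t = integral {0..c t} (\<lambda>s. K s (f s) - K s (g s))"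
        by (simp add: J_def integral_diff integrable_continuous_interval Kc)
      also have "norm \<dots> \<le> 3 * C * (R + 1)\<^sup>2 * dist f g * (c t - 0)"
      proof (rule integral_bound)
        show "norm (K s (f s) - K s (g s)) \<le> 3 * C * (R + 1)\<^sup>2 * dist f g" for s
        proof -
          have "norm (K s (f s) - K s (g s)) \<le> 3 * C * (R + 1)\<^sup>2 * norm (apply_bcontfun f s -
              apply_bcontfun g s)"
            using fg by (intro K_lip nS) auto
          also have "\<dots> \<le> 3 * C * (R + 1)\<^sup>2 * dist f g"
            using dist_bounded[of f s g] C_nonneg by (intro mult_left_mono) (auto simp: dist_norm)
          finally show ?thesis .
        qed
      qed (use c[of t] in \<open>auto intro!: continuous_intros Kc\<close>)
      also have "\<dots> \<le> 3 * C * (R + 1)\<^sup>2 * dist f g * \<tau>"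
        using c[of t] C_nonneg by (intro mult_left_mono) auto
      also have "\<dots> = (\<tau> * (3 * C * (R + 1)\<^sup>2)) * dist f g" by (simp add: mult_ac)
      also have "\<dots> \<le> 1/2 * dist f g" by (intro mult_right_mono small_le(1)[OF sm]) auto
      finally show "dist (apply_bcontfun (Bcontfun (J f)) t) (apply_bcontfun (Bcontfun (J g)) t) \<le>
          1/2 * dist f g"
        using fg by (simp add: Bcontfun_inverse Jc dist_norm)
    qed
  qed auto
  then obtain f where f: "f \<in> S" "Bcontfun (J f) = f" by blast
  then have fJ: "apply_bcontfun f = J f" using Bcontfun_inverse[OF Jc[OF f(1)]] by simp
  have "solves \<tau> v (apply_bcontfun f)"
    unfolding solves_def
  proof (intro conjI ballI)
    fix t assume "t \<in> {0..\<tau>}"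
    then have "c t = t" by (auto simp: c_def)
    then show "apply_bcontfun f t = v + integral {0..t} (\<lambda>s. K s (apply_bcontfun f s))"
      using fJ unfolding J_def by metis
  qed simp
  then show ?thesis using f(1) unfolding inS by blast
qed

section \<open>Dependence of the solution on the initial value\<close>

definition flow :: "real \<Rightarrow> 'a \<Rightarrow> real \<Rightarrow> 'a" where
  "flow \<tau> v = (SOME w. solves \<tau> v w)"

lemma flow_eq:
  assumes "solves \<tau> v w" "t \<in> {0..\<tau>}"
  shows "flow \<tau> v t = w t"
  using someI[of "solves \<tau> v", OF assms(1)] solves_unique assms unfolding flow_def by blast

lemma solves_flow:
  assumes "norm v \<le> R" "small R \<tau>"
  shows "solves \<tau> v (flow \<tau> v)"
  using solves_exists[OF assms] someI_ex[of "solves \<tau> v"] unfolding flow_def by blast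

lemma flow_ball:
  assumes "norm v \<le> R" "small R \<tau>" "t \<in> {0..\<tau>}"
  shows "norm (flow \<tau> v t) \<le> R + 1"
proof -
  obtain w where "solves \<tau> v w" "\<forall>t\<in>{0..\<tau>}. norm (w t - v) \<le> 1"
    using solves_exists[OF assms(1,2)] by blast
  then have "norm (flow \<tau> v t - v) \<le> 1" using flow_eq assms(3) by metis
  then show ?thesis using assms(1) norm_triangle_sub[of "flow \<tau> v t" v] by linarith
qed

lemma flow_integral:
  assumes "norm v \<le> R" "small R \<tau>" "t \<in> {0..\<tau>}"
  shows "flow \<tau> v t - v = integral {0..t} (\<lambda>s. K s (flow \<tau> v s))"
  using solves_flow[OF assms(1,2)] assms(3) by (simp add: solves_def)

lemma flow_step:
  assumes v: "norm v \<le> R" and sm: "small R \<tau>" and t: "t \<in> {0..\<tau>}"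
  shows "norm (flow \<tau> v t - v) \<le> C * (R + 1) ^ 3 * \<tau>"
proof -
  have "norm (integral {0..t} (\<lambda>s. K s (flow \<tau> v s))) \<le> C * (R + 1) ^ 3 * (t - 0)"
    using t by (intro integral_bound K_bound flow_ball[OF v sm] continuous_on_K[OF solves_flow[OF
        v sm]]) auto
  also have "\<dots> \<le> C * (R + 1) ^ 3 * \<tau>"
    using t C_nonneg sm by (intro mult_left_mono) (auto simp: small_def)
  finally show ?thesis by (simp add: flow_integral[OF v sm t])
qed

lemma flow_lip_aux:
  assumes x: "norm x \<le> R" and y: "norm y \<le> R" and sm: "small R \<tau>" and t: "t \<in> {0..\<tau>}"
    and M: "\<And>s. s \<in> {0..\<tau>} \<Longrightarrow> norm (flow \<tau> x s - flow \<tau> y s) \<le> M" "M \<ge> 0"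
  shows "norm ((flow \<tau> x t - x) - (flow \<tau> y t - y)) \<le> 3 * C * (R + 1)\<^sup>2 * M * \<tau>"
proof -
  have "(flow \<tau> x t - x) - (flow \<tau> y t - y) = integral {0..t} (\<lambda>s. K s (flow \<tau> x s) - K s (flow \<tau> y s))"
    using t by (simp add: flow_integral[OF x sm t] flow_integral[OF y sm t] integral_diff
        integrable_continuous_interval continuous_on_K[OF solves_flow[OF x sm]] continuous_on_K[OF
            solves_flow[OF y sm]])
  also have "norm \<dots> \<le> 3 * C * (R + 1)\<^sup>2 * M * (t - 0)"
  proof (rule integral_bound)
    show "continuous_on {0..t} (\<lambda>s. K s (flow \<tau> x s) - K s (flow \<tau> y s))"
      using t by (intro continuous_on_diff continuous_on_K[OF solves_flow[OF x sm]]
          continuous_on_K[OF solves_flow[OF y sm]]) auto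
    fix s assume "s \<in> {0..t}"
    then have s: "s \<in> {0..\<tau>}" using t by auto
    have "norm (K s (flow \<tau> x s) - K s (flow \<tau> y s)) \<le> 3 * C * (R + 1)\<^sup>2 * norm (flow \<tau> x s - flow \<tau> y s)"
      by (intro K_lip flow_ball[OF _ sm] x y s)
    also have "\<dots> \<le> 3 * C * (R + 1)\<^sup>2 * M"
      using C_nonneg by (intro mult_left_mono M s) auto
    finally show "norm (K s (flow \<tau> x s) - K s (flow \<tau> y s)) \<le> 3 * C * (R + 1)\<^sup>2 * M" .
  qed (use t in auto)
  also have "\<dots> \<le> 3 * C * (R + 1)\<^sup>2 * M * \<tau>"
    using t C_nonneg M by (intro mult_left_mono) auto
  finally show ?thesis .
qed

text \<open>With the largest difference M over the interval, the integral contributes at most M/2 by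
  smallness and is absorbed, whence the factor 2. Feeding this back into the integral gives the
  bound of order \<tau> on the displacements.\<close>

lemma flow_lip:
  assumes x: "norm x \<le> R" and y: "norm y \<le> R" and sm: "small R \<tau>" and t: "t \<in> {0..\<tau>}"
  shows "norm (flow \<tau> x t - flow \<tau> y t) \<le> 2 * norm (x - y)"
    and "norm ((flow \<tau> x t - x) - (flow \<tau> y t - y)) \<le> 6 * C * (R + 1)\<^sup>2 * norm (x - y) * \<tau>"
proof -
  have "continuous_on {0..\<tau>} (\<lambda>s. norm (flow \<tau> x s - flow \<tau> y s))"
    using solves_flow[OF x sm] solves_flow[OF y sm] by (intro continuous_intros) (auto simp: solves_def)
  then obtain u where u: "u \<in> {0..\<tau>}"
    "\<And>s. s \<in> {0..\<tau>} \<Longrightarrow> norm (flow \<tau> x s - flow \<tau> y s) \<le> norm (flow \<tau> x u - flow \<tau> y u)"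
    using continuous_attains_sup[of "{0..\<tau>}" "\<lambda>s. norm (flow \<tau> x s - flow \<tau> y s)"] t by auto
  define M where "M = norm (flow \<tau> x u - flow \<tau> y u)"
  have "M \<le> norm (x - y) + norm ((flow \<tau> x u - x) - (flow \<tau> y u - y))"
    unfolding M_def using norm_triangle_ineq[of "x - y" "(flow \<tau> x u - x) - (flow \<tau> y u - y)"]
    by (simp add: algebra_simps)
  also have "\<dots> \<le> norm (x - y) + 3 * C * (R + 1)\<^sup>2 * M * \<tau>"
    using flow_lip_aux[OF x y sm u(1), of M] u(2) by (simp add: M_def)
  also have "3 * C * (R + 1)\<^sup>2 * M * \<tau> = \<tau> * (3 * C * (R + 1)\<^sup>2) * M" by (simp add: mult_ac)
  also have "\<dots> \<le> 1/2 * M" by (intro mult_right_mono small_le(1)[OF sm]) (simp add: M_def)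
  finally have M: "M \<le> 2 * norm (x - y)" by simp
  then have 1: "norm (flow \<tau> x t - flow \<tau> y t) \<le> 2 * norm (x - y)" if "t \<in> {0..\<tau>}" for t
    using u(2)[OF that] by (simp add: M_def)
  then show "norm (flow \<tau> x t - flow \<tau> y t) \<le> 2 * norm (x - y)" using t by blast
  show "norm ((flow \<tau> x t - x) - (flow \<tau> y t - y)) \<le> 6 * C * (R + 1)\<^sup>2 * norm (x - y) * \<tau>"
    using flow_lip_aux[OF x y sm t 1] by simp
qed

text \<open>The remainder is the integral of the change of \<open>K\<close> along the trajectory.
  The trajectory moves by O(\<tau>), and its displacement depends on the data with Lipschitz
  constant O(\<tau>); integration supplies the second factor \<tau>.\<close>

lemma flow_second_order:
  assumes x: "norm x \<le> R" and y: "norm y \<le> R" and sm: "small R \<tau>"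
  shows "norm ((flow \<tau> x \<tau> - x - integral {0..\<tau>} (\<lambda>s. K s x)) - (flow \<tau> y \<tau> - y - integral {0..\<tau>}
      (\<lambda>s. K s y)))
    \<le> 45 * C\<^sup>2 * (R + 1) ^ 4 * \<tau>\<^sup>2 * norm (x - y)"
proof -
  have \<tau>: "\<tau> \<ge> 0" "R \<ge> 0" using sm by (auto simp: small_def)
  have c: "continuous_on A (\<lambda>s. K s z)" for A z by (rule cont) simp
  note k = continuous_on_K[OF solves_flow[OF x sm] order_refl] continuous_on_K[OF solves_flow[OF y
      sm] order_refl]
  let ?f = "\<lambda>s. (K s (flow \<tau> x s) - K s x) - (K s (flow \<tau> y s) - K s y)"
  have "(flow \<tau> x \<tau> - x - integral {0..\<tau>} (\<lambda>s. K s x)) - (flow \<tau> y \<tau> - y - integral {0..\<tau>} (\<lambda>s. K s y))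
      = integral {0..\<tau>} ?f"
    using \<tau> by (simp add: flow_integral[OF x sm] flow_integral[OF y sm] integral_diff integrable_diff
        integrable_continuous_interval k c)
  also have "norm \<dots> \<le> 45 * C\<^sup>2 * (R + 1) ^ 4 * \<tau> * norm (x - y) * (\<tau> - 0)"
  proof (rule integral_bound)
    show "continuous_on {0..\<tau>} ?f" by (intro continuous_intros k c)
    fix s assume s: "s \<in> {0..\<tau>}"
    have "norm (?f s) \<le> 3 * C * (R + 1)\<^sup>2 * (6 * C * (R + 1)\<^sup>2 * norm (x - y) * \<tau>)
        + 3 * C * (R + 1) * (C * (R + 1) ^ 3 * \<tau>) * (norm (x - y) + 2 * norm (x - y))"
      using x y by (intro K_second_diff flow_lip[OF x y sm s] flow_step[OF x sm s] flow_step[OF y sm s]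
          flow_ball[OF x sm s] flow_ball[OF y sm s]) auto
    \<comment> \<open>The constants add up to 18 + 9 = 27, which is estimated by 45.\<close>
    also have "\<dots> \<le> 45 * C\<^sup>2 * (R + 1) ^ 4 * \<tau> * norm (x - y)"
    proof -
      define \<rho> where "\<rho> = R + 1"
      have "3 * C * \<rho>\<^sup>2 * (6 * C * \<rho>\<^sup>2 * norm (x - y) * \<tau>)
        + 3 * C * \<rho> * (C * \<rho> ^ 3 * \<tau>) * (norm (x - y) + 2 * norm (x - y))
        = 27 * C\<^sup>2 * \<rho> ^ 4 * \<tau> * norm (x - y)"
        by (simp add: power2_eq_square power3_eq_cube power4_eq_xxxx algebra_simps)
      moreover have "0 \<le> C\<^sup>2 * \<rho> ^ 4 * \<tau> * norm (x - y)" using \<tau> by (simp add: \<rho>_def)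
      ultimately show ?thesis unfolding \<rho>_def by linarith
    qed
    finally show "norm (?f s) \<le> 45 * C\<^sup>2 * (R + 1) ^ 4 * \<tau> * norm (x - y)" .
  qed (use \<tau> in auto)
  finally show ?thesis by (simp add: power2_eq_square mult_ac)
qed

end

section \<open>Mild solutions of the Schroedinger equation\<close>

text \<open>The constant of the trilinear estimate at order \<open>r\<close>, as found in
  \<open>sum_wt_sq_le\<close>.\<close>

definition algc :: "real \<Rightarrow> real" where
  "algc r = sqrt (3 * 9 powr r) * jb_zeta r"

lemma algc_nonneg: "algc r \<ge> 0"
  by (simp add: algc_def jb_zeta_nonneg)

definition cubic_ksym :: "real \<Rightarrow> real \<Rightarrow> int \<Rightarrow> int \<times> int \<Rightarrow> complex" where
  "cubic_ksym \<mu> r = ksym r (\<lambda>_ _. - \<i> * of_real \<mu>)"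

lemma kernel_bdd_cubic: "r > 1/2 \<Longrightarrow> kernel_bdd (\<bar>\<mu>\<bar> * algc r) (cubic_ksym \<mu> r)"
  unfolding algc_def cubic_ksym_def by (rule kernel_bdd_unit) (auto simp: norm_mult)

definition nlsN :: "real \<Rightarrow> real \<Rightarrow> l2 \<Rightarrow> l2 \<Rightarrow> l2 \<Rightarrow> l2" where
  "nlsN \<mu> r = tri (cubic_ksym \<mu> r)"

text \<open>The nonlinearity in the interaction picture \<open>w(t) = sg (- t) (u(t))\<close>.\<close>

definition nlsB :: "real \<Rightarrow> real \<Rightarrow> real \<Rightarrow> l2 \<Rightarrow> l2 \<Rightarrow> l2 \<Rightarrow> l2" where
  "nlsB \<mu> r s x y z = sg (- s) (nlsN \<mu> r (sg s x) (sg s y) (sg s z))"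

lemma continuous_on_tri:
  assumes K: "kernel_bdd C \<kappa>" and w: "continuous_on A w"
  shows "continuous_on A (\<lambda>s. tri \<kappa> (w s) (w s) (w s))"
  unfolding continuous_on_def
proof
  fix a assume a: "a \<in> A"
  have w': "(w \<longlongrightarrow> w a) (at a within A)" using w a by (simp add: continuous_on_def)
  have d: "((\<lambda>s. norm (w s - w a)) \<longlongrightarrow> 0) (at a within A)"
    by (intro tendsto_norm_zero LIM_zero w')
  have n: "((\<lambda>s. norm (w s)) \<longlongrightarrow> norm (w a)) (at a within A)"
    by (intro tendsto_norm w')
  let ?b = "\<lambda>s. C * (norm (w s - w a) * norm (w s) * norm (w s))
     + C * (norm (w a) * norm (w s - w a) * norm (w s))
     + C * (norm (w a) * norm (w a) * norm (w s - w a))"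
  have "((\<lambda>s. tri \<kappa> (w s) (w s) (w s) - tri \<kappa> (w a) (w a) (w a)) \<longlongrightarrow> 0) (at a within A)"
  proof (rule Lim_null_comparison[OF always_eventually])
    show "\<forall>s. norm (tri \<kappa> (w s) (w s) (w s) - tri \<kappa> (w a) (w a) (w a)) \<le> ?b s"
      unfolding tri_triple_diff[OF K] by (intro allI norm_triangle_le add_mono norm_tri_le K)
    have "(?b \<longlongrightarrow> C * (0 * norm (w a) * norm (w a)) + C * (norm (w a) * 0 * norm (w a))
        + C * (norm (w a) * norm (w a) * 0)) (at a within A)"
      by (intro tendsto_intros d n)
    then show "(?b \<longlongrightarrow> 0) (at a within A)" by simp
  qed
  then show "((\<lambda>s. tri \<kappa> (w s) (w s) (w s)) \<longlongrightarrow> tri \<kappa> (w a) (w a) (w a)) (at a within A)"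
    by (rule LIM_zero_cancel)
qed

lemma cubic_ode_nls:
  assumes r: "r > 1/2"
  shows "cubic_ode (nlsB \<mu> r) (\<bar>\<mu>\<bar> * algc r)"
proof
  note K = kernel_bdd_cubic[OF r, of \<mu>]
  fix s x x' y y' z z'
  show "nlsB \<mu> r s (x - x') y z = nlsB \<mu> r s x y z - nlsB \<mu> r s x' y z"
    and "nlsB \<mu> r s x (y - y') z = nlsB \<mu> r s x y z - nlsB \<mu> r s x y' z"
    and "nlsB \<mu> r s x y (z - z') = nlsB \<mu> r s x y z - nlsB \<mu> r s x y z'"
    by (simp_all add: nlsB_def nlsN_def sg_diff tri_diff[OF K])
  show "norm (nlsB \<mu> r s x y z) \<le> \<bar>\<mu>\<bar> * algc r * (norm x * norm y * norm z)"
    using norm_tri_le[OF K, of "sg s x" "sg s y" "sg s z"] by (simp add: nlsB_def nlsN_def)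
  show "\<bar>\<mu>\<bar> * algc r \<ge> 0" by (simp add: algc_nonneg)
  show "continuous_on A (\<lambda>s. nlsB \<mu> r s (w s) (w s) (w s))" if "continuous_on A w" for A w
    unfolding nlsB_def nlsN_def
    by (intro continuous_on_sg continuous_on_tri[OF K] continuous_intros that)
qed

text \<open>Moving the origin of time conjugates the interaction picture by the free group; this is
  what allows a restart at a grid point.\<close>

lemma nlsB_shift: "sg a (nlsB \<mu> r (a + s) x y z) = nlsB \<mu> r s (sg a x) (sg a y) (sg a z)"
  by (simp add: nlsB_def sg_sg add.commute)

lemma cubic_term_ev:
  assumes r: "r > 1/2"
  shows "- \<i> * of_real \<mu> * schroedinger_group t (\<lambda>y. of_real ((cmod (ev r x y))\<^sup>2) * ev r x y) z
    = ev r (sg t (nlsN \<mu> r x x x)) z"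
proof -
  note a = wsum_cf[OF r, of x]
  have N: "cf r (nlsN \<mu> r x x x) k = - \<i> * of_real \<mu> * tsum (\<lambda>_ _. 1) (cf r x) (cf r x) (cf r x) k" for k
    unfolding nlsN_def cubic_ksym_def cf_tri_ksym[OF kernel_bdd_cubic[OF r, of \<mu>, unfolded cubic_ksym_def]]
    by (simp only: tsum_def infsum_cmult_right' mult_1_left)
  have "(\<lambda>y. of_real ((cmod (ev r x y))\<^sup>2) * ev r x y) = wien (tsum (\<lambda>_ _. 1) (cf r x) (cf r x) (cf r x))"
    unfolding ev_def wien_cubic(1)[OF a] ..
  then have "schroedinger_group t (\<lambda>y. of_real ((cmod (ev r x y))\<^sup>2) * ev r x y)
      = wien (\<lambda>k. su t k * tsum (\<lambda>_ _. 1) (cf r x) (cf r x) (cf r x) k)"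
    by (simp add: schroedinger_group_def fourier_multiplier_wien wien_cubic(2)[OF a] su_def)
  moreover have "(\<lambda>k. - \<i> * of_real \<mu> * (su t k * tsum (\<lambda>_ _. 1) (cf r x) (cf r x) (cf r x) k))
      = cf r (sg t (nlsN \<mu> r x x x))"
  proof
    fix k
    have "cf r (sg t (nlsN \<mu> r x x x)) k = su t k * cf r (nlsN \<mu> r x x x) k"
      by (simp add: cf_def)
    then show "- \<i> * of_real \<mu> * (su t k * tsum (\<lambda>_ _. 1) (cf r x) (cf r x) (cf r x) k)
      = cf r (sg t (nlsN \<mu> r x x x)) k"
      unfolding N by (simp add: mult_ac)
  qed
  ultimately show ?thesis by (simp only: wien_cmult ev_def)
qed

lemma has_integral_ev_sg:
  fixes g :: "real \<Rightarrow> l2"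
  assumes "r > 1/2" "continuous_on {0..t} g"
  shows "((\<lambda>s. ev r (sg a (g s)) x) has_integral ev r (sg a (integral {0..t} g)) x) {0..t}"
proof -
  have "bounded_linear (\<lambda>y. ev r (sg a y) x)"
    by (rule bounded_linear_compose[OF bounded_linear_ev[OF assms(1)] bounded_linear_sg])
  from has_integral_linear[OF integrable_integral[OF integrable_continuous_interval[OF assms(2)]] this]
  show ?thesis by (simp add: o_def)
qed

locale nls =
  fixes \<mu> r :: real
  assumes r: "r > 1/2"
begin

sublocale cubic_ode "nlsB \<mu> r" "\<bar>\<mu>\<bar> * algc r"
  by (rule cubic_ode_nls[OF r])

lemma Duhamel_integrand:
  "- \<i> * of_real \<mu> * schroedinger_group (t - s) (\<lambda>y. of_real ((cmod (ev r (sg s w) y))\<^sup>2) * ev r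
      (sg s w) y) x
    = ev r (sg t (K s w)) x"
  by (simp only: cubic_term_ev[OF r]) (simp add: nlsB_def sg_sg)

lemma sobolev_norm_diff_ev: "sobolev_norm r (\<lambda>x. ev r y x - ev r z x) = norm (y - z)"
  by (simp add: ev_diff[OF r] sobolev_norm_ev[OF r])

text \<open>Writing u(t) = S(t) w(t), the factor S(t - s) in Duhamel's formula becomes S(t) outside
  the integral, and what is left inside no longer depends on t. Injectivity of \<open>ev\<close>
  turns the identity for all points x into one between sequences.\<close>

lemma mild_solution_iff:
  assumes T: "T \<ge> 0"
  shows "nls_mild_solution \<mu> r T v u \<longleftrightarrow>
    (\<exists>V w. v = ev r V \<and> u 0 = v \<and> solves T V w \<and> (\<forall>t\<in>{0..T}. u t = ev r (sg t (w t))))"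
proof
  let ?D = "\<lambda>t x s. - \<i> * of_real \<mu> * schroedinger_group (t - s) (\<lambda>y. of_real ((cmod (u s y))\<^sup>2) * u s y) x"
  assume u: "nls_mild_solution \<mu> r T v u"
  then have sc: "sobolev_continuous r T u" and u0: "u 0 = v" by (auto simp: nls_mild_solution_def)
  have "\<forall>t\<in>{0..T}. \<exists>x. u t = ev r x"
    using sc sobolev_eq_range[OF r] by (auto simp: sobolev_continuous_def)
  then obtain U where U: "\<And>t. t \<in> {0..T} \<Longrightarrow> u t = ev r (U t)" by metis
  have v: "v = ev r (U 0)" using U[of 0] T u0 by simp
  have contU: "continuous_on {0..T} U"
    unfolding continuous_on_def
  proof
    fix t assume t: "t \<in> {0..T}"
    have "((\<lambda>s. sobolev_norm r (\<lambda>x. u s x - u t x)) \<longlongrightarrow> 0) (at t within {0..T})"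
      using sc t by (simp add: sobolev_continuous_def)
    moreover have "\<forall>\<^sub>F s in at t within {0..T}. sobolev_norm r (\<lambda>x. u s x - u t x) = norm (U s - U t)"
      unfolding eventually_at_topological using U t by (auto simp: sobolev_norm_diff_ev)
    ultimately have "((\<lambda>s. norm (U s - U t)) \<longlongrightarrow> 0) (at t within {0..T})"
      by (rule Lim_transform_eventually)
    then show "(U \<longlongrightarrow> U t) (at t within {0..T})"
      by (rule LIM_zero_cancel[OF tendsto_norm_zero_cancel])
  qed
  define w where "w = (\<lambda>t. sg (- t) (U t))"
  have Uw: "U t = sg t (w t)" for t by (simp add: w_def sg_sg)
  have contw: "continuous_on {0..T} w"
    unfolding w_def by (intro continuous_on_sg contU continuous_intros)
  have "solves T (U 0) w"
    unfolding solves_def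
  proof (intro conjI ballI contw)
    fix t assume t: "t \<in> {0..T}"
    let ?I = "integral {0..t} (\<lambda>s. K s (w s))"
    have contK: "continuous_on {0..t} (\<lambda>s. K s (w s))"
      using t by (intro cont continuous_on_subset[OF contw]) auto
    have "ev r (U t - sg t (U 0)) x = ev r (sg t ?I) x" for x
    proof (rule has_integral_unique)
      show "((\<lambda>s. ev r (sg t (K s (w s))) x) has_integral ev r (sg t ?I) x) {0..t}"
        by (rule has_integral_ev_sg[OF r contK])
      have "((\<lambda>s. ev r (sg t (K s (w s))) x) has_integral (u t x - schroedinger_group t v x)) {0..t}"
      proof (rule has_integral_eq)
        show "((\<lambda>s. ?D t x s)
          has_integral (u t x - schroedinger_group t v x)) {0..t}"
        using u t by (simp add: nls_mild_solution_def)
        show "?D t x s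
          = ev r (sg t (K s (w s))) x" if "s \<in> {0..t}" for s
        proof -
          have "u s = ev r (sg s (w s))" using that t U[of s] Uw[of s] by auto
          then show ?thesis by (simp only: Duhamel_integrand)
        qed
      qed
      moreover have "u t x - schroedinger_group t v x = ev r (U t - sg t (U 0)) x"
        by (simp only: U[OF t] v schroedinger_group_ev[OF r] ev_diff[OF r])
      ultimately show "((\<lambda>s. ev r (sg t (K s (w s))) x) has_integral ev r (U t - sg t (U 0)) x) {0..t}"
        by simp
    qed
    then have "U t - sg t (U 0) = sg t ?I" using ev_inj[OF r] by blast
    then have "U t = sg t (U 0 + ?I)" by (simp add: sg_add algebra_simps)
    then show "w t = U 0 + ?I" by (simp add: w_def sg_sg)
  qed
  then show "\<exists>V w. v = ev r V \<and> u 0 = v \<and> solves T V w \<and> (\<forall>t\<in>{0..T}. u t = ev r (sg t (w t)))"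
    using v u0 U Uw by metis
next
  let ?D = "\<lambda>t x s. - \<i> * of_real \<mu> * schroedinger_group (t - s) (\<lambda>y. of_real ((cmod (u s y))\<^sup>2) * u s y) x"
  assume "\<exists>V w. v = ev r V \<and> u 0 = v \<and> solves T V w \<and> (\<forall>t\<in>{0..T}. u t = ev r (sg t (w t)))"
  then obtain V w where V: "v = ev r V" "u 0 = v" "solves T V w" and U: "\<And>t. t \<in> {0..T} \<Longrightarrow> u t = ev
      r (sg t (w t))"
    by blast
  define U where "U = (\<lambda>t. sg t (w t))"
  have contw: "continuous_on {0..T} w" using V by (simp add: solves_def)
  have contU: "continuous_on {0..T} U"
    unfolding U_def by (intro continuous_on_sg contw continuous_intros)
  have "sobolev_continuous r T u"
    unfolding sobolev_continuous_def
  proof (intro ballI conjI)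
    fix t assume t: "t \<in> {0..T}"
    show "u t \<in> sobolev r" using U[OF t] ev_in_sobolev[OF r] by simp
    have "((\<lambda>s. norm (U s - U t)) \<longlongrightarrow> 0) (at t within {0..T})"
      using contU t by (intro tendsto_norm_zero LIM_zero) (simp add: continuous_on_def)
    moreover have "\<forall>\<^sub>F s in at t within {0..T}. norm (U s - U t) = sobolev_norm r (\<lambda>x. u s x - u t x)"
      unfolding eventually_at_topological using U t by (auto simp: sobolev_norm_diff_ev U_def)
    ultimately show "((\<lambda>s. sobolev_norm r (\<lambda>x. u s x - u t x)) \<longlongrightarrow> 0) (at t within {0..T})"
      by (rule Lim_transform_eventually)
  qed
  moreover have "((\<lambda>s. ?D t x s)
          has_integral (u t x - schroedinger_group t v x)) {0..t}" if t: "t \<in> {0..T}" for t x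
  proof -
    let ?I = "integral {0..t} (\<lambda>s. K s (w s))"
    have contK: "continuous_on {0..t} (\<lambda>s. K s (w s))"
      using t by (intro cont continuous_on_subset[OF contw]) auto
    have "((\<lambda>s. ?D t x s)
        has_integral ev r (sg t ?I) x) {0..t}"
    proof (rule has_integral_eq[OF _ has_integral_ev_sg[OF r contK]])
      show "ev r (sg t (K s (w s))) x = ?D t x s" if "s \<in> {0..t}" for s
      proof -
        have "u s = ev r (sg s (w s))" using that t U[of s] by auto
        then show ?thesis by (simp only: Duhamel_integrand)
      qed
    qed
    moreover have "u t x - schroedinger_group t v x = ev r (sg t ?I) x"
    proof -
      have "w t = V + ?I" using V(3) t by (simp add: solves_def)
      then show ?thesis
        using U[OF t] by (simp add: V(1) schroedinger_group_ev[OF r] ev_diff[OF r] flip: sg_diff)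
    qed
    ultimately show ?thesis by simp
  qed
  ultimately show "nls_mild_solution \<mu> r T v u"
    using V(2) by (simp add: nls_mild_solution_def)
qed

section \<open>The fine propagator and restarts along a solution\<close>

definition exact_flow :: "real \<Rightarrow> l2 \<Rightarrow> l2" where
  "exact_flow \<tau> x = sg \<tau> (flow \<tau> x \<tau>)"

text \<open>The definite description is meaningful here: existence comes from the smallness of
  \<tau> relative to \<open>R\<close>, uniqueness from \<open>solves_unique\<close> and from
  injectivity of \<open>ev\<close>.\<close>

lemma fine_propagator_ev:
  assumes "norm x \<le> R" "small R \<tau>"
  shows "fine_propagator \<mu> r \<tau> (ev r x) = ev r (exact_flow \<tau> x)"
proof -
  have \<tau>: "\<tau> \<ge> 0" using assms by (simp add: small_def)
  show ?thesis
    unfolding fine_propagator_def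
  proof (rule the_equality)
    have "solves \<tau> x (flow \<tau> x)" by (rule solves_flow[OF assms])
    moreover from this have "flow \<tau> x 0 = x" using \<tau> by (simp add: solves_def)
    ultimately have "nls_mild_solution \<mu> r \<tau> (ev r x) (\<lambda>t. ev r (sg t (flow \<tau> x t)))"
      unfolding mild_solution_iff[OF \<tau>] by auto
    then show "\<exists>u. nls_mild_solution \<mu> r \<tau> (ev r x) u \<and> ev r (exact_flow \<tau> x) = u \<tau>"
      unfolding exact_flow_def by blast
    fix w assume "\<exists>u. nls_mild_solution \<mu> r \<tau> (ev r x) u \<and> w = u \<tau>"
    then obtain u V y where "w = u \<tau>" "ev r x = ev r V" "solves \<tau> V y" "\<forall>t\<in>{0..\<tau>}. u t = ev r (sg t (y t))"
      unfolding mild_solution_iff[OF \<tau>] by blast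
    moreover have "V = x" using ev_inj[OF r] calculation(2) by metis
    ultimately show "w = ev r (exact_flow \<tau> x)"
      using flow_eq[of \<tau> x y \<tau>] \<tau> by (simp add: exact_flow_def)
  qed
qed

text \<open>\<open>w\<close> is written in the frame of time 0, so the state at time
  \<open>a\<close> is \<open>sg a (w a)\<close>; \<open>nlsB_shift\<close> changes the frame under
  the integral.\<close>

lemma solves_shift:
  assumes w: "solves T V w" and a: "a \<ge> 0" "a + \<tau> \<le> T"
  shows "solves \<tau> (sg a (w a)) (\<lambda>s. sg a (w (a + s)))"
  unfolding solves_def
proof (intro conjI ballI)
  have contw: "continuous_on {0..T} w" using w by (simp add: solves_def)
  show "continuous_on {0..\<tau>} (\<lambda>s. sg a (w (a + s)))"
    by (intro continuous_on_sg continuous_on_compose2[OF contw] continuous_intros) (use a in auto)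
  fix t assume t: "t \<in> {0..\<tau>}"
  let ?k = "\<lambda>s. K s (w s)"
  have contK: "continuous_on {0..a + t} ?k"
    using t a by (intro cont continuous_on_subset[OF contw]) auto
  have "w (a + t) = V + integral {0..a + t} ?k" "w a = V + integral {0..a} ?k"
    using w t a by (auto simp: solves_def)
  moreover have "integral {0..a} ?k + integral {a..a + t} ?k = integral {0..a + t} ?k"
    using t a by (intro Henstock_Kurzweil_Integration.integral_combine
        integrable_continuous_interval contK) auto
  ultimately have "w (a + t) = w a + integral {a..a + t} ?k" by (simp add: add.assoc)
  moreover have "sg a (integral {a..a + t} ?k) = integral {0..t} (\<lambda>s. K s (sg a (w (a + s))))"
  proof -
    have "(?k has_integral integral {a..a + t} ?k) {a..a + t}"
      using t a by (intro integrable_integral integrable_continuous_interval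
          continuous_on_subset[OF contK]) auto
    then have "((\<lambda>s. ?k (s + a)) has_integral integral {a..a + t} ?k) {0..t}"
      using has_integral_shift_Icc_real[of ?k a "integral {a..a + t} ?k" 0 t] by (simp add: o_def
          add.commute)
    from has_integral_linear[OF this bounded_linear_sg[of a]]
    have "((\<lambda>s. K s (sg a (w (a + s)))) has_integral sg a (integral {a..a + t} ?k)) {0..t}"
      by (simp add: o_def add.commute[of _ a] nlsB_shift)
    then show ?thesis by (simp add: integral_unique)
  qed
  ultimately show "sg a (w (a + t)) = sg a (w a) + integral {0..t} (\<lambda>s. K s (sg a (w (a + s))))"
    by (simp add: sg_add)
qed

lemma exact_flow_solves:
  assumes w: "solves T V w" and a: "a \<ge> 0" "\<tau> \<ge> 0" "a + \<tau> \<le> T"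
  shows "exact_flow \<tau> (sg a (w a)) = sg (a + \<tau>) (w (a + \<tau>))"
  using flow_eq[OF solves_shift[OF w a(1,3)], of \<tau>] a
  by (simp add: exact_flow_def sg_sg add.commute)

end

section \<open>Oscillatory integrals and resonances\<close>

definition osc :: "real \<Rightarrow> real \<Rightarrow> complex" where
  "osc \<tau> \<theta> = integral {0..\<tau>} (\<lambda>s. cis (s * \<theta>))"

lemma continuous_on_cis_linear: "continuous_on A (\<lambda>s. cis (s * \<theta>))"
  by (intro continuous_intros)

lemma osc_0: "\<tau> \<ge> 0 \<Longrightarrow> osc \<tau> 0 = of_real \<tau>"
  by (simp add: osc_def scaleR_conv_of_real)

lemma osc_eq:
  assumes "\<tau> \<ge> 0" "\<theta> \<noteq> 0"
  shows "osc \<tau> \<theta> = (cis (\<tau> * \<theta>) - 1) / (\<i> * of_real \<theta>)"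
proof -
  have "((\<lambda>s. cis (s * \<theta>)) has_integral
      (cis (\<tau> * \<theta>) / (\<i> * of_real \<theta>) - cis (0 * \<theta>) / (\<i> * of_real \<theta>))) {0..\<tau>}"
  proof (rule fundamental_theorem_of_calculus[OF assms(1)])
    fix s
    have "((\<lambda>z. exp (\<i> * of_real \<theta> * z) / (\<i> * of_real \<theta>)) has_field_derivative cis (s * \<theta>)) (at
        (of_real s))"
      using assms(2) by (auto intro!: derivative_eq_intros simp: cis_conv_exp mult_ac)
    from has_vector_derivative_real_field[OF this]
    show "((\<lambda>s. cis (s * \<theta>) / (\<i> * of_real \<theta>)) has_vector_derivative cis (s * \<theta>)) (at s within {0..\<tau>})"
      by (simp add: cis_conv_exp mult_ac)
  qed
  then show ?thesis unfolding osc_def by (simp add: integral_unique diff_divide_distrib)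
qed

lemma cmod_cis_diff_le: "cmod (cis a - cis b) \<le> \<bar>a - b\<bar>"
proof -
  have "cis a - cis b = cis b * (cis (a - b) - 1)"
    by (simp add: right_diff_distrib cis_mult)
  then have "cmod (cis a - cis b) = 2 * \<bar>sin ((a - b) / 2)\<bar>"
    using dist_exp_i_1[of "a - b"] by (simp add: norm_mult cis_conv_exp)
  also have "\<dots> \<le> 2 * \<bar>(a - b) / 2\<bar>" by (intro mult_left_mono abs_sin_x_le_abs_x) auto
  finally show ?thesis by simp
qed

lemma cmod_osc_diff_le:
  assumes "\<tau> \<ge> 0"
  shows "cmod (osc \<tau> a - osc \<tau> b) \<le> \<tau>\<^sup>2 * \<bar>a - b\<bar>"
proof -
  have "osc \<tau> a - osc \<tau> b = integral {0..\<tau>} (\<lambda>s. cis (s * a) - cis (s * b))"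
    unfolding osc_def
    by (intro integral_diff[symmetric] integrable_continuous_interval continuous_on_cis_linear)
  also have "cmod \<dots> \<le> \<tau> * \<bar>a - b\<bar> * (\<tau> - 0)"
  proof (rule integral_bound)
    fix s assume s: "s \<in> {0..\<tau>}"
    have "cmod (cis (s * a) - cis (s * b)) \<le> \<bar>s * a - s * b\<bar>" by (rule cmod_cis_diff_le)
    also have "\<dots> = s * \<bar>a - b\<bar>" using s by (simp add: abs_mult flip: right_diff_distrib)
    also have "\<dots> \<le> \<tau> * \<bar>a - b\<bar>" using s by (intro mult_right_mono) auto
    finally show "cmod (cis (s * a) - cis (s * b)) \<le> \<tau> * \<bar>a - b\<bar>" .
  qed (use assms in \<open>auto intro!: continuous_intros\<close>)
  finally show ?thesis by (simp add: power2_eq_square mult_ac)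
qed

lemma cmod_osc_le:
  assumes "\<tau> \<ge> 0"
  shows "cmod (osc \<tau> \<theta>) \<le> \<tau>"
proof -
  have "cmod (integral {0..\<tau>} (\<lambda>s. cis (s * \<theta>))) \<le> 1 * (\<tau> - 0)"
    by (intro integral_bound continuous_on_cis_linear assms) simp
  then show ?thesis by (simp add: osc_def)
qed

text \<open>For the frequencies \<open>k = - k1 + k2 + k3\<close> with \<open>p = (k1, k2)\<close>, the phase is
  \<open>k\<^sup>2 + k1\<^sup>2 - k2\<^sup>2 - k3\<^sup>2\<close>.\<close>

definition phase :: "int \<Rightarrow> int \<times> int \<Rightarrow> real" where
  "phase k p = 2 * of_int (k - snd p) * of_int (snd p - fst p)"

lemma phase_eq:
  "phase k p = (of_int k)\<^sup>2 + (of_int (fst p))\<^sup>2 - (of_int (snd p))\<^sup>2 - (of_int (k + fst p - snd p))\<^sup>2"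
  by (simp add: phase_def power2_eq_square algebra_simps)

text \<open>The exchange of k2 and k3, a symmetry of the cubic term since both belong to
  unconjugated factors.\<close>

definition swap3 :: "int \<Rightarrow> int \<times> int \<Rightarrow> int \<times> int" where
  "swap3 k p = (fst p, k + fst p - snd p)"

lemma swap3_swap3: "swap3 k (swap3 k p) = p"
  by (simp add: swap3_def)

lemma tprod_swap3: "tprod a b b k (swap3 k p) = tprod a b b k p"
  by (simp add: tprod_def swap3_def)

lemma phase_swap3: "phase k (swap3 k p) = phase k p"
  by (simp add: phase_def swap3_def algebra_simps)

text \<open>The symbol of the cubic part of the coarse propagator for \<open>k \<noteq> 0\<close>.\<close>

definition coarse_symbol :: "real \<Rightarrow> real \<Rightarrow> int \<Rightarrow> int \<times> int \<Rightarrow> complex" where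
  "coarse_symbol \<mu> \<tau> k p =
     - (if snd p = k then 2 * \<i> * of_real \<mu> * of_real \<tau> * (1 - of_int (fst p) / of_int k) else 0)
     - of_real \<mu> / 2 * (inv_deriv_symbol k)\<^sup>2 * cis (\<tau> * (- 2 * of_int k * of_int (fst p)))
     + of_real \<mu> / 2 * (inv_deriv_symbol k)\<^sup>2
     + of_real \<mu> * inv_deriv_symbol k * (inv_deriv_symbol (k - snd p) * cis (\<tau> * phase k p))
     - of_real \<mu> * inv_deriv_symbol k * inv_deriv_symbol (k - snd p)"

text \<open>Since \<open>k = (k - k2) + (k - k3) + k1\<close>, the weight \<open>1\<close> splits as
  \<open>(k - k2)/k + (k - k3)/k + k1/k\<close>.  On the first two summands the oscillatory integral is computed
  exactly, as the phase equals \<open>2 (k - k2) (k - k3)\<close>; on the third one the scheme freezes the part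
  \<open>2 k2 k3\<close> of the phase.\<close>

lemma coarse_symbol_eq:
  assumes \<tau>: "\<tau> \<ge> 0" and k: "k \<noteq> 0"
  shows "coarse_symbol \<mu> \<tau> k p =
    - 2 * \<i> * of_real \<mu> * (of_int (snd p - fst p) / of_int k) * osc \<tau> (phase k p)
    - \<i> * of_real \<mu> * (of_int (fst p) / of_int k) * osc \<tau> (- 2 * of_int k * of_int (fst p))"
proof -
  obtain a b where p: "p = (a, b)" by (cases p)
  have alg: "- A - B + C + D - E = X - Y" if "- B + C = - Y" "- A + D - E = X" for A B C D E X Y :: complex
  proof -
    have "- A - B + C + D - E = (- A + D - E) + (- B + C)" by simp
    then show ?thesis unfolding that by simp
  qed
  have 1: "- (of_real \<mu> / 2 * (inv_deriv_symbol k)\<^sup>2 * cis (\<tau> * (- 2 * of_int k * of_int a))) +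
      of_real \<mu> / 2 * (inv_deriv_symbol k)\<^sup>2
    = - (\<i> * of_real \<mu> * (of_int a / of_int k) * osc \<tau> (- 2 * of_int k * of_int a))"
  proof (cases "a = 0")
    case False
    then have *: "- 2 * real_of_int k * of_int a \<noteq> 0" using k by simp
    show ?thesis
      unfolding osc_eq[OF \<tau> *] using k False
      by (simp add: inv_deriv_symbol_def power2_eq_square field_simps)
  qed simp
  have 2: "- (if b = k then 2 * \<i> * of_real \<mu> * of_real \<tau> * (1 - of_int a / of_int k) else 0)
     + of_real \<mu> * inv_deriv_symbol k * (inv_deriv_symbol (k - b) * cis (\<tau> * phase k p))
     - of_real \<mu> * inv_deriv_symbol k * inv_deriv_symbol (k - b)
    = - 2 * \<i> * of_real \<mu> * (of_int (b - a) / of_int k) * osc \<tau> (phase k p)"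
  \<comment> \<open>On the resonance k2 = k the phase is zero and the inverse derivative contributes
    nothing, so the explicit term alone must supply the factor \<tau>. For k2 = k1 the phase
    vanishes too, but so does the weight.\<close>
  proof (cases "b = k")
    case True
    then show ?thesis
      using k \<tau> by (simp add: p phase_def osc_0 inv_deriv_symbol_def field_simps)
  next
    case False
    show ?thesis
    proof (cases "b = a")
      case True
      with False show ?thesis by (simp add: p phase_def)
    next
      case ba: False
      then have *: "phase k p \<noteq> 0" using False by (simp add: p phase_def)
      have kb: "complex_of_int (k - b) \<noteq> 0" "complex_of_int (b - a) \<noteq> 0" using False ba by auto
      have ph: "complex_of_real (phase k p) = 2 * of_int (k - b) * of_int (b - a)"
        by (simp add: p phase_def)
      define c where "c = cis (\<tau> * phase k p)"
      have "of_real \<mu> * inv_deriv_symbol k * (inv_deriv_symbol (k - b) * c)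
         - of_real \<mu> * inv_deriv_symbol k * inv_deriv_symbol (k - b)
         = - of_real \<mu> / (of_int k * of_int (k - b)) * (c - 1)"
        using False k kb by (simp add: inv_deriv_symbol_def field_simps del: of_int_diff)
      moreover have "- 2 * \<i> * of_real \<mu> * (of_int (b - a) / of_int k) * ((c - 1) / (\<i> * (2 *
          of_int (k - b) * of_int (b - a))))
         = - of_real \<mu> / (of_int k * of_int (k - b)) * (c - 1)"
        using k kb by (simp add: field_simps del: of_int_diff)
      ultimately show ?thesis
        unfolding osc_eq[OF \<tau> *] ph c_def[symmetric] using False by simp
    qed
  qed
  show ?thesis
    using alg[OF 1 2] unfolding coarse_symbol_def p fst_conv snd_conv .
qed

text \<open>Coarse minus exact, after symmetrization. At k = 0 the coarse propagator replaces the
  whole oscillatory integral by \<tau>; otherwise only the summand of weight k1/k is in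
  error.\<close>

definition rem_symbol :: "real \<Rightarrow> real \<Rightarrow> int \<Rightarrow> int \<times> int \<Rightarrow> complex" where
  "rem_symbol \<mu> \<tau> k p = (if k = 0 then \<i> * of_real \<mu> * (osc \<tau> (phase 0 p) - of_real \<tau>)
     else \<i> * of_real \<mu> * (of_int (fst p) / of_int k) *
       (osc \<tau> (phase k p) - osc \<tau> (- 2 * of_int k * of_int (fst p))))"

text \<open>The coarse symbol counts (k2 - k1)/k twice; together with its mirror image (k3 - k1)/k
  this gives 2 (k - k1)/k, so the exact integrals cancel up to the weight 2 k1/k.\<close>

lemma rem_symbol_symmetrized:
  assumes "\<tau> \<ge> 0" "k \<noteq> 0"
  shows "(coarse_symbol \<mu> \<tau> k p + \<i> * of_real \<mu> * osc \<tau> (phase k p))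
    + (coarse_symbol \<mu> \<tau> k (swap3 k p) + \<i> * of_real \<mu> * osc \<tau> (phase k (swap3 k p)))
    = 2 * rem_symbol \<mu> \<tau> k p"
  unfolding coarse_symbol_eq[OF assms] phase_swap3 rem_symbol_def using assms(2)
  by (simp add: swap3_def field_simps)

text \<open>The phase error is 2 k2 k3. For nonzero k each input frequency appears once and lowers
  its own weight by one order, while 1/k lowers the output weight; at k = 0 only k2 k3 occurs and
  the output weight is 1. All of it is bounded by the weight of order r - 1.\<close>

lemma cmod_rem_symbol_le:
  assumes "\<tau> \<ge> 0"
  shows "cmod (rem_symbol \<mu> \<tau> k p) * wt r k p \<le> 4 * \<bar>\<mu>\<bar> * \<tau>\<^sup>2 * wt (r - 1) k p"
proof -
  obtain a b where p: "p = (a, b)" by (cases p)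
  define c where "c = k + a - b"
  have J: "\<bar>real_of_int j\<bar> * jb j powr (- r / 2) \<le> jb j powr (- (r - 1) / 2)" for j
  proof -
    have "\<bar>real_of_int j\<bar> * jb j powr (- r / 2) \<le> jb j powr (1 / 2) * jb j powr (- r / 2)"
      by (intro mult_right_mono abs_int_le_jb) auto
    also have "\<dots> = jb j powr (1 / 2 + - r / 2)" by (simp only: powr_add)
    also have "1 / 2 + - r / 2 = - (r - 1) / 2" by (simp add: field_simps)
    finally show ?thesis .
  qed
  have le0: "jb j powr (- r / 2) \<le> jb j powr (- (r - 1) / 2)" for j
    using jb_ge_1[of j] by (intro powr_mono) (auto simp: field_simps)
  show ?thesis
  proof (cases "k = 0")
    case True
    have "phase 0 p = 2 * of_int b * of_int c"
      by (simp add: p phase_def c_def True algebra_simps)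
    then have "cmod (rem_symbol \<mu> \<tau> k p) \<le> \<bar>\<mu>\<bar> * (\<tau>\<^sup>2 * \<bar>2 * of_int b * of_int c\<bar>)"
      using cmod_osc_diff_le[OF assms, of "phase 0 p" 0] True
      by (simp add: rem_symbol_def norm_mult osc_0[OF assms] mult_left_mono)
    then have "cmod (rem_symbol \<mu> \<tau> k p) * wt r k p \<le> \<bar>\<mu>\<bar> * (\<tau>\<^sup>2 * \<bar>2 * of_int b * of_int c\<bar>) * wt r k p"
      by (intro mult_right_mono wt_nonneg)
    also have "\<dots> = 2 * \<bar>\<mu>\<bar> * \<tau>\<^sup>2 * (jb a powr (- r / 2) *
        (\<bar>real_of_int b\<bar> * jb b powr (- r / 2)) * (\<bar>real_of_int c\<bar> * jb c powr (- r / 2)))"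
      by (simp add: wt_def p c_def True jb_def abs_mult)
    also have "\<dots> \<le> 2 * \<bar>\<mu>\<bar> * \<tau>\<^sup>2 * (jb a powr (- (r - 1) / 2) * jb b powr (- (r - 1) / 2) * jb c
        powr (- (r - 1) / 2))"
      by (intro mult_left_mono mult_mono J le0) auto
    also have "\<dots> = 2 * \<bar>\<mu>\<bar> * \<tau>\<^sup>2 * wt (r - 1) k p"
      by (simp add: wt_def p c_def True jb_def)
    also have "\<dots> \<le> 4 * \<bar>\<mu>\<bar> * \<tau>\<^sup>2 * wt (r - 1) k p"
      using wt_nonneg by (intro mult_right_mono) auto
    finally show ?thesis .
  next
    case False
    then have k1: "\<bar>real_of_int k\<bar> \<ge> 1" by linarith
    have "phase k p - (- 2 * of_int k * of_int a) = 2 * of_int b * of_int c"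
      by (simp add: p phase_def c_def algebra_simps)
    then have "cmod (osc \<tau> (phase k p) - osc \<tau> (- 2 * of_int k * of_int a)) \<le> \<tau>\<^sup>2 * \<bar>2 * of_int b
        * of_int c\<bar>"
      using cmod_osc_diff_le[OF assms, of "phase k p" "- 2 * of_int k * of_int a"] by simp
    then have rem_le: "cmod (rem_symbol \<mu> \<tau> k p) \<le> \<bar>\<mu>\<bar> * (\<bar>of_int a\<bar> / \<bar>of_int k\<bar>) * (\<tau>\<^sup>2 * \<bar>2 *
        of_int b * of_int c\<bar>)"
    proof -
      assume le: "cmod (osc \<tau> (phase k p) - osc \<tau> (- 2 * of_int k * of_int a)) \<le> \<tau>\<^sup>2 * \<bar>2 * of_int
          b * of_int c\<bar>"
      have "cmod (rem_symbol \<mu> \<tau> k p) = \<bar>\<mu>\<bar> * (\<bar>of_int a\<bar> / \<bar>of_int k\<bar>) *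
          cmod (osc \<tau> (phase k p) - osc \<tau> (- 2 * of_int k * of_int a))"
        using False by (simp add: rem_symbol_def norm_mult norm_divide p)
      moreover have "0 \<le> \<bar>\<mu>\<bar> * (\<bar>real_of_int a\<bar> / \<bar>of_int k\<bar>)" by simp
      ultimately show ?thesis using le by (metis mult_left_mono)
    qed
    from rem_le have "cmod (rem_symbol \<mu> \<tau> k p) * wt r k p
        \<le> \<bar>\<mu>\<bar> * (\<bar>of_int a\<bar> / \<bar>of_int k\<bar>) * (\<tau>\<^sup>2 * \<bar>2 * of_int b * of_int c\<bar>) * wt r k p"
      by (intro mult_right_mono wt_nonneg)
    also have "\<dots> = 2 * \<bar>\<mu>\<bar> * \<tau>\<^sup>2 * ((jb k powr (r / 2) / \<bar>real_of_int k\<bar>) *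
        ((\<bar>real_of_int a\<bar> * jb a powr (- r / 2)) * (\<bar>real_of_int b\<bar> * jb b powr (- r / 2)) *
         (\<bar>real_of_int c\<bar> * jb c powr (- r / 2))))"
      by (simp add: wt_def p c_def abs_mult)
    also have "\<dots> \<le> 2 * \<bar>\<mu>\<bar> * \<tau>\<^sup>2 * ((2 * jb k powr ((r - 1) / 2)) *
        (jb a powr (- (r - 1) / 2) * jb b powr (- (r - 1) / 2) * jb c powr (- (r - 1) / 2)))"
    proof (intro mult_left_mono mult_mono J)
      \<comment> \<open>For nonzero integers 1 + k^2 is at most 4 k^2; this factor 2 and the 2 in
        the phase make up the 4.\<close>
      have "jb k \<le> (2 * \<bar>real_of_int k\<bar>)\<^sup>2"
        using k1 one_le_power[OF k1, of 2] by (simp add: jb_def power_mult_distrib)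
      then have "sqrt (jb k) \<le> 2 * \<bar>real_of_int k\<bar>" by (intro real_le_lsqrt) auto
      then have "jb k powr (1/2) \<le> 2 * \<bar>real_of_int k\<bar>"
        using jb_pos[of k] by (simp add: powr_half_sqrt)
      then have "jb k powr ((r - 1) / 2) * jb k powr (1/2) \<le> jb k powr ((r - 1) / 2) * (2 *
          \<bar>real_of_int k\<bar>)"
        by (intro mult_left_mono) auto
      moreover have "(r - 1) / 2 + 1 / 2 = r / 2" by (simp add: field_simps)
      ultimately have "jb k powr (r / 2) \<le> jb k powr ((r - 1) / 2) * (2 * \<bar>real_of_int k\<bar>)"
        by (simp only: powr_add[symmetric])
      then show "jb k powr (r / 2) / \<bar>real_of_int k\<bar> \<le> 2 * jb k powr ((r - 1) / 2)"
        using k1 by (simp add: divide_le_eq mult_ac)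
    qed auto
    also have "\<dots> = 4 * \<bar>\<mu>\<bar> * \<tau>\<^sup>2 * wt (r - 1) k p"
      by (simp add: wt_def p c_def)
    finally show ?thesis .
  qed
qed

lemma kernel_bdd_rem:
  assumes "r > 3/2" "\<tau> \<ge> 0"
  shows "kernel_bdd (4 * \<bar>\<mu>\<bar> * \<tau>\<^sup>2 * algc (r - 1)) (ksym r (rem_symbol \<mu> \<tau>))"
  unfolding algc_def
proof (rule kernel_bdd_wt)
  show "cmod (ksym r (rem_symbol \<mu> \<tau>) k p) \<le> 4 * \<bar>\<mu>\<bar> * \<tau>\<^sup>2 * wt (r - 1) k p" for k p
    using cmod_rem_symbol_le[OF assms(2), of \<mu> k p r] by (simp add: ksym_def norm_mult wt_nonneg)
qed (use assms in auto)

section \<open>Mass and momentum\<close>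

text \<open>A quadratic form diagonal in frequency: symbol 1 gives the mass, and - i j, the
  derivative falling on the conjugate, gives the momentum.\<close>

definition qform :: "real \<Rightarrow> (int \<Rightarrow> complex) \<Rightarrow> l2 \<Rightarrow> complex" where
  "qform r n x = (\<Sum>\<^sub>\<infinity>j. n j * (cnj (cf r x j) * cf r x j))"

abbreviation "qmass r \<equiv> qform r (\<lambda>_. 1)"
abbreviation "qmom r \<equiv> qform r (\<lambda>j. - \<i> * of_int j)"

lemma infsum_cnj_mult_le:
  assumes "\<And>j. cmod (n j) \<le> 1"
  shows "(\<lambda>j. cmod (n j * (cnj (coord x j) * coord y j))) summable_on UNIV"
    and "cmod (\<Sum>\<^sub>\<infinity>j. n j * (cnj (coord x j) * coord y j)) \<le> norm x * norm y"
proof -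
  have le: "(\<Sum>j\<in>F. cmod (n j * (cnj (coord x j) * coord y j))) \<le> norm x * norm y" if F: "finite F" for F
  proof -
    have "(\<Sum>j\<in>F. cmod (n j * (cnj (coord x j) * coord y j))) \<le> (\<Sum>j\<in>F. cmod (coord x j) * cmod (coord y j))"
      by (intro sum_mono) (simp add: norm_mult mult_left_le_one_le assms)
    also have "\<dots> \<le> L2_set (\<lambda>j. cmod (coord x j)) F * L2_set (\<lambda>j. cmod (coord y j)) F"
      using L2_set_mult_ineq[of "\<lambda>j. cmod (coord x j)" "\<lambda>j. cmod (coord y j)" F] by simp
    also have "\<dots> \<le> norm x * norm y"
      using F unfolding norm_l2_def
      by (intro mult_mono L2_set_le_l2_norm) (auto simp: norm_l2_def[symmetric] L2_set_nonneg)
    finally show ?thesis .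
  qed
  show *: "(\<lambda>j. cmod (n j * (cnj (coord x j) * coord y j))) summable_on UNIV"
    by (rule abs_summable_iff_bdd_above[THEN iffD2], rule bdd_aboveI2[where M = "norm x * norm y"])
      (auto intro: le)
  have "cmod (\<Sum>\<^sub>\<infinity>j. n j * (cnj (coord x j) * coord y j)) \<le> (\<Sum>\<^sub>\<infinity>j. cmod (n j * (cnj (coord x j) *
      coord y j)))"
    by (rule norm_infsum_bound[OF *])
  also have "\<dots> \<le> norm x * norm y" by (rule infsum_le_finite_sums[OF *]) (auto intro: le)
  finally show "cmod (\<Sum>\<^sub>\<infinity>j. n j * (cnj (coord x j) * coord y j)) \<le> norm x * norm y" .
qed

text \<open>Dividing the symbol by the weight makes it bounded by 1, so Cauchy-Schwarz applies; the
  difference is split into two sesquilinear terms that each contain \<open>x - y\<close>.\<close>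

lemma qform_bounds:
  assumes n: "\<And>j. cmod (n j) \<le> jb j powr r"
  shows "cmod (qform r n x) \<le> (norm x)\<^sup>2"
    and "cmod (qform r n x - qform r n y) \<le> (norm x + norm y) * norm (x - y)"
proof -
  define n' where "n' = (\<lambda>j. n j * of_real (jb j powr (-r)))"
  have n': "cmod (n' j) \<le> 1" for j
  proof -
    have "cmod (n' j) \<le> jb j powr r * jb j powr (-r)"
      unfolding n'_def norm_mult by (intro mult_mono n) auto
    then show ?thesis using jb_pos[of j] by (simp flip: powr_add)
  qed
  have eq: "qform r n x = (\<Sum>\<^sub>\<infinity>j. n' j * (cnj (coord x j) * coord x j))" for x
  proof -
    have "complex_of_real (jb j powr (-r/2)) * of_real (jb j powr (-r/2)) = of_real (jb j powr (-r))" for j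
    proof -
      have "jb j powr (-r/2) * jb j powr (-r/2) = jb j powr (-r)" by (simp flip: powr_add)
      then show ?thesis by (metis of_real_mult)
    qed
    note sq = this
    have "n j * (cnj (cf r x j) * cf r x j) = n' j * (cnj (coord x j) * coord x j)" for j
      unfolding n'_def cf_def complex_cnj_mult complex_cnj_complex_of_real sq[symmetric] by (simp
          only: mult_ac)
    then show ?thesis unfolding qform_def by simp
  qed
  show "cmod (qform r n x) \<le> (norm x)\<^sup>2"
    unfolding eq power2_eq_square by (rule infsum_cnj_mult_le(2)[OF n'])
  note sm = abs_summable_summable[OF infsum_cnj_mult_le(1)[OF n']]
  have "qform r n x - qform r n y
      = (\<Sum>\<^sub>\<infinity>j. n' j * (cnj (coord x j) * coord x j) - n' j * (cnj (coord y j) * coord y j))"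
    unfolding eq by (rule infsum_diff[symmetric, OF sm sm])
  also have "\<dots> = (\<Sum>\<^sub>\<infinity>j. n' j * (cnj (coord x j) * coord (x - y) j) + n' j * (cnj (coord (x - y) j)
      * coord y j))"
    by (rule infsum_cong) (simp add: algebra_simps)
  also have "\<dots> = (\<Sum>\<^sub>\<infinity>j. n' j * (cnj (coord x j) * coord (x - y) j)) + (\<Sum>\<^sub>\<infinity>j. n' j * (cnj (coord (x
      - y) j) * coord y j))"
    by (rule infsum_add[OF sm sm])
  also have "cmod \<dots> \<le> norm x * norm (x - y) + norm (x - y) * norm y"
    by (intro norm_triangle_le add_mono infsum_cnj_mult_le(2)[OF n'])
  finally show "cmod (qform r n x - qform r n y) \<le> (norm x + norm y) * norm (x - y)"
    by (simp add: algebra_simps)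
qed

text \<open>The exponent of the resonant part of the scheme at frequency \<open>k\<close>, up to sign.\<close>

definition zexp :: "real \<Rightarrow> real \<Rightarrow> real \<Rightarrow> l2 \<Rightarrow> int \<Rightarrow> complex" where
  "zexp \<mu> r \<tau> x k = 2 * \<i> * of_real \<mu> * of_real \<tau> *
     (qmass r x + qmom r x * inv_deriv_symbol k)"

lemma cmod_inv_deriv_symbol_le: "cmod (inv_deriv_symbol k) \<le> 1"
proof (cases "k = 0")
  case False
  then have "1 \<le> \<bar>real_of_int k\<bar>" by linarith
  then show ?thesis using False by (simp add: inv_deriv_symbol_def norm_divide norm_mult)
qed (simp add: inv_deriv_symbol_def)

lemma zexp_bounds:
  assumes r: "r > 3/2" and \<tau>: "\<tau> \<ge> 0"
  shows "cmod (zexp \<mu> r \<tau> x k) \<le> 4 * \<bar>\<mu>\<bar> * \<tau> * (norm x)\<^sup>2"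
    and "cmod (zexp \<mu> r \<tau> x k - zexp \<mu> r \<tau> y k) \<le> 4 * \<bar>\<mu>\<bar> * \<tau> * ((norm x + norm y) * norm (x - y))"
proof -
  have n1: "cmod 1 \<le> jb j powr r" for j
    using jb_ge_1[of j] r by (simp add: ge_one_powr_ge_zero)
  have n2: "cmod (- \<i> * of_int j) \<le> jb j powr r" for j
  proof -
    have "\<bar>real_of_int j\<bar> \<le> jb j powr (1/2)" by (rule abs_int_le_jb)
    also have "\<dots> \<le> jb j powr r" using jb_ge_1[of j] r by (intro powr_mono) auto
    finally show ?thesis by (simp add: norm_mult)
  qed
  note q1 = qform_bounds[of "\<lambda>_. 1" r, OF n1] and q2 = qform_bounds[of "\<lambda>j. - \<i> * of_int j" r, OF n2]
  have s: "cmod (c * inv_deriv_symbol k) \<le> cmod c" for c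
    using mult_left_mono[OF cmod_inv_deriv_symbol_le[of k], of "cmod c"] by (simp add: norm_mult)
  have m: "cmod (2 * \<i> * of_real \<mu> * of_real \<tau> * c) = 2 * \<bar>\<mu>\<bar> * \<tau> * cmod c" for c
    using \<tau> by (simp add: norm_mult)
  have "cmod (qmass r x + qmom r x * inv_deriv_symbol k) \<le> (norm x)\<^sup>2 + (norm x)\<^sup>2"
    by (intro norm_triangle_le add_mono q1 order_trans[OF s q2(1)])
  then have "2 * \<bar>\<mu>\<bar> * \<tau> * cmod (qmass r x + qmom r x * inv_deriv_symbol k)
      \<le> 2 * \<bar>\<mu>\<bar> * \<tau> * ((norm x)\<^sup>2 + (norm x)\<^sup>2)"
    using \<tau> by (intro mult_left_mono) auto
  then show "cmod (zexp \<mu> r \<tau> x k) \<le> 4 * \<bar>\<mu>\<bar> * \<tau> * (norm x)\<^sup>2"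
    unfolding zexp_def m by (simp add: algebra_simps)
  define d where "d = (norm x + norm y) * norm (x - y)"
  have "cmod ((qmass r x - qmass r y)
      + (qmom r x - qmom r y) * inv_deriv_symbol k) \<le> d + d"
    unfolding d_def by (intro norm_triangle_le add_mono q1 order_trans[OF s q2(2)])
  then have "2 * \<bar>\<mu>\<bar> * \<tau> * cmod ((qmass r x - qmass r y)
      + (qmom r x - qmom r y) * inv_deriv_symbol k)
      \<le> 2 * \<bar>\<mu>\<bar> * \<tau> * (d + d)"
    using \<tau> by (intro mult_left_mono) auto
  moreover have "zexp \<mu> r \<tau> x k - zexp \<mu> r \<tau> y k = 2 * \<i> * of_real \<mu> * of_real \<tau> *
     ((qmass r x - qmass r y)
      + (qmom r x - qmom r y) * inv_deriv_symbol k)"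
    by (simp add: zexp_def algebra_simps)
  ultimately show "cmod (zexp \<mu> r \<tau> x k - zexp \<mu> r \<tau> y k) \<le> 4 * \<bar>\<mu>\<bar> * \<tau> * ((norm x + norm y) *
      norm (x - y))"
    unfolding d_def[symmetric] by (simp only: m) (simp add: algebra_simps)
qed

text \<open>The Taylor remainder of exp (- z). The linear part belongs to the resonant modes of the
  cubic term; the remainder is of second order in \<tau>.\<close>

definition hexp :: "complex \<Rightarrow> complex" where
  "hexp z = exp (- z) - 1 + z"

text \<open>The derivative 1 - exp (- z) vanishes at 0, so a second use of the mean value inequality
  bounds it by m exp m on the disc.\<close>

lemma hexp_lip:
  assumes "cmod z \<le> m" "cmod w \<le> m"
  shows "cmod (hexp z - hexp w) \<le> m * exp m * cmod (z - w)"
proof (rule field_differentiable_bound[of "cball 0 m"])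
  show "(hexp has_field_derivative (1 - exp (- z))) (at z within cball 0 m)" for z
    unfolding hexp_def[abs_def] by (auto intro!: derivative_eq_intros)
  show "cmod (1 - exp (- z)) \<le> m * exp m" if "z \<in> cball 0 m" for z
  proof -
    have "cmod (exp (- 0) - exp (- z)) \<le> exp m * cmod (0 - z)"
    proof (rule field_differentiable_bound[of "cball 0 m"])
      show "((\<lambda>z. exp (- z)) has_field_derivative (- exp (- z))) (at z within cball 0 m)" for z :: complex
        by (auto intro!: derivative_eq_intros)
      show "cmod (- exp (- z)) \<le> exp m" if "z \<in> cball 0 m" for z
        using norm_exp[of "- z"] that by (simp del: norm_exp_eq_Re) (meson exp_le_cancel_iff order_trans)
    qed (use that in \<open>auto intro: order_trans[OF norm_ge_zero]\<close>)
    also have "\<dots> \<le> exp m * m" using that by (intro mult_left_mono) auto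
    finally show ?thesis by (simp add: mult.commute)
  qed
qed (use assms in auto)

lemma hexp_le: "cmod z \<le> m \<Longrightarrow> cmod (hexp z) \<le> m\<^sup>2 * exp m"
proof -
  assume z: "cmod z \<le> m"
  then have "0 \<le> m" using norm_ge_zero order_trans by blast
  have "cmod (hexp z - hexp 0) \<le> m * exp m * cmod (z - 0)"
    using z \<open>0 \<le> m\<close> by (intro hexp_lip) auto
  also have "\<dots> \<le> m * exp m * m" using z \<open>0 \<le> m\<close> by (intro mult_left_mono) auto
  finally show ?thesis by (simp add: hexp_def power2_eq_square mult_ac)
qed

definition resonant_rem :: "real \<Rightarrow> real \<Rightarrow> real \<Rightarrow> l2 \<Rightarrow> l2" where
  "resonant_rem \<mu> r \<tau> x = diag (\<lambda>k. hexp (zexp \<mu> r \<tau> x k)) x"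

lemma hexp_zexp_bounded:
  assumes "r > 3/2" "\<tau> \<ge> 0"
  shows "cmod (hexp (zexp \<mu> r \<tau> x k)) \<le> (4 * \<bar>\<mu>\<bar> * \<tau> * (norm x)\<^sup>2)\<^sup>2 * exp (4 * \<bar>\<mu>\<bar> * \<tau> * (norm x)\<^sup>2)"
  by (rule hexp_le[OF zexp_bounds(1)[OF assms]])

lemma resonant_rem_lip:
  assumes r: "r > 3/2" and \<tau>: "0 \<le> \<tau>" "\<tau> \<le> 1" and x: "norm x \<le> R" and y: "norm y \<le> R"
  shows "norm (resonant_rem \<mu> r \<tau> x - resonant_rem \<mu> r \<tau> y)
    \<le> 48 * \<mu>\<^sup>2 * R ^ 4 * exp (4 * \<bar>\<mu>\<bar> * R\<^sup>2) * \<tau>\<^sup>2 * norm (x - y)"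
proof -
  define m where "m = 4 * \<bar>\<mu>\<bar> * \<tau> * R\<^sup>2"
  have R: "R \<ge> 0" using x norm_ge_zero order_trans by blast
  have m0: "m \<ge> 0" using \<tau> by (simp add: m_def)
  have z: "cmod (zexp \<mu> r \<tau> v k) \<le> m" if "norm v \<le> R" for v k
  proof -
    have "4 * \<bar>\<mu>\<bar> * \<tau> * (norm v)\<^sup>2 \<le> m"
      unfolding m_def using that \<tau> by (intro mult_left_mono power_mono) auto
    then show ?thesis using zexp_bounds(1)[OF r \<tau>(1), of \<mu> v k] by linarith
  qed
  have em: "exp m \<le> exp (4 * \<bar>\<mu>\<bar> * R\<^sup>2)"
    using mult_right_mono[OF mult_left_mono[OF \<tau>(2), of "4 * \<bar>\<mu>\<bar>"], of "R\<^sup>2"] by (simp add: m_def)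
  let ?hx = "\<lambda>k. hexp (zexp \<mu> r \<tau> x k)" and ?hy = "\<lambda>k. hexp (zexp \<mu> r \<tau> y k)"
  have bx: "cmod (?hx k) \<le> m\<^sup>2 * exp m" for k by (rule hexp_le[OF z[OF x]])
  have by': "cmod (?hy k) \<le> m\<^sup>2 * exp m" for k by (rule hexp_le[OF z[OF y]])
  define e where "e = m * exp m * (4 * \<bar>\<mu>\<bar> * \<tau> * ((R + R) * norm (x - y)))"
  have bd: "cmod (?hx k - ?hy k) \<le> e" for k
  proof -
    have "cmod (?hx k - ?hy k) \<le> m * exp m * cmod (zexp \<mu> r \<tau> x k - zexp \<mu> r \<tau> y k)"
      by (rule hexp_lip[OF z[OF x] z[OF y]])
    also have "\<dots> \<le> e"
    proof -
      have "4 * \<bar>\<mu>\<bar> * \<tau> * ((norm x + norm y) * norm (x - y)) \<le> 4 * \<bar>\<mu>\<bar> * \<tau> * ((R + R) * norm (x - y))"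
        using x y \<tau> by (intro mult_left_mono mult_right_mono add_mono) auto
      then show ?thesis unfolding e_def
        using order_trans[OF zexp_bounds(2)[OF r \<tau>(1), of \<mu> x k y]] m0 by (intro mult_left_mono) auto
    qed
    finally show ?thesis .
  qed
  have e0: "e \<ge> 0" using bd[of 0] norm_ge_zero order_trans by blast
  have "resonant_rem \<mu> r \<tau> x - resonant_rem \<mu> r \<tau> y = diag ?hx (x - y) + diag (\<lambda>k. ?hx k - ?hy k) y"
    unfolding resonant_rem_def
    by (rule l2_eqI) (simp add: coord_diag[of ?hx, OF bx] coord_diag[of ?hy, OF by']
        coord_diag[of "\<lambda>k. ?hx k - ?hy k", OF bd] algebra_simps)
  also have "norm \<dots> \<le> m\<^sup>2 * exp m * norm (x - y) + e * norm y"
    by (intro norm_triangle_le add_mono norm_diag_le bx bd)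
  also have "\<dots> \<le> m\<^sup>2 * exp m * norm (x - y) + e * R"
    using y e0 by (intro add_left_mono mult_left_mono) auto
  \<comment> \<open>The multiplier contributes m^2, its variation twice that, and m^2 = 16 \<mu>^2
    \<tau>^2 R^4; so the constant is 3 times 16.\<close>
  also have "\<dots> = 48 * \<mu>\<^sup>2 * R ^ 4 * exp m * \<tau>\<^sup>2 * norm (x - y)"
  proof -
    have "e * R = 2 * m\<^sup>2 * exp m * norm (x - y)"
      by (simp add: e_def m_def power2_eq_square mult_ac)
    then have "m\<^sup>2 * exp m * norm (x - y) + e * R = 3 * m\<^sup>2 * exp m * norm (x - y)" by simp
    moreover have "m\<^sup>2 = 16 * \<mu>\<^sup>2 * \<tau>\<^sup>2 * R ^ 4"
      by (simp add: m_def power_mult_distrib flip: power_mult)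
    ultimately show ?thesis by simp
  qed
  also have "\<dots> \<le> 48 * \<mu>\<^sup>2 * R ^ 4 * exp (4 * \<bar>\<mu>\<bar> * R\<^sup>2) * \<tau>\<^sup>2 * norm (x - y)"
    using R em by (intro mult_right_mono mult_left_mono) auto
  finally show ?thesis .
qed

section \<open>Fourier coefficients of the coarse propagator\<close>

text \<open>A relation rather than a function, so that its closure rules can be composed along the
  formula of the coarse propagator and read off the coefficients.\<close>

definition has_coeffs :: "(real \<Rightarrow> complex) \<Rightarrow> (int \<Rightarrow> complex) \<Rightarrow> bool" where
  "has_coeffs f a \<longleftrightarrow> wsum a \<and> f = wien a"

lemma has_coeffs_add:
  "has_coeffs f a \<Longrightarrow> has_coeffs g b \<Longrightarrow> has_coeffs (\<lambda>x. f x + g x) (\<lambda>k. a k + b k)"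
  by (auto simp: has_coeffs_def wsum_add wien_add)

lemma has_coeffs_diff:
  "has_coeffs f a \<Longrightarrow> has_coeffs g b \<Longrightarrow> has_coeffs (\<lambda>x. f x - g x) (\<lambda>k. a k - b k)"
  by (auto simp: has_coeffs_def wsum_diff wien_diff)

lemma has_coeffs_cmult: "has_coeffs f a \<Longrightarrow> has_coeffs (\<lambda>x. c * f x) (\<lambda>k. c * a k)"
  by (auto simp: has_coeffs_def wsum_cmult wien_cmult)

lemma has_coeffs_const: "has_coeffs (\<lambda>x. c) (\<lambda>k. if k = 0 then c else 0)"
  by (auto simp: has_coeffs_def wsum_single wien_single)

lemma has_coeffs_mult:
  "has_coeffs f a \<Longrightarrow> has_coeffs g b \<Longrightarrow> has_coeffs (\<lambda>x. f x * g x) (conv a b)"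
  by (auto simp: has_coeffs_def wsum_conv wien_mult)

lemma has_coeffs_power2: "has_coeffs f a \<Longrightarrow> has_coeffs (\<lambda>x. (f x)\<^sup>2) (conv a a)"
  unfolding power2_eq_square by (rule has_coeffs_mult)

lemma has_coeffs_cnj: "has_coeffs f a \<Longrightarrow> has_coeffs (\<lambda>x. cnj (f x)) (\<lambda>k. cnj (a (- k)))"
  by (auto simp: has_coeffs_def wsum_cnj wien_cnj)

lemma has_coeffs_cmod2:
  assumes "has_coeffs f a"
  shows "has_coeffs (\<lambda>x. of_real ((cmod (f x))\<^sup>2)) (conv (\<lambda>k. cnj (a (- k))) a)"
  using has_coeffs_mult[OF has_coeffs_cnj[OF assms] assms]
  by (simp only: complex_norm_square mult.commute)

lemma has_coeffs_multiplier:
  "has_coeffs f a \<Longrightarrow> (\<And>k. cmod (m k) \<le> C) \<Longrightarrow> has_coeffs (fourier_multiplier m f) (\<lambda>k. m k * a k)"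
  by (auto simp: has_coeffs_def fourier_multiplier_wien intro: wsum_mult)

lemma has_coeffs_schroedinger: "has_coeffs f a \<Longrightarrow> has_coeffs (schroedinger_group t f) (\<lambda>k. su t k * a k)"
  using has_coeffs_multiplier[of f a "su t" 1] by (simp add: schroedinger_group_def su_def[abs_def])

lemma has_coeffs_inv_deriv: "has_coeffs f a \<Longrightarrow> has_coeffs (inv_deriv f) (\<lambda>k. inv_deriv_symbol k * a k)"
  unfolding inv_deriv_def by (rule has_coeffs_multiplier[OF _ cmod_inv_deriv_symbol_le])

lemma has_coeffs_Pi0: "has_coeffs f a \<Longrightarrow> Pi0 f = a 0"
  by (auto simp: has_coeffs_def Pi0_wien)

text \<open>The formally differentiated series converges uniformly, so it is integrated term by term
  and the fundamental theorem is applied. Starting the integral at x - 1 puts x in the interior of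
  the interval.\<close>

lemma wien_has_vector_derivative:
  assumes a: "wsum a" and a': "wsum (\<lambda>k. of_int k * a k)"
  shows "(wien a has_vector_derivative wien (\<lambda>k. \<i> * (of_int k * a k)) x) (at x)"
proof -
  define g where "g = wien (\<lambda>k. \<i> * (of_int k * a k))"
  have contg: "continuous_on UNIV g"
    unfolding g_def by (intro continuous_on_wien wsum_cmult a')
  have eq: "wien a y = wien a (x - 1) + integral {x - 1..y} g" if "x - 1 \<le> y" for y
  proof -
    have "((\<lambda>k. integral {x - 1..y} (\<lambda>s. \<i> * (of_int k * a k) * ek k s)) has_sum
        integral {x - 1..y} (\<lambda>s. \<Sum>\<^sub>\<infinity>k. \<i> * (of_int k * a k) * ek k s)) UNIV"
      by (rule has_integral_infsum(1)[OF a'[unfolded wsum_def]])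
        (auto simp: norm_mult intro!: continuous_intros continuous_on_ek)
    moreover have "integral {x - 1..y} (\<lambda>s. \<i> * (of_int k * a k) * ek k s) = a k * ek k y - a k *
        ek k (x - 1)" for k
    proof -
      have "((\<lambda>s. \<i> * of_int k * ek k s) has_integral ek k y - ek k (x - 1)) {x - 1..y}"
        by (intro fundamental_theorem_of_calculus has_vector_derivative_ek that)
      then have "((\<lambda>s. a k * (\<i> * of_int k * ek k s)) has_integral a k * (ek k y - ek k (x - 1)))
          {x - 1..y}"
        by (rule has_integral_mult_right)
      from integral_unique[OF this] show ?thesis by (simp only: mult_ac right_diff_distrib)
    qed
    ultimately have "((\<lambda>k. a k * ek k y - a k * ek k (x - 1)) has_sum integral {x - 1..y} g) UNIV"
      by (simp add: g_def wien_def[abs_def])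
    then have "integral {x - 1..y} g = (\<Sum>\<^sub>\<infinity>k. a k * ek k y - a k * ek k (x - 1))"
      by (simp add: infsumI)
    also have "\<dots> = wien a y - wien a (x - 1)"
      unfolding wien_def by (rule infsum_diff[OF wsum_summable[OF a] wsum_summable[OF a]])
    finally show ?thesis by simp
  qed
  have "((\<lambda>y. integral {x - 1..y} g) has_vector_derivative g x) (at x within {x - 1..x + 1})"
    by (rule integral_has_vector_derivative) (auto intro: continuous_on_subset[OF contg])
  then have "((\<lambda>y. integral {x - 1..y} g) has_vector_derivative g x) (at x)"
    using at_within_interior[of x "{x - 1..x + 1}"] by simp
  then have "((\<lambda>y. wien a (x - 1) + integral {x - 1..y} g) has_vector_derivative g x) (at x)"
    using has_vector_derivative_add[OF has_vector_derivative_const] by fastforce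
  then show ?thesis
    unfolding g_def[symmetric]
  proof (rule has_vector_derivative_transform_within_open)
    show "wien a (x - 1) + integral {x - 1..y} g = wien a y" if "y \<in> {x - 1<..<x + 1}" for y
      using eq[of y] that by simp
  qed auto
qed

lemma has_sum_diff:
  fixes f g :: "'a \<Rightarrow> 'b :: real_normed_vector"
  assumes "(f has_sum a) A" "(g has_sum b) A"
  shows "((\<lambda>x. f x - g x) has_sum (a - b)) A"
  using has_sum_add[OF assms(1), of "\<lambda>x. - g x" "- b"] assms(2) by (simp add: has_sum_uminus)

section \<open>Matching the coarse propagator with the cubic integral, frequency by
  frequency\<close>

context
  fixes \<mu> r \<tau> :: real and x :: l2
  assumes r: "r > 3/2" and \<tau>: "\<tau> \<ge> 0"
begin

private lemma r': "r > 1/2" using r by simp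

private abbreviation "a \<equiv> cf r x"

private lemma hc: "has_coeffs (ev r x) a"
  by (simp add: has_coeffs_def ev_def wsum_cf[OF r'])

private lemma wa: "wsum a" by (rule wsum_cf[OF r'])

lemma mass_ev: "mass (ev r x) = qmass r x"
proof -
  have "mass (ev r x) = conv (\<lambda>k. cnj (a (- k))) a 0"
    unfolding mass_def by (rule has_coeffs_Pi0[OF has_coeffs_cmod2[OF hc]])
  also have "\<dots> = qmass r x"
    unfolding conv_def qform_def
    by (rule infsum_reindex_bij_witness[of _ uminus uminus]) auto
  finally show ?thesis .
qed

lemma momentum_ev: "momentum (ev r x) = qmom r x"
proof -
  let ?c = "\<lambda>k. cnj (a (- k))"
  have "wsum (\<lambda>k. cnj (of_int (- k) * a (- k)))" by (rule wsum_cnj[OF wsum_int_cf[OF r]])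
  then have "wsum (\<lambda>k. - 1 * cnj (of_int (- k) * a (- k)))" by (rule wsum_cmult)
  then have w: "wsum (\<lambda>k. of_int k * ?c k)" by simp
  have "vector_derivative (\<lambda>y. cnj (ev r x y)) (at y) = wien (\<lambda>k. \<i> * (of_int k * ?c k)) y" for y
    using vector_derivative_at[OF wien_has_vector_derivative[OF wsum_cnj[OF wa] w]]
    by (simp add: ev_def wien_cnj)
  moreover have "has_coeffs (\<lambda>y. ev r x y * wien (\<lambda>k. \<i> * (of_int k * ?c k)) y)
      (conv a (\<lambda>k. \<i> * (of_int k * ?c k)))"
    by (rule has_coeffs_mult[OF hc]) (simp add: has_coeffs_def wsum_cmult w)
  ultimately have "momentum (ev r x) = conv a (\<lambda>k. \<i> * (of_int k * ?c k)) 0"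
    unfolding momentum_def by (simp add: has_coeffs_Pi0)
  also have "\<dots> = qmom r x"
    unfolding conv_def qform_def by (rule infsum_cong) (simp add: mult_ac)
  finally show ?thesis .
qed

private abbreviation "osum \<equiv> tsum (\<lambda>k p. - \<i> * of_real \<mu> * osc \<tau> (phase k p)) a a a"
private abbreviation "rsum \<equiv> tsum (rem_symbol \<mu> \<tau>) a a a"
private abbreviation "res k p \<equiv> (if snd p = k then 2 * \<i> * of_real \<mu> * of_real \<tau> * (1 - of_int
    (fst p) / of_int k) else 0)"

private definition "E k = exp (- zexp \<mu> r \<tau> x k)"

private definition "cub0 = tsum (\<lambda>_ _. 1) a a a"
private definition "cub1 = tsum (\<lambda>k p. su (- \<tau>) (- fst p) * su \<tau> (k + fst p)) a a a"
text \<open>One definition for both occurrences: evolved factors for t = \<tau>, plain ones for t =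
  0.\<close>

private definition "cub2 = (\<lambda>t. tsum (\<lambda>k p. inv_deriv_symbol (k - snd p))
  (\<lambda>k. su t k * a k) (\<lambda>k. su t k * a k) (\<lambda>k. su t k * a k))"

private lemma hc_E: "has_coeffs (mass_momentum_exp \<mu> \<tau> (ev r x) (ev r x)) (\<lambda>k. E k * a k)"
proof -
  have "cmod (E k) \<le> exp (4 * \<bar>\<mu>\<bar> * \<tau> * (norm x)\<^sup>2)" for k
  proof -
    have "cmod (E k) \<le> exp (cmod (- zexp \<mu> r \<tau> x k))"
      unfolding E_def by (rule norm_exp)
    also have "\<dots> \<le> exp (4 * \<bar>\<mu>\<bar> * \<tau> * (norm x)\<^sup>2)"
      using zexp_bounds(1)[OF r \<tau>, of \<mu> x k] by simp
    finally show ?thesis .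
  qed
  from has_coeffs_multiplier[OF hc this] show ?thesis
    by (simp add: mass_momentum_exp_def E_def[abs_def] zexp_def mass_ev momentum_ev)
qed

private lemma hc_cub0: "has_coeffs (\<lambda>y. of_real ((cmod (ev r x y))\<^sup>2) * ev r x y) cub0"
  unfolding cub0_def has_coeffs_def ev_def using wien_cubic[OF wa] by (simp add: fun_eq_iff)

private lemma hc_cub1:
  "has_coeffs (\<lambda>y. schroedinger_group (- \<tau>) (\<lambda>z. cnj (ev r x z)) y * schroedinger_group \<tau> (\<lambda>z. (ev
      r x z)\<^sup>2) y) cub1"
proof -
  have "conv (\<lambda>j. su (- \<tau>) j * cnj (a (- j))) (\<lambda>l. su \<tau> l * conv a a l) = cub1"
    unfolding cub1_def by (rule ext, rule conv_conv_conj_first[OF wa wa wa]) auto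
  then show ?thesis
    using has_coeffs_mult[OF has_coeffs_schroedinger[OF has_coeffs_cnj[OF hc]]
        has_coeffs_schroedinger[OF has_coeffs_power2[OF hc]],
        of "- \<tau>" \<tau>] by simp
qed

private lemma hc_cub2:
  assumes f: "has_coeffs f (\<lambda>k. su t k * a k)"
  shows "has_coeffs (\<lambda>y. f y * inv_deriv (\<lambda>z. of_real ((cmod (f z))\<^sup>2)) y) (cub2 t)"
proof -
  let ?b = "\<lambda>k. su t k * a k"
  have w: "wsum ?b" using f by (simp add: has_coeffs_def)
  have "conv ?b (\<lambda>l. inv_deriv_symbol l * conv (\<lambda>j. cnj (?b (- j))) ?b l) = cub2 t"
    unfolding cub2_def by (rule ext, rule conv_conv_conj_second[OF w w w cmod_inv_deriv_symbol_le])
  then show ?thesis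
    using has_coeffs_mult[OF f has_coeffs_inv_deriv[OF has_coeffs_cmod2[OF f]]] by simp
qed

text \<open>The image of the coarse propagator under the rules for \<open>has_coeffs\<close>, in the
  same order of terms so that these rules match syntactically.\<close>

private definition "gcoef k = su \<tau> k * a k +
  (su \<tau> k * (E k * a k - a k) - (if k = 0 then \<i> * of_real \<mu> * of_real \<tau> * cub0 0 else 0)
   + (if k = 0 then 2 * \<i> * of_real \<mu> * of_real \<tau> * mass (ev r x) * a 0 else 0)
   - of_real \<mu> / 2 * (inv_deriv_symbol k * (inv_deriv_symbol k * cub1 k))
   + of_real \<mu> / 2 * (su \<tau> k * (inv_deriv_symbol k * (inv_deriv_symbol k * cub0 k)))
   + of_real \<mu> * (inv_deriv_symbol k * cub2 \<tau> k)
   - of_real \<mu> * (su \<tau> k * (inv_deriv_symbol k * cub2 0 k)))"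

private lemma hc_coarse: "has_coeffs (coarse_propagator \<mu> \<tau> (ev r x)) gcoef"
proof -
  have hc0: "has_coeffs (ev r x) (\<lambda>k. su 0 k * a k)" using hc by simp
  show ?thesis
    unfolding coarse_propagator_def Phi_c2_def Let_def gcoef_def[abs_def]
      has_coeffs_Pi0[OF hc_cub0] has_coeffs_Pi0[OF hc]
    by (intro has_coeffs_add has_coeffs_diff has_coeffs_cmult has_coeffs_const has_coeffs_schroedinger
        has_coeffs_inv_deriv hc hc_E hc_cub0 hc_cub1 hc_cub2 hc0)
qed

text \<open>Taking out the free phase of the output leaves k^2 + k1^2 - (k + k1)^2 = - 2 k k1: the
  part of the phase that the scheme keeps.\<close>

private lemma su_cub1: "cub1 k = su \<tau> k * tsum (\<lambda>k p. cis (\<tau> * (- 2 * of_int k * of_int (fst p)))) a a a k"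
proof -
  have "su (- \<tau>) (- fst p) * su \<tau> (k + fst p) = su \<tau> k * cis (\<tau> * (- 2 * of_int k * of_int (fst
      p)))" for p :: "int \<times> int"
    by (simp add: su_eq_cis cis_mult power2_eq_square algebra_simps)
  then show ?thesis
    by (simp add: cub1_def tsum_def mult.assoc infsum_cmult_right')
qed

private lemma su_tprod:
  "tprod (\<lambda>k. su t k * a k) (\<lambda>k. su t k * a k) (\<lambda>k. su t k * a k) k p = su t k * (cis (t * phase k
      p) * tprod a a a k p)"
proof -
  have "cnj (su t (fst p)) * su t (snd p) * su t (k + fst p - snd p) = su t k * cis (t * phase k p)"
    unfolding phase_eq by (simp add: su_eq_cis cis_cnj cis_mult algebra_simps)
  then show ?thesis unfolding tprod_def complex_cnj_mult by algebra
qed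

private lemma su_cub2: "cub2 t k = su t k * tsum (\<lambda>k p. inv_deriv_symbol (k - snd p) * cis (t *
    phase k p)) a a a k"
  unfolding cub2_def tsum_def infsum_cmult_right'[symmetric] su_tprod
  by (rule infsum_cong) (simp add: mult_ac)

text \<open>If k2 = k then k3 = k1, so the product is |a_k1|^2 a_k; the weights 1 and - k1/k sum to
  mass and to momentum times 1/(ik).\<close>

private lemma resonant_has_sum:
  assumes "k \<noteq> 0"
  shows "((\<lambda>p. res k p * tprod a a a k p)
    has_sum zexp \<mu> r \<tau> x k * a k) UNIV"
proof -
  obtain C where C: "\<And>k. cmod (a k) \<le> C" "C \<ge> 0" using wsum_bounded[OF wa] by blast
  have "wsum (\<lambda>j. cnj (a j) * a j)"
    by (rule wsum_mult[OF wa, where C = C]) (simp add: C)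
  from this[unfolded wsum_def] have s1: "(\<lambda>j. cnj (a j) * a j) summable_on UNIV"
    by (rule abs_summable_summable)
  have "wsum (\<lambda>j. - \<i> * cnj (a j) * (of_int j * a j))"
    by (rule wsum_mult[OF wsum_int_cf[OF r], where C = C]) (simp add: C norm_mult)
  from this[unfolded wsum_def] have "(\<lambda>j. - \<i> * cnj (a j) * (of_int j * a j)) summable_on UNIV"
    by (rule abs_summable_summable)
  then have s2: "(\<lambda>j. - \<i> * of_int j * (cnj (a j) * a j)) summable_on UNIV"
    by (simp add: mult_ac)
  have "((\<lambda>j. 1 * (cnj (a j) * a j) + - \<i> * of_int j * (cnj (a j) * a j) * inv_deriv_symbol k) has_sum
      (qmass r x + qmom r x * inv_deriv_symbol k)) UNIV"
    unfolding qform_def using s1 s2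
    by (intro has_sum_add has_sum_cmult_left has_sum_infsum) auto
  from has_sum_cmult_right[OF this, of "2 * \<i> * of_real \<mu> * of_real \<tau> * a k"]
  have "((\<lambda>j. 2 * \<i> * of_real \<mu> * of_real \<tau> * a k *
      (1 * (cnj (a j) * a j) + - \<i> * of_int j * (cnj (a j) * a j) * inv_deriv_symbol k)) has_sum
          zexp \<mu> r \<tau> x k * a k) UNIV"
    by (simp only: zexp_def mult_ac)
  also have "?this \<longleftrightarrow> ((\<lambda>p. res k p * tprod a a a k p)
    has_sum zexp \<mu> r \<tau> x k * a k) {p. snd p = k}"
    by (rule has_sum_reindex_bij_witness[of _ fst "\<lambda>j. (j, k)"])
      (use assms in \<open>auto simp: tprod_def inv_deriv_symbol_def field_simps\<close>)
  also have "\<dots> \<longleftrightarrow> ((\<lambda>p. res k p * tprod a a a k p)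
    has_sum zexp \<mu> r \<tau> x k * a k) UNIV"
    by (rule has_sum_cong_neutral) auto
  finally show ?thesis .
qed

private lemma tsum_has_sum:
  assumes "\<And>p. cmod (m k p) \<le> C"
  shows "((\<lambda>p. m k p * tprod a a a k p) has_sum tsum m a a a k) UNIV"
  unfolding tsum_def by (rule has_sum_infsum, rule tsum_summable[OF wa wa wa, where C = C], rule assms)

text \<open>Taking a coefficient is a bounded functional and commutes with the integral; then sum
  and integral are exchanged, as the oscillating factor has modulus 1.\<close>

private lemma cf_cubic_integral:
  "cf r (integral {0..\<tau>} (\<lambda>s. nlsB \<mu> r s x x x)) k = osum k"
proof -
  have bl: "bounded_linear (\<lambda>y. cf r y k)"
    unfolding cf_def by (intro bounded_linear_mult_const bounded_linear_const_mult bounded_linear_coord)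
  interpret cubic_ode "nlsB \<mu> r" "\<bar>\<mu>\<bar> * algc r" by (rule cubic_ode_nls[OF r'])
  have int: "(\<lambda>s. nlsB \<mu> r s x x x) integrable_on {0..\<tau>}"
    by (intro integrable_continuous_interval cont continuous_on_const)
  have cfB: "cf r (nlsB \<mu> r s x x x) k = (\<Sum>\<^sub>\<infinity>p. - \<i> * of_real \<mu> * tprod a a a k p * cis (s * phase
      k p))" for s
  proof -
    have sgs: "cf r (sg t y) = (\<lambda>k. su t k * cf r y k)" for t y by (simp add: cf_def fun_eq_iff)
    have "cf r (nlsB \<mu> r s x x x) k = su (- s) k * tsum (\<lambda>_ _. - \<i> * of_real \<mu>) (\<lambda>k. su s k * a k)
        (\<lambda>k. su s k * a k) (\<lambda>k. su s k * a k) k"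
      unfolding nlsB_def nlsN_def cubic_ksym_def sgs
        cf_tri_ksym[OF kernel_bdd_cubic[OF r', of \<mu>, unfolded cubic_ksym_def]] ..
    also have "\<dots> = (\<Sum>\<^sub>\<infinity>p. - \<i> * of_real \<mu> * tprod a a a k p * cis (s * phase k p))"
      unfolding tsum_def infsum_cmult_right'[symmetric] su_tprod
    proof (rule infsum_cong)
      fix p
      have "su (- s) k * su s k = 1" by (simp flip: su_add)
      then show "su (- s) k * (- \<i> * of_real \<mu> * (su s k * (cis (s * phase k p) * tprod a a a k p)))
          = - \<i> * of_real \<mu> * tprod a a a k p * cis (s * phase k p)" by algebra
    qed
    finally show ?thesis .
  qed
  have "cf r (integral {0..\<tau>} (\<lambda>s. nlsB \<mu> r s x x x)) k
      = integral {0..\<tau>} (\<lambda>s. \<Sum>\<^sub>\<infinity>p. - \<i> * of_real \<mu> * tprod a a a k p * cis (s * phase k p))"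
    using integral_linear[OF int bl] by (simp add: o_def cfB)
  also have "\<dots> = (\<Sum>\<^sub>\<infinity>p. integral {0..\<tau>} (\<lambda>s. - \<i> * of_real \<mu> * tprod a a a k p * cis (s * phase k p)))"
  proof (rule infsumI[symmetric], rule has_integral_infsum(1))
    show "(\<lambda>p. \<bar>\<mu>\<bar> * cmod (tprod a a a k p)) summable_on UNIV"
      by (intro summable_on_cmult_right tprod_summable wa)
  qed (auto simp: norm_mult intro!: continuous_intros)
  also have "\<dots> = osum k"
    unfolding tsum_def osc_def by (rule infsum_cong) (simp add: mult_ac)
  finally show ?thesis .
qed

private lemma osc_symbol_bounded: "cmod (- \<i> * of_real \<mu> * osc \<tau> (phase k p)) \<le> \<bar>\<mu>\<bar> * \<tau>"
  by (simp add: norm_mult mult_left_mono cmod_osc_le[OF \<tau>])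

private lemma rem_has_sum:
  "((\<lambda>p. rem_symbol \<mu> \<tau> k p * tprod a a a k p) has_sum rsum k) UNIV"
proof -
  have "(\<lambda>p. ksym r (rem_symbol \<mu> \<tau>) k p * ctprod x x x k p) summable_on UNIV"
    by (rule abs_summable_summable[OF kernel_abs_summable[OF kernel_bdd_rem[OF r \<tau>]]])
  then have "(\<lambda>p. of_real (jb k powr (- r / 2)) * (ksym r (rem_symbol \<mu> \<tau>) k p * ctprod x x x k
      p)) summable_on UNIV"
    by (rule summable_on_cmult_right)
  then have "(\<lambda>p. rem_symbol \<mu> \<tau> k p * tprod a a a k p) summable_on UNIV"
    by (simp only: ksym_tprod)
  then show ?thesis unfolding tsum_def by (rule has_sum_infsum)
qed

text \<open>\<open>\<Gamma>\<close> is the cubic part of the coefficient, with the exponential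
  replaced by its linear part; \<open>hexp\<close> accounts for the replacement. The claim reduces
  to the comparison of \<open>\<Gamma>\<close> with the exact oscillatory sum.\<close>

private lemma coarse_identity_nonzero:
  assumes k: "k \<noteq> 0"
  shows "gcoef k = su \<tau> k * (a k + osum k
    + rsum k + hexp (zexp \<mu> r \<tau> x k) * a k)"
proof -
  let ?\<sigma> = "inv_deriv_symbol" and ?t = "tprod a a a k"
  let ?I = "osum k"
  define A B C where "A = tsum (\<lambda>k p. cis (\<tau> * (- 2 * of_int k * of_int (fst p)))) a a a k"
    and "B = tsum (\<lambda>k p. ?\<sigma> (k - snd p) * cis (\<tau> * phase k p)) a a a k"
    and "C = tsum (\<lambda>k p. ?\<sigma> (k - snd p)) a a a k"
  define \<Gamma> where "\<Gamma> = - (zexp \<mu> r \<tau> x k * a k) - of_real \<mu> / 2 * (?\<sigma> k)\<^sup>2 * A + of_real \<mu> / 2 *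
      (?\<sigma> k)\<^sup>2 * cub0 k
     + of_real \<mu> * ?\<sigma> k * B - of_real \<mu> * ?\<sigma> k * C"
  have hs: "((\<lambda>p. coarse_symbol \<mu> \<tau> k p * ?t p) has_sum \<Gamma>) UNIV"
  proof -
    let ?g = "\<lambda>p. - (res k p * ?t p)
      - of_real \<mu> / 2 * (?\<sigma> k)\<^sup>2 * (cis (\<tau> * (- 2 * of_int k * of_int (fst p))) * ?t p)
      + of_real \<mu> / 2 * (?\<sigma> k)\<^sup>2 * (1 * ?t p)
      + of_real \<mu> * ?\<sigma> k * (?\<sigma> (k - snd p) * cis (\<tau> * phase k p) * ?t p)
      - of_real \<mu> * ?\<sigma> k * (?\<sigma> (k - snd p) * ?t p)"
    have "(?g has_sum \<Gamma>) UNIV"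
      unfolding \<Gamma>_def A_def B_def C_def cub0_def
      by (intro has_sum_diff has_sum_add has_sum_uminusI has_sum_cmult_right resonant_has_sum k
          tsum_has_sum[where C = 1]) (auto simp: norm_mult cmod_inv_deriv_symbol_le)
    moreover have "coarse_symbol \<mu> \<tau> k p * ?t p = ?g p" for p
      unfolding coarse_symbol_def ring_distribs mult.assoc mult_minus_left mult_1_left ..
    ultimately show ?thesis by simp
  qed
  have "((\<lambda>p. coarse_symbol \<mu> \<tau> k p * ?t p - - \<i> * of_real \<mu> * osc \<tau> (phase k p) * ?t p) has_sum
      (\<Gamma> - ?I)) UNIV"
    by (intro has_sum_diff hs tsum_has_sum[OF osc_symbol_bounded])
  then have hs1: "((\<lambda>p. (coarse_symbol \<mu> \<tau> k p + \<i> * of_real \<mu> * osc \<tau> (phase k p)) * ?t p)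
      has_sum (\<Gamma> - ?I)) UNIV"
    by (simp add: algebra_simps)
  \<comment> \<open>Symbols agree only after symmetrization, so the same sum is reindexed by
    exchanging k2 and k3, added to itself and halved.\<close>
  also have "?this \<longleftrightarrow> ((\<lambda>p. (coarse_symbol \<mu> \<tau> k (swap3 k p) + \<i> * of_real \<mu> * osc \<tau> (phase k
      (swap3 k p))) * ?t (swap3 k p))
      has_sum (\<Gamma> - ?I)) UNIV"
    by (rule has_sum_reindex_bij_witness[of _ "swap3 k" "swap3 k"]) (auto simp: swap3_swap3)
  finally have hs2: "((\<lambda>p. (coarse_symbol \<mu> \<tau> k (swap3 k p) + \<i> * of_real \<mu> * osc \<tau> (phase k
      (swap3 k p))) * ?t p)
      has_sum (\<Gamma> - ?I)) UNIV"
    unfolding tprod_swap3 .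
  have "((\<lambda>p. 2 * (rem_symbol \<mu> \<tau> k p * ?t p)) has_sum ((\<Gamma> - ?I) + (\<Gamma> - ?I))) UNIV"
    using has_sum_add[OF hs1 hs2] unfolding ring_distribs(2)[symmetric] rem_symbol_symmetrized[OF \<tau> k]
    by (simp add: mult.assoc)
  moreover have "((\<lambda>p. 2 * (rem_symbol \<mu> \<tau> k p * ?t p)) has_sum (2 * rsum k)) UNIV"
    by (intro has_sum_cmult_right rem_has_sum)
  ultimately have "(\<Gamma> - ?I) + (\<Gamma> - ?I) = 2 * rsum k"
    by (rule has_sum_unique)
  then have \<Gamma>: "\<Gamma> = ?I + rsum k"
    by (simp only: mult_2[symmetric] mult_cancel_left) (simp add: diff_eq_eq add.commute)
  have "gcoef k = su \<tau> k * (a k + \<Gamma> + hexp (zexp \<mu> r \<tau> x k) * a k)"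
    unfolding gcoef_def su_cub1 su_cub2 \<Gamma>_def hexp_def E_def A_def[symmetric] B_def[symmetric] using k
    by (simp add: C_def power2_eq_square algebra_simps)
  then show ?thesis unfolding \<Gamma> by (simp add: add.assoc)
qed

text \<open>All inverse derivatives drop out. The term with mass times mean value cancels the linear
  part of the exponential, leaving \<open>hexp\<close>; the mean of the cubic term is the
  oscillatory sum with its phase set to zero.\<close>

private lemma coarse_identity_zero:
  "gcoef 0 = su \<tau> 0 * (a 0 + osum 0
    + rsum 0 + hexp (zexp \<mu> r \<tau> x 0) * a 0)"
proof -
  have s0: "su \<tau> 0 = 1" "inv_deriv_symbol 0 = 0" by (simp_all add: su_def inv_deriv_symbol_def)
  have "((\<lambda>p. - \<i> * of_real \<mu> * osc \<tau> (phase 0 p) * tprod a a a 0 p + rem_symbol \<mu> \<tau> 0 p * tprod a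
      a a 0 p) has_sum
      (osum 0 + rsum 0)) UNIV"
    by (intro has_sum_add tsum_has_sum[OF osc_symbol_bounded] rem_has_sum)
  also have "(\<lambda>p. - \<i> * of_real \<mu> * osc \<tau> (phase 0 p) * tprod a a a 0 p + rem_symbol \<mu> \<tau> 0 p *
      tprod a a a 0 p)
      = (\<lambda>p. - \<i> * of_real \<mu> * of_real \<tau> * (1 * tprod a a a 0 p))"
    by (simp add: rem_symbol_def fun_eq_iff algebra_simps)
  finally have "osum 0 + rsum 0
      = - \<i> * of_real \<mu> * of_real \<tau> * cub0 0"
  proof (rule has_sum_unique)
    show "((\<lambda>p. - \<i> * of_real \<mu> * of_real \<tau> * (1 * tprod a a a 0 p)) has_sum (- \<i> * of_real \<mu> *
        of_real \<tau> * cub0 0)) UNIV"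
      unfolding cub0_def by (intro has_sum_cmult_right tsum_has_sum[where C = 1]) auto
  qed
  then have "su \<tau> 0 * (a 0 + osum 0
    + rsum 0 + hexp (zexp \<mu> r \<tau> x 0) * a 0)
    = a 0 + - \<i> * of_real \<mu> * of_real \<tau> * cub0 0 + hexp (zexp \<mu> r \<tau> x 0) * a 0"
    by (simp add: s0 add.assoc)
  then show ?thesis
    unfolding gcoef_def by (simp add: s0 E_def hexp_def zexp_def mass_ev algebra_simps)
qed

definition coarse_rem :: "l2" where
  "coarse_rem = tri (ksym r (rem_symbol \<mu> \<tau>)) x x x + resonant_rem \<mu> r \<tau> x"

lemma coarse_propagator_ev:
  "coarse_propagator \<mu> \<tau> (ev r x)
    = ev r (sg \<tau> (x + integral {0..\<tau>} (\<lambda>s. nlsB \<mu> r s x x x) + coarse_rem))"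
proof -
  have add: "cf r (y + z) k = cf r y k + cf r z k" for y z k by (simp add: cf_def distrib_left)
  have res: "cf r (resonant_rem \<mu> r \<tau> x) k = hexp (zexp \<mu> r \<tau> x k) * a k" for k
    by (simp add: cf_def resonant_rem_def coord_diag[of _ _ x k, OF hexp_zexp_bounded[OF r \<tau>, of \<mu> x]])
  have "gcoef k = cf r (sg \<tau> (x + integral {0..\<tau>} (\<lambda>s. nlsB \<mu> r s x x x) + coarse_rem)) k" for k
  proof -
    have "cf r (sg \<tau> (x + integral {0..\<tau>} (\<lambda>s. nlsB \<mu> r s x x x) + coarse_rem)) k
      = su \<tau> k * cf r (x + integral {0..\<tau>} (\<lambda>s. nlsB \<mu> r s x x x) + coarse_rem) k"
      by (simp add: cf_def)
    also have "\<dots> = gcoef k"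
      unfolding coarse_rem_def add cf_cubic_integral res cf_tri_ksym[OF kernel_bdd_rem[OF r \<tau>]]
      using coarse_identity_nonzero[of k] coarse_identity_zero by (cases "k = 0") (simp_all add: add.assoc)
    finally show ?thesis by simp
  qed
  then have "gcoef = cf r (sg \<tau> (x + integral {0..\<tau>} (\<lambda>s. nlsB \<mu> r s x x x) + coarse_rem))"
    by (simp add: fun_eq_iff)
  then show ?thesis using hc_coarse by (simp add: has_coeffs_def ev_def)
qed

end

section \<open>Convergence of the parareal iteration\<close>

context nls
begin

definition coarse :: "real \<Rightarrow> l2 \<Rightarrow> l2" where
  "coarse \<tau> x = sg \<tau> (x + integral {0..\<tau>} (\<lambda>s. K s x) + coarse_rem \<mu> r \<tau> x)"

lemma exact_flow_lip:
  assumes "norm x \<le> R" "norm y \<le> R" "small R \<tau>"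
  shows "norm (exact_flow \<tau> x - exact_flow \<tau> y) \<le> (1 + 6 * (\<bar>\<mu>\<bar> * algc r) * (R + 1)\<^sup>2 * \<tau>) * norm (x - y)"
proof -
  have \<tau>: "\<tau> \<in> {0..\<tau>}" using assms by (simp add: small_def)
  have "norm (exact_flow \<tau> x - exact_flow \<tau> y) = norm (flow \<tau> x \<tau> - flow \<tau> y \<tau>)"
    by (simp add: exact_flow_def flip: sg_diff)
  also have "\<dots> = norm ((x - y) + ((flow \<tau> x \<tau> - x) - (flow \<tau> y \<tau> - y)))"
    by (simp add: algebra_simps)
  also have "\<dots> \<le> norm (x - y) + 6 * (\<bar>\<mu>\<bar> * algc r) * (R + 1)\<^sup>2 * norm (x - y) * \<tau>"
    by (intro norm_triangle_le add_mono flow_lip(2)[OF assms \<tau>] order_refl)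
  finally show ?thesis by (simp add: algebra_simps)
qed

definition defect_const :: "real \<Rightarrow> real" where
  "defect_const R = 45 * (\<bar>\<mu>\<bar> * algc r)\<^sup>2 * (R + 1) ^ 4 + 12 * \<bar>\<mu>\<bar> * algc (r - 1) * R\<^sup>2
     + 48 * \<mu>\<^sup>2 * R ^ 4 * exp (4 * \<bar>\<mu>\<bar> * R\<^sup>2)"

lemma defect_const_nonneg: "defect_const R \<ge> 0"
  unfolding defect_const_def by (intro add_nonneg_nonneg mult_nonneg_nonneg algc_nonneg) auto

lemma defect_lip:
  assumes r32: "r > 3/2" and x: "norm x \<le> R" and y: "norm y \<le> R" and sm: "small R \<tau>" and \<tau>1: "\<tau> \<le> 1"
  shows "norm ((exact_flow \<tau> x - coarse \<tau> x) - (exact_flow \<tau> y - coarse \<tau> y))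
    \<le> defect_const R * \<tau>\<^sup>2 * norm (x - y)"
proof -
  have \<tau>: "\<tau> \<ge> 0" using sm by (simp add: small_def)
  note Kr = kernel_bdd_rem[OF r32 \<tau>, of \<mu>]
  define Q where "Q = (\<lambda>x. tri (ksym r (rem_symbol \<mu> \<tau>)) x x x)"
  define T where "T = (\<lambda>x. flow \<tau> x \<tau> - x - integral {0..\<tau>} (\<lambda>s. K s x))"
  have "exact_flow \<tau> x - coarse \<tau> x = sg \<tau> (T x - Q x - resonant_rem \<mu> r \<tau> x)" for x
    by (simp add: exact_flow_def coarse_def coarse_rem_def[OF r32 \<tau>] Q_def T_def algebra_simps
        flip: sg_diff)
  then have "norm ((exact_flow \<tau> x - coarse \<tau> x) - (exact_flow \<tau> y - coarse \<tau> y))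
      = norm ((T x - T y) - (Q x - Q y) - (resonant_rem \<mu> r \<tau> x - resonant_rem \<mu> r \<tau> y))"
    by (simp add: algebra_simps flip: sg_diff)
  also have "\<dots> \<le> norm (T x - T y) + norm (Q x - Q y) + norm (resonant_rem \<mu> r \<tau> x - resonant_rem \<mu> r \<tau> y)"
    by (rule order_trans[OF norm_triangle_ineq4], rule add_right_mono, rule norm_triangle_ineq4)
  also have "\<dots> \<le> 45 * (\<bar>\<mu>\<bar> * algc r)\<^sup>2 * (R + 1) ^ 4 * \<tau>\<^sup>2 * norm (x - y)
      + 12 * \<bar>\<mu>\<bar> * algc (r - 1) * R\<^sup>2 * \<tau>\<^sup>2 * norm (x - y)
      + 48 * \<mu>\<^sup>2 * R ^ 4 * exp (4 * \<bar>\<mu>\<bar> * R\<^sup>2) * \<tau>\<^sup>2 * norm (x - y)"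
  proof (intro add_mono)
    show "norm (T x - T y) \<le> 45 * (\<bar>\<mu>\<bar> * algc r)\<^sup>2 * (R + 1) ^ 4 * \<tau>\<^sup>2 * norm (x - y)"
      unfolding T_def by (rule flow_second_order[OF x y sm])
    show "norm (resonant_rem \<mu> r \<tau> x - resonant_rem \<mu> r \<tau> y)
      \<le> 48 * \<mu>\<^sup>2 * R ^ 4 * exp (4 * \<bar>\<mu>\<bar> * R\<^sup>2) * \<tau>\<^sup>2 * norm (x - y)"
      by (rule resonant_rem_lip[OF r32 \<tau> \<tau>1 x y])
    have R: "R \<ge> 0" using sm by (simp add: small_def)
    let ?C = "4 * \<bar>\<mu>\<bar> * \<tau>\<^sup>2 * algc (r - 1)"
    have C: "?C \<ge> 0" by (simp add: algc_nonneg)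
    have "norm (Q x - Q y) \<le> ?C * (norm (x - y) * norm x * norm x) + ?C * (norm y * norm (x - y) * norm x)
        + ?C * (norm y * norm y * norm (x - y))"
      unfolding Q_def tri_triple_diff[OF Kr] by (intro norm_triangle_le add_mono norm_tri_le Kr)
    also have "\<dots> \<le> ?C * (norm (x - y) * R * R) + ?C * (R * norm (x - y) * R) + ?C * (R * R * norm (x - y))"
      using x y R C by (intro add_mono mult_left_mono mult_mono) auto
    finally show "norm (Q x - Q y) \<le> 12 * \<bar>\<mu>\<bar> * algc (r - 1) * R\<^sup>2 * \<tau>\<^sup>2 * norm (x - y)"
      by (simp add: power2_eq_square algebra_simps)
  qed
  also have "\<dots> = defect_const R * \<tau>\<^sup>2 * norm (x - y)"
    by (simp add: defect_const_def algebra_simps)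
  finally show ?thesis .
qed

text \<open>Turns the Lipschitz bound of the defect into a bound on its size over a ball, which the
  initial coarse sweep needs.\<close>

lemma defect_0:
  assumes "r > 3/2" "\<tau> \<ge> 0"
  shows "exact_flow \<tau> 0 - coarse \<tau> 0 = 0"
proof -
  have "solves \<tau> 0 (\<lambda>_. 0)" by (simp add: solves_def K_0)
  then have "flow \<tau> 0 \<tau> = 0" using flow_eq[of \<tau> 0 "\<lambda>_. 0" \<tau>] assms by simp
  moreover have "tri (ksym r (rem_symbol \<mu> \<tau>)) 0 0 0 = 0"
    using norm_tri_le[OF kernel_bdd_rem[OF assms, of \<mu>], of 0 0 0] by simp
  moreover have "resonant_rem \<mu> r \<tau> 0 = 0"
    unfolding resonant_rem_def
    using norm_diag_le[OF hexp_zexp_bounded[OF assms, of \<mu> 0], where x = 0] by simp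
  ultimately show ?thesis
    by (simp add: exact_flow_def coarse_def coarse_rem_def[OF assms] K_0)
qed

end

text \<open>The recursion is available only while the error is at most 1, that is, inside the ball
  where the propagators are Lipschitz. The final bound is itself at most 1, so the induction never
  leaves that regime.\<close>

lemma discrete_Gronwall:
  fixes e :: "nat \<Rightarrow> real"
  assumes e0: "e 0 = 0" and nonneg: "\<alpha> \<ge> 0" "c \<ge> 0" "\<And>n. e n \<ge> 0"
    and bound: "real N * c * exp (\<alpha> * real N) \<le> 1"
    and step: "\<And>n. n < N \<Longrightarrow> e n \<le> 1 \<Longrightarrow> e (Suc n) \<le> (1 + \<alpha>) * e n + c"
  shows "n \<le> N \<Longrightarrow> e n \<le> real N * c * exp (\<alpha> * real N)"
proof -
  have mono: "real n * c * exp (\<alpha> * real n) \<le> real N * c * exp (\<alpha> * real N)" if "n \<le> N" for n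
    using that nonneg by (intro mult_mono mult_right_mono) (auto intro: mult_left_mono)
  have le: "n \<le> N \<Longrightarrow> e n \<le> real n * c * exp (\<alpha> * real n)" for n
  proof (induction n)
    case 0
    then show ?case by (simp add: e0)
  next
    case (Suc n)
    then have n: "n < N" "e n \<le> real n * c * exp (\<alpha> * real n)" by auto
    then have "e n \<le> 1" using mono[of n] bound by linarith
    then have "e (Suc n) \<le> (1 + \<alpha>) * e n + c" by (rule step[OF n(1)])
    also have "\<dots> \<le> exp \<alpha> * (real n * c * exp (\<alpha> * real n)) + c * exp (\<alpha> * real (Suc n))"
    proof (intro add_mono mult_mono n)
      show "1 + \<alpha> \<le> exp \<alpha>" by (rule exp_ge_add_one_self)
      show "c \<le> c * exp (\<alpha> * real (Suc n))"
        using nonneg mult_left_mono[of 1 "exp (\<alpha> * real (Suc n))" c] by simp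
    qed (use nonneg in auto)
    also have "\<dots> = real (Suc n) * c * exp (\<alpha> * real (Suc n))"
      by (simp add: algebra_simps exp_add)
    finally show ?case .
  qed
  show "n \<le> N \<Longrightarrow> e n \<le> real N * c * exp (\<alpha> * real N)"
    using le mono by (meson order_trans)
qed

text \<open>The iteration in an arbitrary normed space, where norms and Lipschitz estimates can be
  used directly.\<close>

fun parareal_seq :: "('a \<Rightarrow> 'a) \<Rightarrow> ('a \<Rightarrow> 'a) \<Rightarrow> 'a \<Rightarrow> nat \<Rightarrow> nat \<Rightarrow> 'a :: real_normed_vector" where
  "parareal_seq F G x0 k 0 = x0"
| "parareal_seq F G x0 0 (Suc n) = G (parareal_seq F G x0 0 n)"
| "parareal_seq F G x0 (Suc k) (Suc n) =
     G (parareal_seq F G x0 (Suc k) n) + F (parareal_seq F G x0 k n) - G (parareal_seq F G x0 k n)"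

text \<open>The solution satisfies U (n + 1) = G (U n) + (F - G) (U n), so in a sweep the errors
  propagate through \<open>G\<close> with a source given by the defect applied to the previous
  sweep. Summing sources of size d \<theta>^k over N steps produces \<theta>^(k + 1).\<close>

lemma parareal_seq_error:
  fixes F G :: "'a :: real_normed_vector \<Rightarrow> 'a" and U :: "nat \<Rightarrow> 'a"
  assumes U: "\<And>n. n < N \<Longrightarrow> U (Suc n) = F (U n)" and UR: "\<And>n. n \<le> N \<Longrightarrow> norm (U n) \<le> R - 1"
    and G: "\<And>x y. norm x \<le> R \<Longrightarrow> norm y \<le> R \<Longrightarrow> norm (G x - G y) \<le> (1 + \<alpha>) * norm (x - y)"
    and D: "\<And>x y. norm x \<le> R \<Longrightarrow> norm y \<le> R \<Longrightarrow> norm ((F x - G x) - (F y - G y)) \<le> d * norm (x - y)"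
    and D0: "F 0 - G 0 = 0"
    and nonneg: "\<alpha> \<ge> 0" "d \<ge> 0" "R \<ge> 1"
    and \<theta>: "real N * d * exp (\<alpha> * real N) \<le> \<theta>" "\<theta> * R \<le> 1"
  shows "n \<le> N \<Longrightarrow> norm (parareal_seq F G (U 0) k n - U n) \<le> \<theta> ^ k"
proof (induction k arbitrary: n)
  have \<theta>0: "\<theta> \<ge> 0" using nonneg \<theta>(1) by (meson exp_ge_zero mult_nonneg_nonneg of_nat_0_le_iff order_trans)
  have \<theta>1: "\<theta> \<le> 1" using \<theta>(2) mult_left_mono[OF nonneg(3) \<theta>0] by simp
  have ball: "norm x \<le> R" if "n \<le> N" "norm (x - U n) \<le> 1" for x n
    using that UR[of n] norm_triangle_sub[of x "U n"] by linarith
  have UR': "norm (U n) \<le> R" if "n \<le> N" for n using UR[OF that] by simp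
  {
    case 0
    let ?p = "parareal_seq F G (U 0) 0"
    \<comment> \<open>There is no earlier sweep to compare with; the source is the full defect, at
      most d R, and \<open>\<theta> * R \<le> 1\<close> makes the error at most 1 =
      \<theta>^0.\<close>
    have b: "real N * (d * R) * exp (\<alpha> * real N) \<le> 1"
    proof -
      have "real N * (d * R) * exp (\<alpha> * real N) = real N * d * exp (\<alpha> * real N) * R" by (simp add: mult_ac)
      also have "\<dots> \<le> \<theta> * R" using nonneg by (intro mult_right_mono \<theta>(1)) auto
      finally show ?thesis using \<theta>(2) by linarith
    qed
    have "norm (?p n - U n) \<le> real N * (d * R) * exp (\<alpha> * real N)"
    proof (rule discrete_Gronwall[OF _ _ _ _ b _ 0])
      fix n assume n: "n < N" "norm (?p n - U n) \<le> 1"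
      have "norm (?p (Suc n) - U (Suc n)) = norm ((G (?p n) - G (U n)) - (F (U n) - G (U n)))"
        using U[OF n(1)] by simp
      also have "\<dots> \<le> norm (G (?p n) - G (U n)) + norm (F (U n) - G (U n))"
        by (rule norm_triangle_ineq4)
      also have "\<dots> \<le> (1 + \<alpha>) * norm (?p n - U n) + d * R"
      proof (intro add_mono G)
        have "norm ((F (U n) - G (U n)) - (F 0 - G 0)) \<le> d * norm (U n - 0)"
          using n nonneg by (intro D UR') auto
        also have "\<dots> \<le> d * R" using UR'[of n] n nonneg by (intro mult_left_mono) auto
        finally show "norm (F (U n) - G (U n)) \<le> d * R" by (simp add: D0)
      qed (use n in \<open>auto intro: ball[of n] UR'\<close>)
      finally show "norm (?p (Suc n) - U (Suc n)) \<le> (1 + \<alpha>) * norm (?p n - U n) + d * R" .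
    qed (use nonneg in auto)
    then show ?case using b by simp
  next
    case (Suc k)
    let ?p = "parareal_seq F G (U 0)"
    have \<theta>k: "\<theta> ^ k \<le> 1" by (rule power_le_one[OF \<theta>0 \<theta>1])
    have b: "real N * (d * \<theta> ^ k) * exp (\<alpha> * real N) \<le> \<theta> * \<theta> ^ k"
      using mult_right_mono[OF \<theta>(1), of "\<theta> ^ k"] \<theta>0 by (simp add: mult_ac)
    also have "\<theta> * \<theta> ^ k \<le> 1" using power_le_one[OF \<theta>0 \<theta>1, of "Suc k"] by simp
    finally have b1: "real N * (d * \<theta> ^ k) * exp (\<alpha> * real N) \<le> 1" .
    have "norm (?p (Suc k) n - U n) \<le> real N * (d * \<theta> ^ k) * exp (\<alpha> * real N)"
    proof (rule discrete_Gronwall[OF _ _ _ _ b1 _ Suc.prems])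
      fix n assume n: "n < N" "norm (?p (Suc k) n - U n) \<le> 1"
      have pk: "norm (?p k n - U n) \<le> \<theta> ^ k" using Suc.IH n by simp
      have "?p (Suc k) (Suc n) - U (Suc n)
          = (G (?p (Suc k) n) - G (U n)) + ((F (?p k n) - G (?p k n)) - (F (U n) - G (U n)))"
        using U[OF n(1)] by (simp add: algebra_simps)
      also have "norm \<dots> \<le> (1 + \<alpha>) * norm (?p (Suc k) n - U n) + d * \<theta> ^ k"
      proof (intro norm_triangle_le add_mono G)
        have "norm ((F (?p k n) - G (?p k n)) - (F (U n) - G (U n))) \<le> d * norm (?p k n - U n)"
          using n pk \<theta>k by (intro D UR' ball[of n]) auto
        also have "\<dots> \<le> d * \<theta> ^ k" using pk nonneg by (intro mult_left_mono) auto
        finally show "norm ((F (?p k n) - G (?p k n)) - (F (U n) - G (U n))) \<le> d * \<theta> ^ k" .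
      qed (use n in \<open>auto intro: ball[of n] UR'\<close>)
      finally show "norm (?p (Suc k) (Suc n) - U (Suc n)) \<le> (1 + \<alpha>) * norm (?p (Suc k) n - U n) +
          d * \<theta> ^ k" .
    qed (use nonneg \<theta>0 in auto)
    then show ?case using b by simp
  }
qed

text \<open>Membership in \<open>sobolev r\<close> is asserted together with the estimate because a
  divergent infinite sum has the value 0, so a bound on the norm alone would not guarantee
  regularity of the iterates.\<close>

theorem corollary4p2:
  fixes \<mu> T r :: real and u0 :: "real \<Rightarrow> complex" and u :: "real \<Rightarrow> real \<Rightarrow> complex"
  assumes "T > 0" and "r > 3/2"
    and "nls_mild_solution \<mu> r T u0 u"
  shows "\<exists>\<tau>0 C1 C2 :: real. \<tau>0 > 0 \<and> C1 > 0 \<and> C2 > 0 \<and>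
    (\<forall>Nc::nat. \<forall>\<tau>::real. Nc \<ge> 1 \<and> \<tau> = T / real Nc \<and> \<tau> \<le> \<tau>0 \<longrightarrow>
      (\<forall>k::nat.
        (\<forall>n\<in>{1..Nc}.
          parareal (fine_propagator \<mu> r \<tau>) (coarse_propagator \<mu> \<tau>) u0 k n \<in> sobolev r) \<and>
        Max ((\<lambda>n. sobolev_norm r (\<lambda>x.
            parareal (fine_propagator \<mu> r \<tau>) (coarse_propagator \<mu> \<tau>) u0 k n x
            - u (real n * \<tau>) x)) ` {1..Nc})
          \<le> C1 * (C2 * \<tau>) ^ k))"
proof -
  interpret nls \<mu> r by standard (use assms in simp)
  obtain V w where V: "u0 = ev r V" "solves T V w" and uw: "\<And>t. t \<in> {0..T} \<Longrightarrow> u t = ev r (sg t (w t))"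
    using assms(1,3) unfolding mild_solution_iff[OF less_imp_le[OF assms(1)]] by blast
  obtain M where M: "\<And>t. t \<in> {0..T} \<Longrightarrow> norm (w t) \<le> M" using solves_bounded[OF V(2)] by blast
  \<comment> \<open>One unit more than the bound on the solution leaves room for iterates at
    distance at most 1.\<close>
  define R where "R = M + 1"
  have "norm (w 0) \<le> M" using assms(1) by (intro M) auto
  then have R: "R \<ge> 1" unfolding R_def using norm_ge_zero[of "w 0"] by linarith
  \<comment> \<open>The growth rate of the coarse propagator: the rate of the exact flow plus that
    of the defect.\<close>
  define a where "a = 6 * (\<bar>\<mu>\<bar> * algc r) * (R + 1)\<^sup>2 + defect_const R"
  have a0: "a \<ge> 0" unfolding a_def by (intro add_nonneg_nonneg mult_nonneg_nonneg algc_nonneg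
      defect_const_nonneg) auto
  \<comment> \<open>This is C2: N steps, each with defect constant of order \<tau>^2, amount to T
    \<tau> because N \<tau> = T. The added 1 makes it positive.\<close>
  define B where "B = T * defect_const R * exp (a * T) + 1"
  have B: "B > 0" unfolding B_def using assms(1) by (intro add_nonneg_pos mult_nonneg_nonneg
      defect_const_nonneg) auto
  define S where "S = 3 * (\<bar>\<mu>\<bar> * algc r) * (R + 1) ^ 3"
  have S0: "S \<ge> 0" unfolding S_def using R by (intro mult_nonneg_nonneg algc_nonneg) auto
  \<comment> \<open>Chosen so that \<tau> \<le> 1, \<tau> S \<le> 1/2 (smallness for Picard
    iteration) and \<tau> B R \<le> 1 (control of the initial sweep) hold at once.\<close>
  define \<tau>0 where "\<tau>0 = 1 / (1 + 2 * S + B * R)"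
  have den: "1 + 2 * S + B * R > 0" using S0 B R by (simp add: add_pos_nonneg)
  let ?par = "\<lambda>\<tau>. parareal (fine_propagator \<mu> r \<tau>) (coarse_propagator \<mu> \<tau>) u0"
  have main: "?par \<tau> k n \<in> sobolev r \<and>
      sobolev_norm r (\<lambda>x. ?par \<tau> k n x - u (real n * \<tau>) x) \<le> (B * \<tau>) ^ k"
    if N: "N \<ge> 1" and \<tau>: "\<tau> = T / real N" "\<tau> \<le> \<tau>0" and n: "n \<le> N" for N \<tau> k n
  proof -
    have \<tau>pos: "\<tau> > 0" using \<tau>(1) N assms(1) by simp
    have N\<tau>: "real N * \<tau> = T" using \<tau>(1) N by simp
    have "\<tau> * (1 + 2 * S + B * R) \<le> 1" using \<tau>(2) den by (simp add: \<tau>0_def field_simps)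
    then have sum: "\<tau> + 2 * (\<tau> * S) + \<tau> * (B * R) \<le> 1" by (simp add: algebra_simps)
    have p: "0 \<le> \<tau> * S" "0 \<le> \<tau> * (B * R)" using \<tau>pos S0 B R by auto
    have \<tau>1: "\<tau> \<le> 1" and \<tau>S: "\<tau> * S \<le> 1/2" and "\<tau> * (B * R) \<le> 1"
      using sum p \<tau>pos by linarith+
    then have BR: "(B * \<tau>) * R \<le> 1" by (simp add: mult_ac)
    have sm: "small R \<tau>"
      unfolding small_def S_def[symmetric] using \<tau>S \<tau>pos R by simp
    define U where "U = (\<lambda>n. sg (real n * \<tau>) (w (real n * \<tau>)))"
    have in_T: "real n * \<tau> \<in> {0..T}" if "n \<le> N" for n
      using that \<tau>pos N\<tau> mult_right_mono[of "real n" "real N" \<tau>] by auto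
    have u_U: "u (real n * \<tau>) = ev r (U n)" if "n \<le> N" for n
      using uw[OF in_T[OF that]] by (simp add: U_def)
    have U_step: "U (Suc n) = exact_flow \<tau> (U n)" if "n < N" for n
    proof -
      have "real n * \<tau> + \<tau> = real (Suc n) * \<tau>" by (simp add: algebra_simps)
      then show ?thesis
        using exact_flow_solves[OF V(2), of "real n * \<tau>" \<tau>] in_T[of "Suc n"] that \<tau>pos by (simp add: U_def)
    qed
    have U_norm: "norm (U n) \<le> R - 1" if "n \<le> N" for n
      using M[OF in_T[OF that]] by (simp add: U_def R_def)
    let ?d = "defect_const R * \<tau>\<^sup>2"
    have defect: "norm ((exact_flow \<tau> x - coarse \<tau> x) - (exact_flow \<tau> y - coarse \<tau> y)) \<le> ?d * norm (x - y)"
      if "norm x \<le> R" "norm y \<le> R" for x y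
      by (rule defect_lip[OF assms(2) that sm \<tau>1])
    have coarse_lip: "norm (coarse \<tau> x - coarse \<tau> y) \<le> (1 + a * \<tau>) * norm (x - y)"
      if xy: "norm x \<le> R" "norm y \<le> R" for x y
    proof -
      have "coarse \<tau> x - coarse \<tau> y = (exact_flow \<tau> x - exact_flow \<tau> y)
          - ((exact_flow \<tau> x - coarse \<tau> x) - (exact_flow \<tau> y - coarse \<tau> y))" by simp
      also have "norm \<dots> \<le> (1 + 6 * (\<bar>\<mu>\<bar> * algc r) * (R + 1)\<^sup>2 * \<tau>) * norm (x - y) + ?d * norm (x - y)"
        by (rule order_trans[OF norm_triangle_ineq4 add_mono[OF exact_flow_lip[OF xy sm] defect[OF xy]]])
      also have "?d * norm (x - y) \<le> (defect_const R * \<tau>) * norm (x - y)"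
        using \<tau>1 \<tau>pos defect_const_nonneg
        by (intro mult_right_mono mult_left_mono) (auto simp: power2_eq_square mult_left_le)
      finally show ?thesis by (simp add: a_def algebra_simps)
    qed
    have \<theta>: "real N * ?d * exp (a * \<tau> * real N) \<le> B * \<tau>"
    proof -
      have "real N * ?d * exp (a * \<tau> * real N) = (real N * \<tau>) * defect_const R * exp (a * (real N * \<tau>)) * \<tau>"
        by (simp add: power2_eq_square mult_ac)
      also have "\<dots> \<le> B * \<tau>"
        unfolding N\<tau> B_def using \<tau>pos by (intro mult_right_mono) auto
      finally show ?thesis .
    qed
    let ?p = "parareal_seq (exact_flow \<tau>) (coarse \<tau>) (U 0)"
    have err: "norm (?p k n - U n) \<le> (B * \<tau>) ^ k" if "n \<le> N" for k n
      by (rule parareal_seq_error[where N = N and R = R and \<alpha> = "a * \<tau>" and d = ?d])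
        (use U_step U_norm coarse_lip defect defect_0[OF assms(2)] \<theta> BR that R a0 \<tau>pos
            defect_const_nonneg in auto)
    have "B * \<tau> * 1 \<le> B * \<tau> * R" using R B \<tau>pos by (intro mult_left_mono) auto
    then have "B * \<tau> \<le> 1" using BR by linarith
    then have "(B * \<tau>) ^ k \<le> 1" for k using B \<tau>pos by (intro power_le_one) auto
    then have ball: "norm (?p k n) \<le> R" if "n \<le> N" for k n
      using err[OF that, of k] U_norm[OF that] norm_triangle_sub[of "?p k n" "U n"]
      by (smt (verit, best))
    have U0: "u0 = ev r (U 0)" using V assms(1) by (simp add: U_def solves_def)
    have coarse_ev: "coarse_propagator \<mu> \<tau> (ev r x) = ev r (coarse \<tau> x)" for x
      unfolding coarse_def by (rule coarse_propagator_ev[OF assms(2)]) (use \<tau>pos in simp)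
    \<comment> \<open>The error bound for sequences has to come first: the fine propagator is known
      to equal the exact flow only at points of the ball, and \<open>ball\<close> places every
      iterate there.\<close>
    have par: "n \<le> N \<Longrightarrow> ?par \<tau> k n = ev r (?p k n)" for k n
    proof (induction k arbitrary: n)
      case 0
      then show ?case by (induction n) (simp_all add: U0 coarse_ev)
    next
      case (Suc k)
      show ?case
        using Suc.prems
      proof (induction n)
        case (Suc n)
        then have "norm (?p k n) \<le> R" by (intro ball) simp
        with Suc \<open>\<And>n. n \<le> N \<Longrightarrow> ?par \<tau> k n = ev r (?p k n)\<close> show ?case
          by (simp add: coarse_ev fine_propagator_ev[OF _ sm] ev_add[OF r] ev_diff[OF r])
      qed (simp add: U0)
    qed
    show ?thesis
      using err[OF n, of k] by (simp add: par[OF n] u_U[OF n] ev_in_sobolev[OF r] sobolev_norm_diff_ev)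
  qed
  show ?thesis
  proof (rule exI[of _ \<tau>0], rule exI[of _ 1], rule exI[of _ B], intro conjI allI impI)
    show "\<tau>0 > 0" using den by (simp add: \<tau>0_def)
    fix N \<tau> k
    assume N: "1 \<le> N \<and> \<tau> = T / real N \<and> \<tau> \<le> \<tau>0"
    show "\<forall>n\<in>{1..N}. ?par \<tau> k n \<in> sobolev r"
      using main N by simp
    show "Max ((\<lambda>n. sobolev_norm r (\<lambda>x.
            ?par \<tau> k n x
            - u (real n * \<tau>) x)) ` {1..N}) \<le> 1 * (B * \<tau>) ^ k"
      using N main by (subst Max_le_iff) auto
  qed (use B in auto)
qed

end
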